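(* Let $\alpha,\beta_w^+\in(0,1)$ be constants and let $n\to\infty$ with $m=\alpha n$ and $k=\beta_w^+ n$. Let $A$ be an $m\times n$ matrix with i.i.d. standard normal entries. Fix a set $S\subset\{1,\dots,n\}$ with $|S|=k$, and consider $k$-sparse vectors $\mathbf{x}\in\mathbb{R}^n$ with $\mathbf{x}_i=0$ for $i\notin S$ whose nonzero components are a priori known to be positive. For $\mathbf{y}=A\mathbf{x}$ consider $$\min_{\mathbf{u}}\ \|\mathbf{u}\|_1\quad\text{subject to}\quad A\mathbf{u}=\mathbf{y},\ \ \mathbf{u}_i\ge 0\ (1\le i\le n).\qquad(\ast\ast)$$ Let $\epsilon_1^{(c)},\epsilon_2^{(c)},\epsilon_1^{(m)},\epsilon_1^{(g)},\epsilon_3^{(g)}>0$ be arbitrarily small constants independent of $n$. (1) Let $\hat\theta_w^+\in[\beta_w^+,1]$ be the solution of $$(1-\epsilon_1^{(c)})(1-\beta_w^+)\frac{\sqrt{\frac{1}{2\pi}}\,e^{-(\operatorname{erfinv}(2\frac{1-\theta}{1-\beta_w^+}-1))^2}}{\theta}-\sqrt{2}\operatorname{erfinv}\Big(2\frac{(1+\epsilon_1^{(c)})(1-\theta)}{1-\beta_w^+}-1\Big)=0.$$ If $$\alpha>\frac{1-\beta_w^+}{\sqrt{2\pi}}\cdot\frac{\sqrt{2(\operatorname{erfinv}(2\frac{1-\hat\theta_w^+}{1-\beta_w^+}-1))^2}}{e^{(\operatorname{erfinv}(2\frac{1-\hat\theta_w^+}{1-\beta_w^+}-1))^2}}+\hat\theta_w^+-\frac{\left((1-\beta_w^+)\sqrt{\frac{1}{2\pi}}\,e^{-(\operatorname{erfinv}(2\frac{1-\hat\theta_w^+}{1-\beta_w^+}-1))^2}\right)^2}{\hat\theta_w^+},$$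 then with overwhelming probability the solution of $(\ast\ast)$ is the positive $k$-sparse $\mathbf{x}$. (2) Let $\hat\theta_w^+\in[\beta_w^+,1]$ be the solution of $$(1+\epsilon_2^{(c)})(1-\beta_w^+)\frac{\sqrt{\frac{1}{2\pi}}\,e^{-(\operatorname{erfinv}(2\frac{1-\theta}{1-\beta_w^+}-1))^2}}{\theta}-\sqrt{2}\operatorname{erfinv}\Big(2\frac{(1-\epsilon_2^{(c)})(1-\theta)}{1-\beta_w^+}-1\Big)=0.$$ If $$\alpha<\frac{1}{(1+\epsilon_1^{(m)})^2}\left((1-\epsilon_1^{(g)})\Big(\hat\theta_w^++\frac{1-\beta_w^+}{\sqrt{2\pi}}\frac{\sqrt{2(\operatorname{erfinv}(2\frac{1-\hat\theta_w^+}{1-\beta_w^+}-1))^2}}{e^{(\operatorname{erfinv}(2\frac{1-\hat\theta_w^+}{1-\beta_w^+}-1))^2}}\Big)-(1+\epsilon_3^{(g)})^{2}\frac{\left((1-\beta_w^+)\sqrt{\frac{1}{2\pi}}\,e^{-(\operatorname{erfinv}(2\frac{1-\hat\theta_w^+}{1-\beta_w^+}-1))^2}\right)^2}{\hat\theta_w^+}\right),$$ then with overwhelming probability there is a positive $k$-sparse $\mathbf{x}$ with nonzero components located in $S$ that satisfies $A\mathbf{x}=\mathbf{y}$ and is not the solution of $(\ast\ast)$.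
   Context: $\operatorname{erfinv}$ is the inverse of the standard error function $\operatorname{erf}(t)=\frac{2}{\sqrt{\pi}}\int_0^t e^{-s^2}\,ds$. "With overwhelming probability" means with probability at least $1-e^{-cn}$ for some constant $c>0$ independent of $n$ (for all large $n$). "The solution of $(\ast\ast)$ is $\mathbf{x}$" means $\mathbf{x}$ is the unique minimizer of $(\ast\ast)$. *)

theory Defs
  imports "HOL-Probability.Probability"
begin

text \<open>Standard error function erf(t) = 2/sqrt(pi) * int_0^t exp(-s^2) ds
  (oriented integral, so erf is odd) and its inverse on (-1,1).\<close>
definition erf :: "real \<Rightarrow> real" where
  "erf t = 2 / sqrt pi * (LBINT s=0..t. exp (- s\<^sup>2))"

definition erfinv :: "real \<Rightarrow> real" where
  "erfinv y = (THE t. erf t = y)"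

definition gaussian_matrix :: "nat \<Rightarrow> nat \<Rightarrow> (nat \<times> nat \<Rightarrow> real) measure" where
  "gaussian_matrix m n =
     PiM ({0..<m} \<times> {0..<n}) (\<lambda>_. density lborel std_normal_density)"

text \<open>Vectors in R^n are functions nat => real, only indices < n matter.\<close>
definition l1norm :: "nat \<Rightarrow> (nat \<Rightarrow> real) \<Rightarrow> real" where
  "l1norm n u = (\<Sum>j<n. \<bar>u j\<bar>)"

definition matvec :: "nat \<Rightarrow> (nat \<times> nat \<Rightarrow> real) \<Rightarrow> (nat \<Rightarrow> real) \<Rightarrow> nat \<Rightarrow> real" where
  "matvec n A u i = (\<Sum>j<n. A (i, j) * u j)"

definition unique_pos_l1_solution ::
  "nat \<Rightarrow> nat \<Rightarrow> (nat \<times> nat \<Rightarrow> real) \<Rightarrow> (nat \<Rightarrow> real) \<Rightarrow> bool" where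
  "unique_pos_l1_solution m n A x \<longleftrightarrow>
     (\<forall>i<n. 0 \<le> x i) \<and>
     (\<forall>u. (\<forall>i<n. 0 \<le> u i) \<and> (\<forall>i<m. matvec n A u i = matvec n A x i)
          \<and> (\<exists>i<n. u i \<noteq> x i) \<longrightarrow> l1norm n x < l1norm n u)"

definition gw :: "real \<Rightarrow> real \<Rightarrow> real" where
  "gw \<beta> \<theta> = erfinv (2 * (1 - \<theta>) / (1 - \<beta>) - 1)"

text \<open>theta is a solution in [beta,1] of
  (1 - a)(1-beta) sqrt(1/(2pi)) e^{-g(theta)^2}/theta - sqrt 2 erfinv(2 (1+b)(1-theta)/(1-beta) - 1) = 0,
  with both erfinv arguments in the domain (-1,1).\<close>
definition theta_eq_solution :: "real \<Rightarrow> real \<Rightarrow> real \<Rightarrow> real \<Rightarrow> bool" where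
  "theta_eq_solution a b \<beta> \<theta> \<longleftrightarrow>
     \<beta> \<le> \<theta> \<and> \<theta> \<le> 1 \<and>
     \<bar>2 * (1 - \<theta>) / (1 - \<beta>) - 1\<bar> < 1 \<and>
     \<bar>2 * ((1 + b) * (1 - \<theta>)) / (1 - \<beta>) - 1\<bar> < 1 \<and>
     (1 - a) * (1 - \<beta>) * (sqrt (1 / (2 * pi)) * exp (- (gw \<beta> \<theta>)\<^sup>2)) / \<theta>
       - sqrt 2 * erfinv (2 * ((1 + b) * (1 - \<theta>)) / (1 - \<beta>) - 1) = 0"

end

theory Submission
  imports Defs
begin

text \<open>
  All vectors supported on \<open>S\<close> and nonnegative there are recovered iff the kernel of \<open>A\<close> meets the cone of
  vectors that are nonnegative off \<open>S\<close> and have nonpositive sum only in \<open>0\<close>. The probability of this event is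
  compared with the distribution of the dimension of the face of this cone onto which a Gaussian
  vector \<open>g\<close> is projected.

  Distinguish one row of \<open>A\<close> (to show that the intersection is trivial) or one column in \<open>S\<close> (to show that it is
  not), and consider the quadratic program over the cone in which the distinguished row is the linear
  objective, respectively in which the vector of least norm mapped to the distinguished column is sought.
  If the optimum lies in a given face, the optimality conditions split into a
  condition on a vector whose law in the span of the face is rotation invariant, and one on a vector that is
  conditionally Gaussian in the orthogonal complement. Hence this
  event has the same probability as that of the projection of \<open>g\<close> lying in the face. Optima are unique, so
  these events are disjoint and their probabilities add up to that of the dimension being on the right
  side of the number of rows.

  The dimension of the face is \<open>\<bar>S\<bar> - 1\<close> plus the number of entries of \<open>g\<close> off \<open>S\<close> above a threshold that solves an
  explicit scalar equation, so Chernoff bounds show that it concentrates exponentially at \<open>n\<close> times the zero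
  of the unperturbed equation for \<open>\<theta>\<close>. A monotonicity argument compares this with the two bounds on \<open>\<alpha>\<close>.
\<close>

section \<open>Reflection invariance of Gaussian measures\<close>

text \<open>The comparison with \<open>g\<close> works because every condition to be compared is
  invariant under positive scaling. The optimal coefficients are not Gaussian, but a nonzero random
  vector with rotation invariant law has a uniformly distributed direction, so it lies in a cone as
  often as a Gaussian vector does. Reflections suffice in place of all rotations, since the
  reflection along a difference exchanges two vectors of equal length.

  A distinguished row or column is needed because the bare question whether a kernel meets a cone
  singles out no face, whereas the optimum of a program does. The spans of the faces consist of
  zero-sum vectors and are not coordinate subspaces, hence the extra reflection along
  \<open>axis_vec\<close>.

  For each face only a lower bound for the probability of a certificate is proved. This is enough:
  certificates of different faces exclude each other, and both claims are lower bounds. So neither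
  the existence of an optimum nor the measurability of the set of all certified matrices is at
  stake; a measurable set of certified matrices, obtained from explicit solutions of linear systems,
  serves instead.\<close>

abbreviation stdn :: "real measure" where
  "stdn \<equiv> density lborel std_normal_density"

text \<open>The index set is arbitrary, so that a whole matrix, a block of it and a single vector
  are all instances, and disjoint blocks can be split off by \<open>merge\<close>.\<close>

definition gauss :: "'a set \<Rightarrow> ('a \<Rightarrow> real) measure" where
  "gauss I = PiM I (\<lambda>_. stdn)"

definition inner_on :: "'a set \<Rightarrow> ('a \<Rightarrow> real) \<Rightarrow> ('a \<Rightarrow> real) \<Rightarrow> real" where
  "inner_on I x y = (\<Sum>i\<in>I. x i * y i)"

text \<open>If \<open>u\<close> vanishes on \<open>I\<close>, the quotient is \<open>0\<close> by
  the convention for division by zero and the map is the identity on \<open>I\<close>. This is why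
  the invariance statements carry no nondegeneracy hypothesis.\<close>

definition refl_on_set :: "'a set \<Rightarrow> ('a \<Rightarrow> real) \<Rightarrow> ('a \<Rightarrow> real) \<Rightarrow> 'a \<Rightarrow> real" where
  "refl_on_set I u x = (\<lambda>i\<in>I. x i - 2 * inner_on I u x / inner_on I u u * u i)"

lemma prob_space_stdn: "prob_space stdn"
  by (rule prob_space_normal_density) simp

lemma product_prob_space_stdn: "product_prob_space (\<lambda>_. stdn)"
  by (intro product_prob_spaceI prob_space_stdn)

lemma product_sigma_finite_stdn: "product_sigma_finite (\<lambda>_. stdn)"
  using product_prob_space_stdn unfolding product_prob_space_def by blast

lemma prob_space_gauss: "prob_space (gauss I)"
  unfolding gauss_def by (intro prob_space_PiM prob_space_stdn)

lemma sets_gauss [measurable_cong]: "sets (gauss I) = sets (PiM I (\<lambda>_. borel))"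
  unfolding gauss_def by (intro sets_PiM_cong) auto

lemma space_gauss: "space (gauss I) = extensional I"
  unfolding gauss_def by (auto simp: space_PiM PiE_def)

lemma gaussian_matrix_eq_gauss: "gaussian_matrix m n = gauss ({0..<m} \<times> {0..<n})"
  unfolding gaussian_matrix_def gauss_def ..

lemma product_sigma_finite_lborel: "product_sigma_finite (\<lambda>_. lborel :: real measure)"
  by unfold_locales

lemma measurable_inner_on [measurable]:
  assumes "\<And>i. i \<in> I \<Longrightarrow> (\<lambda>w. x w i) \<in> borel_measurable M"
    and "\<And>i. i \<in> I \<Longrightarrow> (\<lambda>w. y w i) \<in> borel_measurable M"
  shows "(\<lambda>w. inner_on I (x w) (y w)) \<in> borel_measurable M"
  unfolding inner_on_def using assms by (intro borel_measurable_sum) auto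

lemma inner_on_commute: "inner_on I x y = inner_on I y x"
  by (simp add: inner_on_def mult.commute)

lemma inner_on_self_nonneg: "0 \<le> inner_on I x x"
  by (simp add: inner_on_def sum_nonneg)

lemma inner_on_self_eq_0_iff: "finite I \<Longrightarrow> inner_on I x x = 0 \<longleftrightarrow> (\<forall>i\<in>I. x i = 0)"
  by (subst inner_on_def, subst sum_nonneg_eq_0_iff) auto

lemma distr_PiM_lborel_shift:
  assumes "finite I"
  shows "distr (PiM I (\<lambda>_. lborel :: real measure)) (PiM I (\<lambda>_. lborel)) (\<lambda>x. \<lambda>i\<in>I. x i + c i)
    = PiM I (\<lambda>_. lborel)" (is "?D = _")
proof -
  interpret product_sigma_finite "\<lambda>_. lborel :: real measure" by (rule product_sigma_finite_lborel)
  show ?thesis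
  proof (rule PiM_eqI[OF assms])
    fix A :: "'a \<Rightarrow> real set" assume A: "\<And>i. i \<in> I \<Longrightarrow> A i \<in> sets lborel"
    have *: "(\<lambda>x. \<lambda>i\<in>I. x i + c i) -` PiE I A \<inter> space (PiM I (\<lambda>_. lborel)) = PiE I (\<lambda>i. (\<lambda>x. x + c i) -` A i)"
      by (auto simp: space_PiM PiE_iff)
    have m: "(\<lambda>x. x + c i) -` A i \<in> sets borel" if "i \<in> I" for i
      using measurable_sets[of "\<lambda>x. x + c i" borel borel "A i"] A[OF that] by simp
    have **: "emeasure lborel ((\<lambda>x. x + c i) -` A i) = emeasure lborel (A i)" if "i \<in> I" for i
    proof -
      have "emeasure lborel (A i) = emeasure (distr lborel borel ((+) (c i))) (A i)"
        by (simp add: lborel_distr_plus)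
      also have "\<dots> = emeasure lborel ((+) (c i) -` A i)"
        using A[OF that] by (subst emeasure_distr) auto
      also have "(+) (c i) -` A i = (\<lambda>x. x + c i) -` A i" by (auto simp: add.commute)
      finally show ?thesis by simp
    qed
    have "emeasure ?D (PiE I A) = emeasure (PiM I (\<lambda>_. lborel)) (PiE I (\<lambda>i. (\<lambda>x. x + c i) -` A i))"
      using A assms by (subst emeasure_distr) (auto simp: * intro!: measurable_restrict sets_PiM_I_finite)
    also have "\<dots> = (\<Prod>i\<in>I. emeasure lborel ((\<lambda>x. x + c i) -` A i))"
      using m by (intro emeasure_PiM[OF assms]) auto
    finally show "emeasure ?D (PiE I A) = (\<Prod>i\<in>I. emeasure lborel (A i))"
      using ** by simp
  qed simp
qed

lemma nn_integral_refl_lborel: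
  fixes f :: "('a \<Rightarrow> real) \<Rightarrow> ennreal"
  assumes I: "finite I" and f: "f \<in> borel_measurable (PiM I (\<lambda>_. lborel))"
  shows "(\<integral>\<^sup>+x. f (refl_on_set I u x) \<partial>PiM I (\<lambda>_. lborel)) = (\<integral>\<^sup>+x. f x \<partial>PiM I (\<lambda>_. lborel))"
proof (cases "\<forall>i\<in>I. u i = 0")
  case True
  then have "refl_on_set I u x = x" if "x \<in> space (PiM I (\<lambda>_. lborel))" for x
    using that by (auto simp: refl_on_set_def space_PiM PiE_def extensional_def fun_eq_iff)
  then show ?thesis by (intro nn_integral_cong) simp
next
  case False
  then obtain i where i: "i \<in> I" "u i \<noteq> 0" by auto
  define J where "J = I - {i}"
  have J: "finite J" "i \<notin> J" "insert i J = I" using I i by (auto simp: J_def)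
  interpret P: product_sigma_finite "\<lambda>_. lborel :: real measure" by (rule product_sigma_finite_lborel)
  interpret SJ: sigma_finite_measure "PiM J (\<lambda>_. lborel :: real measure)"
    by (rule P.sigma_finite[OF J(1)])
  interpret PS: pair_sigma_finite "PiM J (\<lambda>_. lborel :: real measure)" "lborel :: real measure" ..
  define a where "a = u i"
  define U where "U = inner_on I u u"
  define s0 where "s0 = (\<lambda>x. inner_on J u x)"
  have a: "a \<noteq> 0" using i by (simp add: a_def)
  have U: "U > 0" using False inner_on_self_eq_0_iff[OF I, of u] inner_on_self_nonneg[of I u]
    by (auto simp: U_def less_le)
  have UJ: "U = a\<^sup>2 + inner_on J u u"
    unfolding U_def inner_on_def a_def using J(1,2)
    by (simp add: J(3)[symmetric] power2_eq_square)
  \<comment> \<open>\<open>G x s\<close> is the reflection of the point with entries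
    \<open>x\<close> on \<open>J\<close> and inner product \<open>s\<close> with \<open>u\<close>;
    \<open>G' x s\<close> is the point with entries \<open>x\<close> on \<open>J\<close> and inner
    product \<open>- s\<close>. Translating \<open>x\<close> along \<open>u\<close> turns the first
    into the second.\<close>
  define G where "G = (\<lambda>x s. \<lambda>j\<in>insert i J. (if j = i then (s - s0 x) / a else x j) - 2 * s / U * u j)"
  define G' where "G' = (\<lambda>x s. \<lambda>j\<in>insert i J. (if j = i then (- s - s0 x) / a else x j))"
  have ms0[measurable]: "s0 \<in> borel_measurable (PiM J (\<lambda>_. lborel))"
    unfolding s0_def by (intro measurable_inner_on) auto
  have mc: "(\<lambda>p. fst p j) \<in> borel_measurable (PiM J (\<lambda>_. lborel) \<Otimes>\<^sub>M lborel)" if "j \<in> J" for j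
    using that by simp
  have fm[measurable]: "f \<in> borel_measurable (PiM (insert i J) (\<lambda>_. lborel))" using f J by simp
  have "(\<lambda>p. G (fst p) (snd p)) \<in> measurable (PiM J (\<lambda>_. lborel) \<Otimes>\<^sub>M lborel) (PiM (insert i J) (\<lambda>_. lborel))"
    unfolding G_def using J mc by (intro measurable_restrict) auto
  from measurable_compose[OF this fm] have mG: "(\<lambda>(x,s). f (G x s)) \<in> borel_measurable (PiM J (\<lambda>_. lborel) \<Otimes>\<^sub>M lborel)"
    by (simp add: case_prod_beta')
  have "(\<lambda>p. G' (fst p) (snd p)) \<in> measurable (PiM J (\<lambda>_. lborel) \<Otimes>\<^sub>M lborel) (PiM (insert i J) (\<lambda>_. lborel))"
    unfolding G'_def using J mc by (intro measurable_restrict) auto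
  from measurable_compose[OF this fm] have mG': "(\<lambda>(x,s). f (G' x s)) \<in> borel_measurable (PiM J (\<lambda>_. lborel) \<Otimes>\<^sub>M lborel)"
    by (simp add: case_prod_beta')
  have mrefl: "refl_on_set I u \<in> measurable (PiM I (\<lambda>_. lborel)) (PiM I (\<lambda>_. lborel))"
    unfolding refl_on_set_def[abs_def] by (intro measurable_restrict) auto
  have upd: "inner_on I u (x(i := t)) = s0 x + a * t" for x t
    unfolding inner_on_def s0_def a_def J(3)[symmetric] using J(1,2)
    by (simp, auto intro!: sum.cong)
  have rG: "refl_on_set I u (x(i := t)) = G x (s0 x + a * t)" for x t
    unfolding refl_on_set_def G_def upd J(3) U_def[symmetric] using a by (auto simp: fun_eq_iff)
  have Gx: "(\<lambda>s. f (G x s)) \<in> borel_measurable borel" if "x \<in> space (PiM J (\<lambda>_. lborel))" for x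
    using measurable_compose[OF measurable_Pair1'[OF that] mG] by simp
  have Gs: "(\<lambda>x. f (G x s)) \<in> borel_measurable (PiM J (\<lambda>_. lborel))" for s
    using measurable_compose[OF measurable_Pair2'[of s lborel] mG] by simp
  have G'x: "(\<lambda>s. f (G' x s)) \<in> borel_measurable borel" if "x \<in> space (PiM J (\<lambda>_. lborel))" for x
    using measurable_compose[OF measurable_Pair1'[OF that] mG'] by simp
  have shift: "G (\<lambda>j\<in>J. x j + 2 * s / U * u j) s = G' x s" for x s
  proof -
    have "s0 (\<lambda>j\<in>J. x j + 2 * s / U * u j) = s0 x + 2 * s / U * inner_on J u u"
      unfolding s0_def inner_on_def by (simp add: sum.distrib algebra_simps sum_distrib_left)
    also have "inner_on J u u = U - a\<^sup>2" using UJ by simp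
    finally have e: "s0 (\<lambda>j\<in>J. x j + 2 * s / U * u j) = s0 x + 2 * s / U * (U - a\<^sup>2)" .
    have "(s - s0 (\<lambda>j\<in>J. x j + 2 * s / U * u j)) / a - 2 * s / U * a = (- s - s0 x) / a"
      unfolding e using a U by (simp add: field_simps power2_eq_square)
    then show ?thesis unfolding G_def G'_def using J by (auto simp: fun_eq_iff a_def)
  qed
  have "\<bar>a\<bar> * (\<integral>\<^sup>+x. f (refl_on_set I u x) \<partial>PiM I (\<lambda>_. lborel))
     = \<bar>a\<bar> * (\<integral>\<^sup>+x. \<integral>\<^sup>+t. f (G x (s0 x + a * t)) \<partial>lborel \<partial>PiM J (\<lambda>_. lborel))"
    using P.product_nn_integral_insert[OF J(1,2), of "\<lambda>x. f (refl_on_set I u x)"]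
      measurable_compose[OF mrefl f] unfolding J(3) by (simp add: rG)
  also have "\<dots> = (\<integral>\<^sup>+x. \<bar>a\<bar> * (\<integral>\<^sup>+t. f (G x (s0 x + a * t)) \<partial>lborel) \<partial>PiM J (\<lambda>_. lborel))"
  proof (intro nn_integral_cmult[symmetric])
    have "(\<lambda>(x,t). f (G x (s0 x + a * t))) \<in> borel_measurable (PiM J (\<lambda>_. lborel) \<Otimes>\<^sub>M lborel)"
    proof -
      have "(\<lambda>p. (fst p, s0 (fst p) + a * snd p)) \<in> (PiM J (\<lambda>_. lborel) \<Otimes>\<^sub>M lborel) \<rightarrow>\<^sub>M (PiM J (\<lambda>_. lborel) \<Otimes>\<^sub>M lborel)"
        by measurable
      from measurable_compose[OF this mG] show ?thesis by (simp add: case_prod_beta')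
    qed
    then show "(\<lambda>x. \<integral>\<^sup>+t. f (G x (s0 x + a * t)) \<partial>lborel) \<in> borel_measurable (PiM J (\<lambda>_. lborel))"
      by (rule lborel.borel_measurable_nn_integral)
  qed
  also have "\<dots> = (\<integral>\<^sup>+x. \<integral>\<^sup>+s. f (G x s) \<partial>lborel \<partial>PiM J (\<lambda>_. lborel))"
    by (intro nn_integral_cong nn_integral_real_affine[symmetric] Gx a)
  also have "\<dots> = (\<integral>\<^sup>+s. \<integral>\<^sup>+x. f (G x s) \<partial>PiM J (\<lambda>_. lborel) \<partial>lborel)"
    using mG by (rule PS.Fubini'[symmetric])
  also have "\<dots> = (\<integral>\<^sup>+s. \<integral>\<^sup>+x. f (G' x s) \<partial>PiM J (\<lambda>_. lborel) \<partial>lborel)"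
  proof (rule nn_integral_cong)
    fix s :: real
    have "(\<integral>\<^sup>+x. f (G x s) \<partial>PiM J (\<lambda>_. lborel)) = (\<integral>\<^sup>+x. f (G (\<lambda>j\<in>J. x j + 2 * s / U * u j) s) \<partial>PiM J (\<lambda>_. lborel))"
      by (subst distr_PiM_lborel_shift[OF J(1), of "\<lambda>j. 2 * s / U * u j", symmetric], subst nn_integral_distr)
         (auto intro!: measurable_restrict Gs)
    then show "(\<integral>\<^sup>+x. f (G x s) \<partial>PiM J (\<lambda>_. lborel)) = (\<integral>\<^sup>+x. f (G' x s) \<partial>PiM J (\<lambda>_. lborel))"
      unfolding shift .
  qed
  also have "\<dots> = (\<integral>\<^sup>+x. \<integral>\<^sup>+s. f (G' x s) \<partial>lborel \<partial>PiM J (\<lambda>_. lborel))"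
    using mG' by (rule PS.Fubini')
  also have "\<dots> = (\<integral>\<^sup>+x. \<bar>a\<bar> * (\<integral>\<^sup>+t. f (x(i := t)) \<partial>lborel) \<partial>PiM J (\<lambda>_. lborel))"
  proof (rule nn_integral_cong)
    fix x assume x: "x \<in> space (PiM J (\<lambda>_. lborel :: real measure))"
    have "G' x (- s0 x + (- a) * t) = x(i := t)" for t
      using a x by (auto simp: G'_def fun_eq_iff space_PiM PiE_def extensional_def)
    then show "(\<integral>\<^sup>+s. f (G' x s) \<partial>lborel) = \<bar>a\<bar> * (\<integral>\<^sup>+t. f (x(i := t)) \<partial>lborel)"
      using nn_integral_real_affine[OF G'x[OF x], of "- a" "- s0 x"] a by simp
  qed
  also have "\<dots> = \<bar>a\<bar> * (\<integral>\<^sup>+x. \<integral>\<^sup>+t. f (x(i := t)) \<partial>lborel \<partial>PiM J (\<lambda>_. lborel))"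
  proof (intro nn_integral_cmult)
    have "(\<lambda>(x,t). f (x(i := t))) \<in> borel_measurable (PiM J (\<lambda>_. lborel) \<Otimes>\<^sub>M lborel)" by measurable
    then show "(\<lambda>x. \<integral>\<^sup>+t. f (x(i := t)) \<partial>lborel) \<in> borel_measurable (PiM J (\<lambda>_. lborel))"
      by (rule lborel.borel_measurable_nn_integral)
  qed
  also have "\<dots> = \<bar>a\<bar> * (\<integral>\<^sup>+x. f x \<partial>PiM I (\<lambda>_. lborel))"
    using P.product_nn_integral_insert[OF J(1,2) fm] unfolding J(3) by simp
  finally show ?thesis using a by (simp add: ennreal_mult_cancel_left)
qed

lemma gauss_eq_density:
  assumes "finite I"
  shows "gauss I = density (PiM I (\<lambda>_. lborel)) (\<lambda>x. \<Prod>i\<in>I. ennreal (std_normal_density (x i)))"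
    (is "_ = ?D")
proof -
  interpret L: product_sigma_finite "\<lambda>_. lborel :: real measure" by (rule product_sigma_finite_lborel)
  interpret N: product_sigma_finite "\<lambda>_. stdn" by (rule product_sigma_finite_stdn)
  have "?D = PiM I (\<lambda>_. stdn)"
  proof (rule N.PiM_eqI[OF assms])
    show "sets ?D = sets (PiM I (\<lambda>_. stdn))" by (simp cong: sets_PiM_cong)
    fix A :: "'a \<Rightarrow> real set" assume A: "\<And>i. i \<in> I \<Longrightarrow> A i \<in> sets stdn"
    have PA: "PiE I A \<in> sets (PiM I (\<lambda>_. lborel))"
      using A assms by (intro sets_PiM_I_finite) auto
    have "emeasure ?D (PiE I A) = (\<integral>\<^sup>+x. (\<Prod>i\<in>I. ennreal (std_normal_density (x i))) * indicator (PiE I A) x \<partial>PiM I (\<lambda>_. lborel))"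
      using PA by (intro emeasure_density) auto
    also have "\<dots> = (\<integral>\<^sup>+x. (\<Prod>i\<in>I. ennreal (std_normal_density (x i)) * indicator (A i) (x i)) \<partial>PiM I (\<lambda>_. lborel))"
    proof (intro nn_integral_cong)
      fix x assume x: "x \<in> space (PiM I (\<lambda>_. lborel :: real measure))"
      have "indicator (PiE I A) x = (\<Prod>i\<in>I. indicator (A i) (x i) :: ennreal)"
      proof (cases "x \<in> PiE I A")
        case True then show ?thesis by (auto simp: PiE_iff)
      next
        case False
        then obtain i where "i \<in> I" "x i \<notin> A i" using x by (auto simp: space_PiM PiE_iff)
        with False assms show ?thesis by (auto intro!: bexI[of _ i])
      qed
      then show "(\<Prod>i\<in>I. ennreal (std_normal_density (x i))) * indicator (PiE I A) x
        = (\<Prod>i\<in>I. ennreal (std_normal_density (x i)) * indicator (A i) (x i))"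
        by (simp add: prod.distrib)
    qed
    also have "\<dots> = (\<Prod>i\<in>I. \<integral>\<^sup>+x. ennreal (std_normal_density x) * indicator (A i) x \<partial>lborel)"
      using A by (intro L.product_nn_integral_prod[OF assms]) auto
    also have "\<dots> = (\<Prod>i\<in>I. emeasure stdn (A i))"
      using A by (intro prod.cong) (auto simp: emeasure_density)
    finally show "emeasure ?D (PiE I A) = (\<Prod>i\<in>I. emeasure stdn (A i))" .
  qed
  then show ?thesis by (simp add: gauss_def)
qed

lemma inner_on_refl:
  assumes "finite I"
  shows "inner_on I (refl_on_set I u x) (refl_on_set I u x) = inner_on I x x"
proof -
  define c where "c = 2 * inner_on I u x / inner_on I u u"
  have "inner_on I (refl_on_set I u x) (refl_on_set I u x) = (\<Sum>i\<in>I. (x i - c * u i)\<^sup>2)"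
    unfolding inner_on_def refl_on_set_def c_def by (simp add: power2_eq_square)
  also have "\<dots> = inner_on I x x - 2 * c * inner_on I u x + c\<^sup>2 * inner_on I u u"
    unfolding inner_on_def by (simp add: power2_eq_square algebra_simps sum.distrib sum_subtractf sum_distrib_left)
  also have "\<dots> = inner_on I x x"
  proof (cases "inner_on I u u = 0")
    case False then show ?thesis by (simp add: c_def power2_eq_square)
  qed (simp add: c_def)
  finally show ?thesis .
qed

lemma prod_std_normal_density:
  "finite I \<Longrightarrow> (\<Prod>i\<in>I. ennreal (std_normal_density (x i)))
     = ennreal ((1 / sqrt (2 * pi)) ^ card I * exp (- inner_on I x x / 2))"
  by (subst prod_ennreal)
     (auto simp: std_normal_density_def prod_dividef exp_sum[symmetric] inner_on_def power2_eq_square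
        sum_negf sum_divide_distrib power_divide)

lemma measurable_refl_on_set: "refl_on_set I u \<in> measurable (PiM I (\<lambda>_. borel)) (PiM I (\<lambda>_. borel))"
  unfolding refl_on_set_def[abs_def] by (intro measurable_restrict) auto

text \<open>The density with respect to Lebesgue measure is a function of
  \<open>inner_on I x x\<close> alone, which reflections preserve.\<close>

lemma distr_gauss_refl:
  assumes "finite I"
  shows "distr (gauss I) (PiM I (\<lambda>_. borel)) (refl_on_set I u) = gauss I"
proof (rule measure_eqI)
  show "sets (distr (gauss I) (PiM I (\<lambda>_. borel)) (refl_on_set I u)) = sets (gauss I)"
    by (simp add: sets_gauss)
  fix A assume "A \<in> sets (distr (gauss I) (PiM I (\<lambda>_. borel)) (refl_on_set I u))"
  then have A: "A \<in> sets (PiM I (\<lambda>_. borel))" by simp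
  then have A': "A \<in> sets (PiM I (\<lambda>_. lborel))" by (simp cong: sets_PiM_cong)
  define d :: "('a \<Rightarrow> real) \<Rightarrow> ennreal" where "d = (\<lambda>x. \<Prod>i\<in>I. ennreal (std_normal_density (x i)))"
  have d: "d (refl_on_set I u x) = d x" for x
    unfolding d_def prod_std_normal_density[OF assms] inner_on_refl[OF assms] ..
  have md: "d \<in> borel_measurable (PiM I (\<lambda>_. lborel))" unfolding d_def by measurable
  have mr: "refl_on_set I u \<in> measurable (gauss I) (PiM I (\<lambda>_. borel))"
    by (metis measurable_refl_on_set measurable_cong_sets sets_gauss)
  let ?B = "refl_on_set I u -` A \<inter> space (gauss I)"
  have B: "?B \<in> sets (PiM I (\<lambda>_. lborel))"
    using measurable_sets[OF mr A] by (simp add: sets_gauss cong: sets_PiM_cong)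
  have sp: "space (gauss I) = space (PiM I (\<lambda>_. lborel :: real measure))"
    by (simp add: space_gauss space_PiM PiE_def)
  have "emeasure (distr (gauss I) (PiM I (\<lambda>_. borel)) (refl_on_set I u)) A = emeasure (gauss I) ?B"
    by (rule emeasure_distr[OF mr A])
  also have "\<dots> = (\<integral>\<^sup>+x. d x * indicator ?B x \<partial>PiM I (\<lambda>_. lborel))"
    using B md unfolding gauss_eq_density[OF assms] d_def by (intro emeasure_density) auto
  also have "\<dots> = (\<integral>\<^sup>+x. d (refl_on_set I u x) * indicator A (refl_on_set I u x) \<partial>PiM I (\<lambda>_. lborel))"
    by (intro nn_integral_cong) (auto simp: d sp indicator_def)
  also have "\<dots> = (\<integral>\<^sup>+x. d x * indicator A x \<partial>PiM I (\<lambda>_. lborel))"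
    using md A' by (intro nn_integral_refl_lborel[OF assms, of "\<lambda>x. d x * indicator A x"]) auto
  also have "\<dots> = emeasure (gauss I) A"
    using A' md unfolding gauss_eq_density[OF assms] d_def by (intro emeasure_density[symmetric]) auto
  finally show "emeasure (distr (gauss I) (PiM I (\<lambda>_. borel)) (refl_on_set I u)) A = emeasure (gauss I) A" .
qed

lemma inner_on_cong: "(\<And>i. i \<in> I \<Longrightarrow> x i = x' i) \<Longrightarrow> (\<And>i. i \<in> I \<Longrightarrow> y i = y' i) \<Longrightarrow> inner_on I x y = inner_on I x' y'"
  by (simp add: inner_on_def)

lemma inner_on_diff_right: "inner_on I x (\<lambda>i. y i - z i) = inner_on I x y - inner_on I x z"
  by (simp add: inner_on_def algebra_simps sum_subtractf)

lemma inner_on_add_right: "inner_on I x (\<lambda>i. y i + z i) = inner_on I x y + inner_on I x z"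
  by (simp add: inner_on_def algebra_simps sum.distrib)

lemma inner_on_scale_right: "inner_on I x (\<lambda>i. c * y i) = c * inner_on I x y"
  by (simp add: inner_on_def sum_distrib_left mult.left_commute)

lemma inner_on_sum_right: "inner_on I x (\<lambda>i. \<Sum>l\<in>L. y l i) = (\<Sum>l\<in>L. inner_on I x (y l))"
  unfolding inner_on_def by (subst sum.swap) (simp add: sum_distrib_left)

lemma inner_on_diff_left: "inner_on I (\<lambda>i. y i - z i) x = inner_on I y x - inner_on I z x"
  by (simp add: inner_on_def algebra_simps sum_subtractf)

lemma inner_on_scale_left: "inner_on I (\<lambda>i. c * y i) x = c * inner_on I y x"
  by (simp add: inner_on_def sum_distrib_left mult.assoc)

lemma inner_on_restrict [simp]:
  "inner_on I (restrict x I) y = inner_on I x y" "inner_on I x (restrict y I) = inner_on I x y"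
  by (simp_all add: inner_on_def)

lemma inner_on_refl_right:
  "inner_on I x (refl_on_set I u y) = inner_on I x y - 2 * inner_on I u y / inner_on I u u * inner_on I x u"
  unfolding refl_on_set_def by (simp only: inner_on_restrict inner_on_diff_right inner_on_scale_right)

lemma inner_on_refl_adjoint: "inner_on I x (refl_on_set I u y) = inner_on I (refl_on_set I u x) y"
  unfolding inner_on_commute[of I "refl_on_set I u x"] inner_on_refl_right
  by (simp add: inner_on_commute)

lemma inner_on_refl_refl: "finite I \<Longrightarrow> inner_on I (refl_on_set I u x) (refl_on_set I u y) = inner_on I x y"
proof -
  assume I: "finite I"
  show ?thesis
  proof (cases "inner_on I u u = 0")
    case True
    then show ?thesis using inner_on_self_eq_0_iff[OF I, of u]
      by (auto simp: refl_on_set_def intro!: inner_on_cong)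
  next
    case False
    have *: "inner_on I (refl_on_set I u x) u = - inner_on I x u"
      unfolding inner_on_commute[of I "refl_on_set I u x"] inner_on_refl_right
      using False by (simp add: inner_on_commute)
    show ?thesis
      unfolding inner_on_refl_right[of I "refl_on_set I u x"] *
      unfolding inner_on_commute[of I "refl_on_set I u x"] inner_on_refl_right
      using False by (simp add: inner_on_commute)
  qed
qed

text \<open>For vectors of equal length, \<open>inner_on I u u\<close> is twice
  \<open>inner_on I u a\<close> when \<open>u\<close> is their difference, so the reflection
  subtracts exactly \<open>u\<close>. This gives transitivity on spheres, the only property of the
  rotation group that is used later.\<close>

lemma refl_on_set_swap:
  assumes I: "finite I" and "inner_on I a a = inner_on I b b" and i: "i \<in> I"
  shows "refl_on_set I (\<lambda>i. a i - b i) a i = b i"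
proof -
  let ?u = "\<lambda>i. a i - b i"
  have u: "inner_on I ?u ?u = 2 * inner_on I ?u a"
    using assms(2) by (simp add: inner_on_diff_left inner_on_diff_right inner_on_commute[of I b a])
  show ?thesis
  proof (cases "inner_on I ?u ?u = 0")
    case True
    then have "a i = b i" using inner_on_self_eq_0_iff[OF I, of ?u] i by simp
    then show ?thesis using i by (simp add: refl_on_set_def)
  next
    case False
    then have "2 * inner_on I ?u a / inner_on I ?u ?u = 1" using u by simp
    then show ?thesis using i by (simp add: refl_on_set_def)
  qed
qed

section \<open>Rotating a vector onto a coordinate axis\<close>

definition norm_on :: "'a set \<Rightarrow> ('a \<Rightarrow> real) \<Rightarrow> real" where
  "norm_on I x = sqrt (inner_on I x x)"

lemma norm_on_nonneg [simp]: "0 \<le> norm_on I x"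
  by (simp add: norm_on_def inner_on_self_nonneg)

lemma norm_on_square: "(norm_on I x)\<^sup>2 = inner_on I x x"
  by (simp add: norm_on_def inner_on_self_nonneg)

lemma norm_on_eq_0_iff: "finite I \<Longrightarrow> norm_on I x = 0 \<longleftrightarrow> (\<forall>i\<in>I. x i = 0)"
  by (simp add: norm_on_def inner_on_self_eq_0_iff)

lemma norm_on_pos: "finite I \<Longrightarrow> \<not> (\<forall>i\<in>I. x i = 0) \<Longrightarrow> 0 < norm_on I x"
  using norm_on_eq_0_iff[of I x] norm_on_nonneg[of I x] by (auto simp: less_le)

lemma inner_on_delta: "finite I \<Longrightarrow> j \<in> I \<Longrightarrow> inner_on I (\<lambda>i. if i = j then 1 else 0) x = x j"
  by (simp add: inner_on_def if_distrib[where f="\<lambda>a. a * _"] cong: if_cong)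

text \<open>The reflection exchanges the normalised \<open>v\<close> and the unit vector of
  \<open>j\<close>. Together with reflection invariance this says that a linear functional of a
  Gaussian vector has the law of a single coordinate times the norm of the functional.\<close>

lemma inner_on_refl_axis:
  assumes I: "finite I" and j: "j \<in> I" and v: "\<not> (\<forall>i\<in>I. v i = 0)"
  defines "u \<equiv> \<lambda>i. v i / norm_on I v - (if i = j then 1 else 0)"
  shows "inner_on I v (refl_on_set I u x) = norm_on I v * x j"
proof -
  let ?a = "\<lambda>i. (1 / norm_on I v) * v i" and ?b = "\<lambda>i. if i = j then 1 else 0 :: real"
  have n: "norm_on I v > 0" by (rule norm_on_pos[OF I v])
  have "inner_on I ?a ?a = (1 / norm_on I v)\<^sup>2 * (norm_on I v)\<^sup>2"
    unfolding inner_on_scale_left inner_on_scale_right norm_on_square by (simp add: power2_eq_square)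
  also have "\<dots> = inner_on I ?b ?b" using n by (simp add: inner_on_delta[OF I j] power_divide)
  finally have ab: "inner_on I ?a ?a = inner_on I ?b ?b" .
  have u: "u = (\<lambda>i. ?a i - ?b i)" by (simp add: u_def)
  have "inner_on I ?a (refl_on_set I u x) = inner_on I (refl_on_set I u ?a) x"
    by (rule inner_on_refl_adjoint)
  also have "\<dots> = inner_on I ?b x"
    unfolding u by (intro inner_on_cong refl_on_set_swap[OF I ab] refl)
  also have "\<dots> = x j" by (rule inner_on_delta[OF I j])
  finally show ?thesis using n unfolding inner_on_scale_left by (simp add: field_simps)
qed

text \<open>For pairwise orthogonal directions the reflections commute, and their composition
  subtracts all the components at once. A reflection applied to every row, or to every column, of a
  matrix has this form.\<close>

definition refl_family :: "'a set \<Rightarrow> 'b set \<Rightarrow> ('b \<Rightarrow> 'a \<Rightarrow> real) \<Rightarrow> ('a \<Rightarrow> real) \<Rightarrow> 'a \<Rightarrow> real" where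
  "refl_family I L U x = (\<lambda>i\<in>I. x i - (\<Sum>l\<in>L. 2 * inner_on I (U l) x / inner_on I (U l) (U l) * U l i))"

lemma measurable_refl_family [measurable]:
  "refl_family I L U \<in> measurable (PiM I (\<lambda>_. borel)) (PiM I (\<lambda>_. borel))"
  unfolding refl_family_def[abs_def] by (intro measurable_restrict) auto

lemma distr_gauss_refl_family:
  assumes I: "finite I" and L: "finite L"
    and orth: "\<And>l l'. l \<in> L \<Longrightarrow> l' \<in> L \<Longrightarrow> l \<noteq> l' \<Longrightarrow> inner_on I (U l) (U l') = 0"
  shows "distr (gauss I) (PiM I (\<lambda>_. borel)) (refl_family I L U) = gauss I"
  using L orth
proof (induction L rule: finite_induct)
  case empty
  have "distr (gauss I) (PiM I (\<lambda>_. borel)) (refl_family I {} U) = distr (gauss I) (gauss I) (\<lambda>x. x)"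
    by (intro distr_cong) (auto simp: sets_gauss space_gauss refl_family_def extensional_def fun_eq_iff)
  then show ?case by simp
next
  case (insert l L)
  \<comment> \<open>By orthogonality the other reflections leave the component along
    \<open>U l\<close> unchanged, so the last reflection subtracts the same multiple as in the
    simultaneous formula.\<close>
  have eq: "refl_family I (insert l L) U x = refl_on_set I (U l) (refl_family I L U x)" for x
  proof -
    have "inner_on I (U l) (refl_family I L U x) = inner_on I (U l) x
        - (\<Sum>l'\<in>L. 2 * inner_on I (U l') x / inner_on I (U l') (U l') * inner_on I (U l) (U l'))"
      unfolding refl_family_def by (simp only: inner_on_restrict inner_on_diff_right inner_on_sum_right inner_on_scale_right)
    also have "(\<Sum>l'\<in>L. 2 * inner_on I (U l') x / inner_on I (U l') (U l') * inner_on I (U l) (U l')) = 0"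
      using insert by (intro sum.neutral) auto
    finally have "inner_on I (U l) (refl_family I L U x) = inner_on I (U l) x" by simp
    then show ?thesis using insert(1,2) by (auto simp: refl_family_def refl_on_set_def fun_eq_iff)
  qed
  have "distr (gauss I) (PiM I (\<lambda>_. borel)) (refl_family I (insert l L) U)
    = distr (distr (gauss I) (PiM I (\<lambda>_. borel)) (refl_family I L U)) (PiM I (\<lambda>_. borel)) (refl_on_set I (U l))"
    by (subst distr_distr)
       (auto simp: measurable_refl_on_set comp_def eq[abs_def] measurable_cong_sets[OF sets_gauss refl])
  also have "\<dots> = gauss I" using insert by (simp add: distr_gauss_refl[OF I])
  finally show ?case .
qed

text \<open>Right multiplication of the matrix by a reflection; \<open>col_refl\<close> is left
  multiplication. The directions that belong to different rows have disjoint supports and are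
  therefore orthogonal.\<close>

definition row_refl :: "'a set \<Rightarrow> 'b set \<Rightarrow> ('b \<Rightarrow> real) \<Rightarrow> ('a \<times> 'b \<Rightarrow> real) \<Rightarrow> 'a \<times> 'b \<Rightarrow> real" where
  "row_refl M N u A = (\<lambda>p\<in>M \<times> N. refl_on_set N u (\<lambda>j. A (fst p, j)) (snd p))"

definition col_refl :: "'a set \<Rightarrow> 'b set \<Rightarrow> ('a \<Rightarrow> real) \<Rightarrow> ('a \<times> 'b \<Rightarrow> real) \<Rightarrow> 'a \<times> 'b \<Rightarrow> real" where
  "col_refl M N u A = (\<lambda>p\<in>M \<times> N. refl_on_set M u (\<lambda>l. A (l, snd p)) (fst p))"

lemma inner_on_Times_row:
  assumes "finite M" "finite N" "l \<in> M"
  shows "inner_on (M \<times> N) (\<lambda>p. if fst p = l then u (snd p) else 0) x = inner_on N u (\<lambda>j. x (l, j))"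
proof -
  have "inner_on (M \<times> N) (\<lambda>p. if fst p = l then u (snd p) else 0) x
     = (\<Sum>k\<in>M. \<Sum>j\<in>N. if k = l then u j * x (k, j) else 0)"
    unfolding inner_on_def sum.cartesian_product by (intro sum.cong) auto
  also have "\<dots> = (\<Sum>k\<in>M. if k = l then (\<Sum>j\<in>N. u j * x (k, j)) else 0)"
    by (intro sum.cong) auto
  also have "\<dots> = inner_on N u (\<lambda>j. x (l, j))" using assms by (simp add: inner_on_def)
  finally show ?thesis .
qed

lemma inner_on_Times_col:
  assumes "finite M" "finite N" "i \<in> N"
  shows "inner_on (M \<times> N) (\<lambda>p. if snd p = i then u (fst p) else 0) x = inner_on M u (\<lambda>l. x (l, i))"
proof -
  have "inner_on (M \<times> N) (\<lambda>p. if snd p = i then u (fst p) else 0) x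
     = (\<Sum>k\<in>M. \<Sum>j\<in>N. if j = i then u k * x (k, j) else 0)"
    unfolding inner_on_def sum.cartesian_product by (intro sum.cong) auto
  also have "\<dots> = inner_on M u (\<lambda>l. x (l, i))" using assms by (simp add: inner_on_def)
  finally show ?thesis .
qed

lemma row_refl_eq_family:
  assumes "finite M" "finite N"
  shows "row_refl M N u = refl_family (M \<times> N) M (\<lambda>l p. if fst p = l then u (snd p) else 0)"
proof (intro ext)
  fix A p
  let ?U = "\<lambda>l p. if fst p = l then u (snd p) else 0"
  show "row_refl M N u A p = refl_family (M \<times> N) M ?U A p"
  proof (cases "p \<in> M \<times> N")
    case True
    then obtain l i where p: "p = (l, i)" "l \<in> M" "i \<in> N" by auto
    have "(\<Sum>k\<in>M. 2 * inner_on (M \<times> N) (?U k) A / inner_on (M \<times> N) (?U k) (?U k) * ?U k p)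
      = (\<Sum>k\<in>M. if k = l then 2 * inner_on N u (\<lambda>j. A (l, j)) / inner_on N u u * u i else 0)"
      using p assms by (intro sum.cong refl) (auto simp: inner_on_Times_row)
    then have "refl_family (M \<times> N) M ?U A p = A p - 2 * inner_on N u (\<lambda>j. A (l, j)) / inner_on N u u * u i"
      using True p(2) assms unfolding refl_family_def by simp
    then show ?thesis using p by (simp add: row_refl_def refl_on_set_def)
  qed (auto simp: row_refl_def refl_family_def)
qed

lemma col_refl_eq_family:
  assumes "finite M" "finite N"
  shows "col_refl M N u = refl_family (M \<times> N) N (\<lambda>i p. if snd p = i then u (fst p) else 0)"
proof (intro ext)
  fix A p
  let ?U = "\<lambda>i p. if snd p = i then u (fst p) else 0"
  show "col_refl M N u A p = refl_family (M \<times> N) N ?U A p"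
  proof (cases "p \<in> M \<times> N")
    case True
    then obtain l i where p: "p = (l, i)" "l \<in> M" "i \<in> N" by auto
    have "(\<Sum>k\<in>N. 2 * inner_on (M \<times> N) (?U k) A / inner_on (M \<times> N) (?U k) (?U k) * ?U k p)
      = (\<Sum>k\<in>N. if k = i then 2 * inner_on M u (\<lambda>l. A (l, i)) / inner_on M u u * u l else 0)"
      using p assms by (intro sum.cong refl) (auto simp: inner_on_Times_col)
    then have "refl_family (M \<times> N) N ?U A p = A p - 2 * inner_on M u (\<lambda>l. A (l, i)) / inner_on M u u * u l"
      using True p(3) assms unfolding refl_family_def by simp
    then show ?thesis using p by (simp add: col_refl_def refl_on_set_def)
  qed (auto simp: col_refl_def refl_family_def)
qed

lemma distr_gauss_row_refl:
  assumes "finite M" "finite N"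
  shows "distr (gauss (M \<times> N)) (PiM (M \<times> N) (\<lambda>_. borel)) (row_refl M N u) = gauss (M \<times> N)"
  unfolding row_refl_eq_family[OF assms] using assms
  by (intro distr_gauss_refl_family) (auto simp: inner_on_Times_row, auto simp: inner_on_def)

lemma distr_gauss_col_refl:
  assumes "finite M" "finite N"
  shows "distr (gauss (M \<times> N)) (PiM (M \<times> N) (\<lambda>_. borel)) (col_refl M N u) = gauss (M \<times> N)"
  unfolding col_refl_eq_family[OF assms] using assms
  by (intro distr_gauss_refl_family) (auto simp: inner_on_Times_col, auto simp: inner_on_def)

lemma measurable_row_refl:
  "row_refl M N u \<in> measurable (PiM (M \<times> N) (\<lambda>_. borel)) (PiM (M \<times> N) (\<lambda>_. borel))"
  unfolding row_refl_def[abs_def] refl_on_set_def by (intro measurable_restrict) auto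

lemma measurable_col_refl:
  "col_refl M N u \<in> measurable (PiM (M \<times> N) (\<lambda>_. borel)) (PiM (M \<times> N) (\<lambda>_. borel))"
  unfolding col_refl_def[abs_def] refl_on_set_def by (intro measurable_restrict) auto

section \<open>Hyperplanes and linear images under Gaussian measures\<close>

lemma AE_stdn_neq: "AE x in stdn. x \<noteq> c"
proof -
  have "AE x in lborel. x \<noteq> (c::real)" by (rule AE_lborel_singleton)
  then show ?thesis by (subst AE_density) (auto elim: eventually_mono)
qed

text \<open>A reflection moves \<open>v\<close> to a multiple of a coordinate axis, and a single
  coordinate has no atoms. All statements about general position below rest on this.\<close>

lemma AE_gauss_inner_neq_0:
  assumes I: "finite I" and v: "\<not> (\<forall>i\<in>I. v i = 0)"
  shows "AE x in gauss I. inner_on I v x \<noteq> 0"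
proof -
  obtain j where j: "j \<in> I" "v j \<noteq> 0" using v by auto
  define u where "u = (\<lambda>i. v i / norm_on I v - (if i = j then 1 else 0))"
  have n: "norm_on I v > 0" by (rule norm_on_pos[OF I v])
  have "AE x in gauss I. x j \<noteq> 0"
    unfolding gauss_def using j by (intro AE_PiM_component[OF prob_space_stdn] AE_stdn_neq)
  then have "AE x in gauss I. inner_on I v (refl_on_set I u x) \<noteq> 0"
    using n unfolding u_def inner_on_refl_axis[OF I j(1) v] by auto
  then have "AE x in distr (gauss I) (PiM I (\<lambda>_. borel)) (refl_on_set I u). inner_on I v x \<noteq> 0"
    using measurable_refl_on_set[of I u]
    by (subst AE_distr_iff) (auto simp: measurable_cong_sets[OF sets_gauss refl])
  then show ?thesis unfolding distr_gauss_refl[OF I] .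
qed

text \<open>A reflection of the columns moves the fixed vector \<open>Y\<close> to an axis, so the
  combination of the rows with coefficients \<open>Y\<close> has the law of one row times
  \<open>norm_on M Y\<close>. A cone does not see this factor, which is what makes the value
  independent of \<open>Y\<close>.\<close>

lemma emeasure_gauss_linear_image_cone:
  assumes M: "finite M" and R: "finite R" and Y: "\<not> (\<forall>l\<in>M. Y l = 0)"
    and C[measurable]: "C \<in> sets (PiM R (\<lambda>_. borel))"
    and cone: "\<And>c x. c > 0 \<Longrightarrow> x \<in> extensional R \<Longrightarrow> (\<lambda>i\<in>R. c * x i) \<in> C \<longleftrightarrow> x \<in> C"
  shows "emeasure (gauss (M \<times> R)) {A \<in> space (gauss (M \<times> R)). (\<lambda>i\<in>R. inner_on M Y (\<lambda>l. A (l, i))) \<in> C}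
    = emeasure (gauss R) C"
proof -
  obtain k where k: "k \<in> M" "Y k \<noteq> 0" using Y by auto
  define u where "u = (\<lambda>i. Y i / norm_on M Y - (if i = k then 1 else 0))"
  define f where "f = (\<lambda>A. \<lambda>i\<in>R. inner_on M Y (\<lambda>l. A (l, i)))"
  define h :: "('a \<times> 'b \<Rightarrow> real) \<Rightarrow> 'b \<Rightarrow> real" where "h = (\<lambda>A. \<lambda>i\<in>R. A (k, i))"
  let ?G = "gauss (M \<times> R)" and ?P = "PiM (M \<times> R) (\<lambda>_. borel)"
  have n: "norm_on M Y > 0" by (rule norm_on_pos[OF M Y])
  have mf: "f \<in> measurable ?G (PiM R (\<lambda>_. borel))"
    unfolding f_def by (intro measurable_restrict) auto
  have mc: "col_refl M R u \<in> measurable ?G ?P"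
    using measurable_col_refl by (simp add: measurable_cong_sets[OF sets_gauss refl])
  have fc: "f (col_refl M R u A) = (\<lambda>i\<in>R. norm_on M Y * h A i)" for A
  proof -
    have "inner_on M Y (\<lambda>l. col_refl M R u A (l, i)) = norm_on M Y * A (k, i)" if "i \<in> R" for i
    proof -
      have "inner_on M Y (\<lambda>l. col_refl M R u A (l, i)) = inner_on M Y (refl_on_set M u (\<lambda>l. A (l, i)))"
        using that by (intro inner_on_cong) (auto simp: col_refl_def)
      then show ?thesis using inner_on_refl_axis[OF M k(1) Y] by (simp add: u_def)
    qed
    then show ?thesis by (auto simp: f_def h_def fun_eq_iff)
  qed
  have "emeasure ?G {A \<in> space ?G. f A \<in> C} = emeasure (distr ?G ?P (col_refl M R u)) {A \<in> space ?G. f A \<in> C}"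
    by (simp add: distr_gauss_col_refl[OF M R])
  also have "\<dots> = emeasure ?G (col_refl M R u -` {A \<in> space ?G. f A \<in> C} \<inter> space ?G)"
  proof (rule emeasure_distr[OF mc])
    have "f -` C \<inter> space ?G \<in> sets ?G" by (rule measurable_sets[OF mf C])
    moreover have "f -` C \<inter> space ?G = {A \<in> space ?G. f A \<in> C}" by auto
    ultimately show "{A \<in> space ?G. f A \<in> C} \<in> sets ?P" by (simp add: sets_gauss)
  qed
  also have "col_refl M R u -` {A \<in> space ?G. f A \<in> C} \<inter> space ?G = h -` C \<inter> space ?G"
  proof -
    have "col_refl M R u A \<in> space ?G" for A by (simp add: space_gauss col_refl_def)
    moreover have "f (col_refl M R u A) \<in> C \<longleftrightarrow> h A \<in> C" for A
      unfolding fc using n by (intro cone) (auto simp: h_def simp del: restrict_apply)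
    ultimately show ?thesis by auto
  qed
  also have "emeasure ?G (h -` C \<inter> space ?G) = emeasure (distr ?G (gauss R) h) C"
    by (rule emeasure_distr[symmetric])
       (auto simp: h_def sets_gauss measurable_cong_sets[OF refl sets_gauss] k intro!: measurable_restrict)
  also have "distr ?G (gauss R) h = gauss R"
    unfolding gauss_def h_def using k
    by (intro distr_PiM_reindex[where f="\<lambda>i. (k, i)"] prob_space_stdn) (auto simp: inj_on_def)
  finally show ?thesis unfolding f_def .
qed

section \<open>Solving random linear systems\<close>

definition lincomb :: "'i set \<Rightarrow> ('i \<Rightarrow> real) \<Rightarrow> ('i \<Rightarrow> 'k \<Rightarrow> real) \<Rightarrow> 'k \<Rightarrow> real" where
  "lincomb L c b = (\<lambda>k. \<Sum>l\<in>L. c l * b l k)"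

text \<open>If the vectors \<open>b l\<close> for \<open>l \<in> set is\<close> are independent, \<open>gs_coef is D b h\<close> are the coefficients
  of the linear combination of them whose inner product with each \<open>b l\<close> is \<open>h l\<close>. The recursion
  divides by zero for dependent vectors, but its measurability is evident.\<close>
fun gs_coef :: "'i list \<Rightarrow> 'k set \<Rightarrow> ('i \<Rightarrow> 'k \<Rightarrow> real) \<Rightarrow> ('i \<Rightarrow> real) \<Rightarrow> 'i \<Rightarrow> real" where
  "gs_coef [] D b h = (\<lambda>_. 0)"
| "gs_coef (i # is) D b h =
    (let c = gs_coef is D b h;
         e = gs_coef is D b (\<lambda>l. inner_on D (b l) (b i));
         r = (\<lambda>k. b i k - lincomb (set is) e b k);
         s = (h i - inner_on D (b i) (lincomb (set is) c b)) / inner_on D r r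
     in (\<lambda>l. if l = i then s else c l - s * e l))"

definition gs_res :: "'i list \<Rightarrow> 'k set \<Rightarrow> ('i \<Rightarrow> 'k \<Rightarrow> real) \<Rightarrow> ('k \<Rightarrow> real) \<Rightarrow> 'k \<Rightarrow> real" where
  "gs_res is D b v = (\<lambda>k. v k - lincomb (set is) (gs_coef is D b (\<lambda>l. inner_on D (b l) v)) b k)"

text \<open>No step of the Gram-Schmidt process yields a zero residual. For distinct indices and
  finite \<open>D\<close> this is linear independence on \<open>D\<close>, phrased so that its
  measurability follows the recursion.\<close>

fun gs_ok :: "'i list \<Rightarrow> 'k set \<Rightarrow> ('i \<Rightarrow> 'k \<Rightarrow> real) \<Rightarrow> bool" where
  "gs_ok [] D b = True"
| "gs_ok (i # is) D b = (gs_ok is D b \<and> inner_on D (gs_res is D b (b i)) (gs_res is D b (b i)) \<noteq> 0)"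

lemma inner_on_lincomb: "inner_on D x (lincomb L c b) = (\<Sum>l\<in>L. c l * inner_on D x (b l))"
  unfolding lincomb_def inner_on_sum_right inner_on_scale_right ..

text \<open>The residual \<open>r\<close> of the new vector is orthogonal to the earlier ones, so
  adding \<open>s * r\<close> leaves their equations intact. Its inner product with
  \<open>b i\<close> is \<open>inner_on D r r\<close>, and \<open>s\<close> is chosen to satisfy the
  equation of \<open>i\<close>.\<close>

lemma gs_coef_solves:
  assumes "distinct is" "gs_ok is D b" "l \<in> set is"
  shows "inner_on D (b l) (lincomb (set is) (gs_coef is D b h) b) = h l"
  using assms
proof (induction "is" arbitrary: h l)
  case (Cons i "is")
  define c where "c = gs_coef is D b h"
  define e where "e = gs_coef is D b (\<lambda>l. inner_on D (b l) (b i))"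
  define r where "r = gs_res is D b (b i)"
  define s where "s = (h i - inner_on D (b i) (lincomb (set is) c b)) / inner_on D r r"
  have r_alt: "r = (\<lambda>k. b i k - lincomb (set is) e b k)" by (simp add: r_def gs_res_def e_def)
  have g: "gs_coef (i # is) D b h = (\<lambda>l. if l = i then s else c l - s * e l)"
    unfolding gs_coef.simps Let_def c_def[symmetric] e_def[symmetric] r_alt[symmetric] s_def[symmetric] ..
  have ok: "gs_ok is D b" and r0: "inner_on D r r \<noteq> 0" and dist: "distinct is" "i \<notin> set is"
    using Cons.prems by (auto simp: r_def)
  have IH: "inner_on D (b l) (lincomb (set is) (gs_coef is D b h) b) = h l" if "l \<in> set is" for l h
    by (rule Cons.IH[OF dist(1) ok that])
  have orth: "inner_on D (b l) r = 0" if "l \<in> set is" for l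
    unfolding r_alt inner_on_diff_right e_def IH[OF that] by simp
  have "inner_on D r r = inner_on D (b i) r - (\<Sum>l\<in>set is. e l * inner_on D r (b l))"
    by (subst r_alt) (simp add: inner_on_diff_left inner_on_commute[of D "lincomb _ _ _"] inner_on_lincomb)
  also have "(\<Sum>l\<in>set is. e l * inner_on D r (b l)) = 0"
    using orth by (intro sum.neutral) (auto simp: inner_on_commute[of D r])
  finally have rr: "inner_on D (b i) r = inner_on D r r" by simp
  have "lincomb (set (i # is)) (gs_coef (i # is) D b h) b = (\<lambda>k. lincomb (set is) c b k + s * r k)"
  proof
    fix k
    have "lincomb (set (i # is)) (gs_coef (i # is) D b h) b k = s * b i k + (\<Sum>l\<in>set is. (c l - s * e l) * b l k)"
      unfolding g lincomb_def using dist by (auto intro!: sum.cong)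
    then show "lincomb (set (i # is)) (gs_coef (i # is) D b h) b k = lincomb (set is) c b k + s * r k"
      unfolding r_alt lincomb_def by (simp add: algebra_simps sum_subtractf sum_distrib_left)
  qed
  then have *: "inner_on D x (lincomb (set (i # is)) (gs_coef (i # is) D b h) b)
     = inner_on D x (lincomb (set is) c b) + s * inner_on D x r" for x
    by (simp only: inner_on_add_right inner_on_scale_right)
  show ?case
  proof (cases "l = i")
    case True
    then show ?thesis unfolding * using rr r0 by (simp add: s_def)
  next
    case False
    then have "l \<in> set is" using Cons.prems by simp
    then show ?thesis unfolding * orth[OF \<open>l \<in> set is\<close>] using IH[of l h] by (simp add: c_def)
  qed
qed simp

lemma gs_res_orth:
  assumes "distinct is" "gs_ok is D b" "l \<in> set is"
  shows "inner_on D (b l) (gs_res is D b v) = 0"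
  unfolding gs_res_def inner_on_diff_right gs_coef_solves[OF assms] by simp

text \<open>Pairing the combination with the residual of the head of the list annihilates the
  vectors of the tail and isolates the coefficient of the head.\<close>

lemma gs_indep:
  assumes "distinct is" "gs_ok is D b" "\<And>k. k \<in> D \<Longrightarrow> lincomb (set is) c b k = 0" "l \<in> set is"
  shows "c l = 0"
  using assms
proof (induction "is" arbitrary: l)
  case (Cons i "is")
  define r where "r = gs_res is D b (b i)"
  have ok: "gs_ok is D b" and r0: "inner_on D r r \<noteq> 0" and dist: "distinct is" "i \<notin> set is"
    using Cons.prems by (auto simp: r_def)
  have orth: "inner_on D r (b l) = 0" if "l \<in> set is" for l
    using gs_res_orth[OF dist(1) ok that] by (simp add: inner_on_commute r_def)
  have "inner_on D r r = inner_on D r (b i)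
      - (\<Sum>l\<in>set is. gs_coef is D b (\<lambda>l. inner_on D (b l) (b i)) l * inner_on D r (b l))"
    by (subst (2) r_def) (simp add: gs_res_def inner_on_diff_right inner_on_lincomb)
  also have "\<dots> = inner_on D r (b i)" using orth by simp
  finally have ri: "inner_on D r (b i) \<noteq> 0" using r0 by simp
  have "0 = inner_on D r (lincomb (set (i # is)) c b)"
    using Cons.prems(3) by (simp add: inner_on_def)
  also have "\<dots> = c i * inner_on D r (b i)"
    unfolding inner_on_lincomb using dist orth by simp
  finally have ci: "c i = 0" using ri by simp
  then have "lincomb (set is) c b k = 0" if "k \<in> D" for k
    using Cons.prems(3)[OF that] dist by (simp add: lincomb_def)
  then show ?case using Cons.IH[OF dist(1) ok] ci Cons.prems(4) by auto
qed simp

text \<open>Two solutions differ by a combination that is orthogonal to each of its own summands,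
  hence has norm zero. This determines how the coefficients transform under reflections without
  unfolding the recursion.\<close>

lemma gs_coef_unique:
  assumes "finite D" "distinct is" "gs_ok is D b"
    and sol: "\<And>l. l \<in> set is \<Longrightarrow> inner_on D (b l) (lincomb (set is) c b) = h l"
    and "l \<in> set is"
  shows "c l = gs_coef is D b h l"
proof -
  define d where "d = (\<lambda>l. c l - gs_coef is D b h l)"
  have d: "lincomb (set is) d b k = lincomb (set is) c b k - lincomb (set is) (gs_coef is D b h) b k" for k
    unfolding lincomb_def d_def by (simp add: algebra_simps sum_subtractf)
  have z: "inner_on D (b l) (lincomb (set is) d b) = 0" if "l \<in> set is" for l
    using sol[OF that] gs_coef_solves[OF assms(2,3) that, of h]
    unfolding inner_on_diff_right[symmetric] by (subst d[abs_def]) (simp add: inner_on_diff_right)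
  have "inner_on D (lincomb (set is) d b) (lincomb (set is) d b) = 0"
    by (subst inner_on_lincomb) (use z in \<open>simp add: inner_on_commute\<close>)
  then have "lincomb (set is) d b k = 0" if "k \<in> D" for k
    using that inner_on_self_eq_0_iff[OF assms(1)] by blast
  from gs_indep[OF assms(2,3) this assms(5)] show ?thesis by (simp add: d_def)
qed

lemma measurable_lincomb:
  assumes "\<And>l. l \<in> L \<Longrightarrow> (\<lambda>w. c w l) \<in> borel_measurable M"
    and "\<And>l. l \<in> L \<Longrightarrow> (\<lambda>w. b w l k) \<in> borel_measurable M"
  shows "(\<lambda>w. lincomb L (c w) (b w) k) \<in> borel_measurable M"
  unfolding lincomb_def using assms by (intro borel_measurable_sum) auto

lemma measurable_gs_coef:
  assumes "\<And>l k. l \<in> set is \<Longrightarrow> k \<in> D \<Longrightarrow> (\<lambda>w. b w l k) \<in> borel_measurable M"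
    and "\<And>l. l \<in> set is \<Longrightarrow> (\<lambda>w. h w l) \<in> borel_measurable M" and "l \<in> set is"
  shows "(\<lambda>w. gs_coef is D (b w) (h w) l) \<in> borel_measurable M"
  using assms
proof (induction "is" arbitrary: h l)
  case (Cons i "is")
  have c: "(\<lambda>w. gs_coef is D (b w) (h w) l) \<in> borel_measurable M" if "l \<in> set is" for l
    using Cons.prems that by (intro Cons.IH) auto
  have e: "(\<lambda>w. gs_coef is D (b w) (\<lambda>l. inner_on D (b w l) (b w i)) l) \<in> borel_measurable M" if "l \<in> set is" for l
    using Cons.prems that by (intro Cons.IH measurable_inner_on) auto
  have "(\<lambda>w. b w i k - lincomb (set is) (gs_coef is D (b w) (\<lambda>l. inner_on D (b w l) (b w i))) (b w) k) \<in> borel_measurable M"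
    if "k \<in> D" for k using Cons.prems that e by (intro borel_measurable_diff measurable_lincomb) auto
  note r = this
  have s: "(\<lambda>w. (h w i - inner_on D (b w i) (lincomb (set is) (gs_coef is D (b w) (h w)) (b w)))
     / inner_on D (\<lambda>k. b w i k - lincomb (set is) (gs_coef is D (b w) (\<lambda>l. inner_on D (b w l) (b w i))) (b w) k)
        (\<lambda>k. b w i k - lincomb (set is) (gs_coef is D (b w) (\<lambda>l. inner_on D (b w l) (b w i))) (b w) k)) \<in> borel_measurable M"
    using Cons.prems c e by (intro borel_measurable_divide borel_measurable_diff measurable_inner_on measurable_lincomb) auto
  show ?case
  proof (cases "l = i")
    case True
    then show ?thesis using s by (simp add: Let_def)
  next
    case False
    then have "l \<in> set is" using Cons.prems by simp
    then show ?thesis using False borel_measurable_diff[OF c borel_measurable_times[OF s e]]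
      by (simp add: Let_def)
  qed
qed simp

lemma measurable_gs_res:
  assumes "\<And>l k. l \<in> set is \<Longrightarrow> k \<in> D \<Longrightarrow> (\<lambda>w. b w l k) \<in> borel_measurable M"
    and "\<And>k. k \<in> D \<Longrightarrow> (\<lambda>w. v w k) \<in> borel_measurable M" and "k \<in> D"
  shows "(\<lambda>w. gs_res is D (b w) (v w) k) \<in> borel_measurable M"
  unfolding gs_res_def using assms
  by (intro borel_measurable_diff measurable_lincomb measurable_gs_coef measurable_inner_on) auto

lemma measurable_gs_ok:
  assumes "\<And>l k. l \<in> set is \<Longrightarrow> k \<in> D \<Longrightarrow> (\<lambda>w. b w l k) \<in> borel_measurable M"
  shows "Measurable.pred M (\<lambda>w. gs_ok is D (b w))"
  using assms
proof (induction "is")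
  case (Cons i "is")
  have "(\<lambda>w. inner_on D (gs_res is D (b w) (b w i)) (gs_res is D (b w) (b w i))) \<in> borel_measurable M"
    using Cons.prems by (intro measurable_inner_on measurable_gs_res) auto
  then have "Measurable.pred M (\<lambda>w. inner_on D (gs_res is D (b w) (b w i)) (gs_res is D (b w) (b w i)) \<noteq> 0)"
    by measurable
  moreover have "Measurable.pred M (\<lambda>w. gs_ok is D (b w))" using Cons by simp
  ultimately show ?case by simp
qed simp

text \<open>Elimination of one unknown with a pivot of the equation \<open>l\<close>. It will supply
  a direction orthogonal to vectors that are fewer than the dimension.\<close>

lemma homogeneous_system_nontrivial:
  fixes a :: "'i \<Rightarrow> 'k \<Rightarrow> real"
  assumes "finite L" "finite D" "card L < card D"
  shows "\<exists>v. (\<exists>k\<in>D. v k \<noteq> 0) \<and> (\<forall>l\<in>L. inner_on D (a l) v = 0)"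
  using assms
proof (induction L arbitrary: D a rule: finite_induct)
  case empty
  then have "D \<noteq> {}" by auto
  then show ?case by (intro exI[of _ "\<lambda>_. 1"]) auto
next
  case (insert l L)
  show ?case
  proof (cases "\<forall>k\<in>D. a l k = 0")
    case True
    have "card L < card D" using insert by simp
    from insert.IH[OF insert.prems(1) this, of a] obtain v where
      "\<exists>k\<in>D. v k \<noteq> 0" "\<forall>l\<in>L. inner_on D (a l) v = 0" by blast
    moreover have "inner_on D (a l) v = 0" using True by (simp add: inner_on_def)
    ultimately show ?thesis by auto
  next
    case False
    then obtain k0 where k0: "k0 \<in> D" "a l k0 \<noteq> 0" by auto
    define D' where "D' = D - {k0}"
    have D': "finite D'" "k0 \<notin> D'" "D = insert k0 D'" "card L < card D'"
      using insert k0 by (auto simp: D'_def)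
    define a' where "a' = (\<lambda>l' k. a l' k - a l' k0 / a l k0 * a l k)"
    from insert.IH[OF D'(1,4), of a'] obtain v where
      v: "\<exists>k\<in>D'. v k \<noteq> 0" "\<forall>l\<in>L. inner_on D' (a' l) v = 0" by blast
    define t where "t = - inner_on D' (a l) v / a l k0"
    define w where "w = v(k0 := t)"
    have w: "inner_on D (a l') w = a l' k0 * t + inner_on D' (a l') v" for l'
      unfolding D'(3) inner_on_def w_def using D'(1,2) by (auto intro!: sum.cong)
    have "inner_on D (a l') w = 0" if "l' \<in> L" for l'
    proof -
      have "0 = inner_on D' (a l') v - a l' k0 / a l k0 * inner_on D' (a l) v"
        using v(2) that unfolding a'_def inner_on_diff_left inner_on_scale_left by auto
      then show ?thesis using k0 unfolding w t_def by (simp add: field_simps)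
    qed
    moreover have "inner_on D (a l) w = 0" using k0 unfolding w t_def by simp
    moreover have "\<exists>k\<in>D. w k \<noteq> 0" using v(1) D' by (auto simp: w_def)
    ultimately show ?thesis by (intro exI[of _ w]) auto
  qed
qed

lemma AE_gauss_merge:
  assumes "finite I" "finite J" "I \<inter> J = {}"
    and P: "Measurable.pred (PiM (I \<union> J) (\<lambda>_. borel)) P"
    and AE: "\<And>x. x \<in> space (gauss I) \<Longrightarrow> AE y in gauss J. P (merge I J (x, y))"
  shows "AE z in gauss (I \<union> J). P z"
proof -
  interpret N: product_sigma_finite "\<lambda>_. stdn" by (rule product_sigma_finite_stdn)
  interpret GI: prob_space "gauss I" by (rule prob_space_gauss)
  interpret GJ: prob_space "gauss J" by (rule prob_space_gauss)
  interpret PP: pair_sigma_finite "gauss I" "gauss J" ..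
  have d: "distr (gauss I \<Otimes>\<^sub>M gauss J) (gauss (I \<union> J)) (merge I J) = gauss (I \<union> J)"
    unfolding gauss_def using assms by (intro N.distr_merge)
  have mm: "merge I J \<in> measurable (gauss I \<Otimes>\<^sub>M gauss J) (gauss (I \<union> J))"
    unfolding gauss_def by (rule measurable_merge)
  have P': "Measurable.pred (gauss (I \<union> J)) P" using P by (simp add: measurable_cong_sets[OF sets_gauss refl])
  have mP: "Measurable.pred (gauss I \<Otimes>\<^sub>M gauss J) (\<lambda>p. P (merge I J p))"
    using measurable_compose[OF mm P'] .
  have "AE p in gauss I \<Otimes>\<^sub>M gauss J. P (merge I J p)"
    using mP AE by (intro PP.AE_pair_measure) (auto simp: pred_def)
  then have "AE z in distr (gauss I \<Otimes>\<^sub>M gauss J) (gauss (I \<union> J)) (merge I J). P z"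
    using P' by (subst AE_distr_iff[OF mm]) (auto simp: pred_def)
  then show ?thesis unfolding d .
qed

lemma gs_coef_cong:
  assumes "\<And>l k. l \<in> set is \<Longrightarrow> k \<in> D \<Longrightarrow> b l k = b' l k" "\<And>l. l \<in> set is \<Longrightarrow> h l = h' l" "l \<in> set is"
  shows "gs_coef is D b h l = gs_coef is D b' h' l"
  using assms
proof (induction "is" arbitrary: h h' l)
  case (Cons i "is")
  have b: "inner_on D (b l) (b i) = inner_on D (b' l) (b' i)" if "l \<in> set is" for l
    using Cons.prems(1) that by (intro inner_on_cong) auto
  have c: "gs_coef is D b h l = gs_coef is D b' h' l" if "l \<in> set is" for l
    using Cons.prems that by (intro Cons.IH) auto
  have e: "gs_coef is D b (\<lambda>l. inner_on D (b l) (b i)) l = gs_coef is D b' (\<lambda>l. inner_on D (b' l) (b' i)) l"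
    if "l \<in> set is" for l using Cons.prems that by (intro Cons.IH) (auto simp: b)
  have lc: "lincomb (set is) (gs_coef is D b h) b k = lincomb (set is) (gs_coef is D b' h') b' k" if "k \<in> D" for k
    unfolding lincomb_def using c Cons.prems(1) that by (intro sum.cong) auto
  have le: "lincomb (set is) (gs_coef is D b (\<lambda>l. inner_on D (b l) (b i))) b k
     = lincomb (set is) (gs_coef is D b' (\<lambda>l. inner_on D (b' l) (b' i))) b' k" if "k \<in> D" for k
    unfolding lincomb_def using e Cons.prems(1) that by (intro sum.cong) auto
  let ?r = "\<lambda>b k. b i k - lincomb (set is) (gs_coef is D b (\<lambda>l. inner_on D (b l) (b i))) b k"
  have r: "inner_on D (?r b) (?r b) = inner_on D (?r b') (?r b')"
    using le Cons.prems(1) by (intro inner_on_cong) auto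
  have x: "inner_on D (b i) (lincomb (set is) (gs_coef is D b h) b) = inner_on D (b' i) (lincomb (set is) (gs_coef is D b' h') b')"
    using lc Cons.prems(1) by (intro inner_on_cong) auto
  show ?case unfolding gs_coef.simps Let_def r x
    using Cons.prems c e by auto
qed simp

text \<open>Fix all entries except those of the newest vector and choose a nonzero \<open>v\<close>
  orthogonal to the earlier vectors. A zero residual would put the newest vector into their span,
  hence into the hyperplane orthogonal to \<open>v\<close>, a null set. The map \<open>f\<close>
  from vector and coordinate to entry lets columns as well as rows play the role of the
  vectors.\<close>

lemma AE_gs_ok:
  assumes I: "finite I" and D: "finite D" and "distinct is" "length is \<le> card D"
    and inj: "inj_on (\<lambda>(i, k). f i k) (set is \<times> D)"
    and sub: "\<And>i k. i \<in> set is \<Longrightarrow> k \<in> D \<Longrightarrow> f i k \<in> I"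
  shows "AE A in gauss I. gs_ok is D (\<lambda>i k. A (f i k))"
  using assms(3-)
proof (induction "is")
  case (Cons i "is")
  have "AE A in gauss I. gs_ok is D (\<lambda>i k. A (f i k))"
    using Cons.prems by (intro Cons.IH) (auto intro: inj_on_subset)
  moreover define R where "R = (\<lambda>A. gs_res is D (\<lambda>i k. A (f i k)) (\<lambda>k. A (f i k)))"
  have "AE A in gauss I. inner_on D (R A) (R A) \<noteq> 0"
  proof -
    define J where "J = f i ` D"
    define I1 where "I1 = I - J"
    have J: "finite J" "J \<subseteq> I" using D Cons.prems by (auto simp: J_def)
    have I1: "finite I1" "I1 \<inter> J = {}" "I1 \<union> J = I" using I J by (auto simp: I1_def)
    have injD: "inj_on (f i) D" using Cons.prems(3) by (auto simp: inj_on_def)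
    have fl: "f l k \<in> I1" if "l \<in> set is" "k \<in> D" for l k
    proof -
      have "f l k \<noteq> f i k'" if "k' \<in> D" for k'
        using inj_onD[OF Cons.prems(3), of "(l, k)" "(i, k')"] Cons.prems(1) \<open>l \<in> set is\<close> \<open>k \<in> D\<close> that by auto
      then show ?thesis using that Cons.prems(4) by (auto simp: I1_def J_def)
    qed
    have mA: "(\<lambda>A. A (f l k)) \<in> borel_measurable (PiM I (\<lambda>_. borel))" if "l \<in> set (i # is)" "k \<in> D" for l k
      using Cons.prems(4)[OF that] by simp
    have "(\<lambda>A. inner_on D (R A) (R A)) \<in> borel_measurable (PiM I (\<lambda>_. borel))"
      unfolding R_def using mA by (intro measurable_inner_on measurable_gs_res) auto
    then have mP: "Measurable.pred (PiM (I1 \<union> J) (\<lambda>_. borel)) (\<lambda>A. inner_on D (R A) (R A) \<noteq> 0)"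
      unfolding I1(3) by measurable
    have "AE z in gauss (I1 \<union> J). inner_on D (R z) (R z) \<noteq> 0"
    proof (rule AE_gauss_merge[OF I1(1) J(1) I1(2) mP])
      fix x
      \<comment> \<open>The list with its head has length at most \<open>card D\<close>, so the
        earlier vectors alone are strictly fewer and leave an orthogonal direction.\<close>
      have "card (set is) < card D" using Cons.prems(1,2) distinct_card[of "is"] by simp
      from homogeneous_system_nontrivial[OF _ D this, of "\<lambda>l k. x (f l k)"] obtain v where
        v: "\<exists>k\<in>D. v k \<noteq> 0" "\<And>l. l \<in> set is \<Longrightarrow> inner_on D (\<lambda>k. x (f l k)) v = 0" by auto
      define v' where "v' = (\<lambda>j. v (the_inv_into D (f i) j))"
      have v': "v' (f i k) = v k" if "k \<in> D" for k
        using the_inv_into_f_f[OF injD that] by (simp add: v'_def)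
      have "\<not> (\<forall>j\<in>J. v' j = 0)" using v(1) v' by (auto simp: J_def)
      from AE_gauss_inner_neq_0[OF J(1) this]
      show "AE y in gauss J. inner_on D (R (merge I1 J (x, y))) (R (merge I1 J (x, y))) \<noteq> 0"
      proof eventually_elim
        case (elim y)
        define z where "z = merge I1 J (x, y)"
        have z1: "z (f l k) = x (f l k)" if "l \<in> set is" "k \<in> D" for l k
          using fl[OF that] I1(2) by (simp add: z_def merge_def)
        have z2: "z (f i k) = y (f i k)" if "k \<in> D" for k
          using that I1(2) by (auto simp: z_def merge_def J_def)
        have "inner_on J v' y = (\<Sum>k\<in>D. v' (f i k) * y (f i k))"
          unfolding inner_on_def J_def by (subst sum.reindex[OF injD]) simp
        then have yv: "inner_on J v' y = inner_on D v (\<lambda>k. z (f i k))"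
          using z2 v' by (simp add: inner_on_def)
        show ?case
        proof
          assume "inner_on D (R (merge I1 J (x, y))) (R (merge I1 J (x, y))) = 0"
          then have "R z k = 0" if "k \<in> D" for k
            using inner_on_self_eq_0_iff[OF D, of "R z"] that by (simp add: z_def)
          then have "0 = inner_on D v (R z)" by (simp add: inner_on_def)
          also have "\<dots> = inner_on D v (\<lambda>k. z (f i k))
            - (\<Sum>l\<in>set is. gs_coef is D (\<lambda>i k. z (f i k)) (\<lambda>l. inner_on D (\<lambda>k. z (f l k)) (\<lambda>k. z (f i k))) l * inner_on D v (\<lambda>k. z (f l k)))"
            unfolding R_def gs_res_def inner_on_diff_right inner_on_lincomb ..
          also have "inner_on D v (\<lambda>k. z (f l k)) = 0" if "l \<in> set is" for l
            using v(2)[OF that] z1[OF that] by (subst inner_on_commute) (simp add: inner_on_def)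
          then have "(\<Sum>l\<in>set is. gs_coef is D (\<lambda>i k. z (f i k)) (\<lambda>l. inner_on D (\<lambda>k. z (f l k)) (\<lambda>k. z (f i k))) l * inner_on D v (\<lambda>k. z (f l k))) = 0"
            by (intro sum.neutral) auto
          finally show False using elim yv by simp
        qed
      qed
    qed
    then show ?thesis unfolding I1(3) .
  qed
  ultimately show ?case unfolding R_def by eventually_elim simp
qed simp

section \<open>Rotation invariant laws and polyhedral cones\<close>

lemma norm_on_eq_L2_set: "norm_on I x = L2_set x I"
  by (simp add: norm_on_def inner_on_def L2_set_def power2_eq_square)

lemma Cauchy_Schwarz_inner_on: "\<bar>inner_on I x y\<bar> \<le> norm_on I x * norm_on I y"
proof -
  have "\<bar>inner_on I x y\<bar> \<le> (\<Sum>i\<in>I. \<bar>x i\<bar> * \<bar>y i\<bar>)"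
    unfolding inner_on_def by (rule order_trans[OF sum_abs]) (simp add: abs_mult)
  also have "\<dots> \<le> norm_on I x * norm_on I y"
    unfolding norm_on_eq_L2_set by (rule L2_set_mult_ineq)
  finally show ?thesis .
qed

lemma norm_on_scale: "norm_on I (\<lambda>i. c * x i) = \<bar>c\<bar> * norm_on I x"
  unfolding norm_on_def inner_on_scale_left inner_on_scale_right
  by (simp add: real_sqrt_mult mult.assoc[symmetric])

lemma measurable_norm_on [measurable]:
  assumes "\<And>i. i \<in> I \<Longrightarrow> (\<lambda>w. x w i) \<in> borel_measurable M"
  shows "(\<lambda>w. norm_on I (x w)) \<in> borel_measurable M"
  unfolding norm_on_def using assms by measurable

text \<open>Countably many caps cover the sphere, so that a cap cannot have measure zero.\<close>
lemma rational_point_in_cap: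
  assumes Q: "finite Q" and x: "\<not> (\<forall>q\<in>Q. x q = 0)" and c: "0 < c" "c < 1"
  shows "\<exists>y\<in>PiE Q (\<lambda>_. \<rat>). c * norm_on Q x * norm_on Q y < inner_on Q y x"
proof -
  define n where "n = norm_on Q x"
  define d where "d = (1 - c) / 3 * n"
  define e where "e = d / (real (card Q) + 1)"
  have n: "n > 0" unfolding n_def by (rule norm_on_pos[OF Q x])
  have d: "d > 0" using n c by (simp add: d_def)
  then have e: "e > 0" by (simp add: e_def)
  have "\<exists>r\<in>\<rat>. x q - e < r \<and> r < x q" for q
    using Rats_dense_in_real[of "x q - e" "x q"] e by auto
  then obtain r where r: "\<And>q. r q \<in> \<rat>" "\<And>q. x q - e < r q" "\<And>q. r q < x q" by metis
  define y where "y = restrict r Q"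
  have yP: "y \<in> PiE Q (\<lambda>_. \<rat>)" using r by (simp add: y_def)
  let ?z = "\<lambda>q. y q - x q"
  have "norm_on Q ?z \<le> (\<Sum>q\<in>Q. \<bar>?z q\<bar>)"
    unfolding norm_on_eq_L2_set by (rule L2_set_le_sum_abs)
  also have "\<dots> \<le> (\<Sum>q\<in>Q. e)"
  proof (rule sum_mono)
    fix q assume "q \<in> Q" then show "\<bar>?z q\<bar> \<le> e" using r(2,3)[of q] by (simp add: y_def)
  qed
  also have "\<dots> \<le> d" using d by (simp add: e_def field_simps)
  finally have z: "norm_on Q ?z \<le> d" .
  have yx: "inner_on Q y x = n\<^sup>2 + inner_on Q ?z x"
    by (simp add: inner_on_diff_left n_def norm_on_square)
  have "inner_on Q ?z x \<ge> - (d * n)"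
  proof -
    have "\<bar>inner_on Q ?z x\<bar> \<le> norm_on Q ?z * n" unfolding n_def by (rule Cauchy_Schwarz_inner_on)
    also have "\<dots> \<le> d * n" using z n by (intro mult_right_mono) auto
    finally show ?thesis by simp
  qed
  with yx have 1: "inner_on Q y x \<ge> n\<^sup>2 - d * n" by simp
  have "norm_on Q y \<le> n + norm_on Q ?z"
    using L2_set_triangle_ineq[of x ?z Q] by (simp add: norm_on_eq_L2_set n_def)
  then have "norm_on Q y \<le> n + d" using z by simp
  then have 2: "c * n * norm_on Q y \<le> c * n * (n + d)" using c n by (intro mult_left_mono) auto
  have "c * n * (n + d) < n\<^sup>2 - d * n"
  proof -
    have "n\<^sup>2 - d * n - c * n * (n + d) = n * n * ((1 - c) * (2 - c) / 3)"
      by (simp add: d_def power2_eq_square field_simps)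
    also have "\<dots> > 0" using n c by simp
    finally show ?thesis by simp
  qed
  with 1 2 yP show ?thesis unfolding n_def by (intro bexI[of _ y]) auto
qed

lemma sets_cap:
  assumes "sets \<mu> = sets (PiM Q (\<lambda>_. borel))"
  shows "{x \<in> space \<mu>. c * norm_on Q x * d < inner_on Q y x} \<in> sets \<mu>"
proof -
  note [measurable_cong] = assms
  show ?thesis by measurable
qed

text \<open>The reflection that exchanges the two normalised centres maps one cap onto the
  other.\<close>

lemma cap_measure_const:
  assumes Q: "finite Q" and sets: "sets \<mu> = sets (PiM Q (\<lambda>_. borel))"
    and inv: "\<And>u. distr \<mu> (PiM Q (\<lambda>_. borel)) (refl_on_set Q u) = \<mu>"
    and y: "\<not> (\<forall>q\<in>Q. y q = 0)" "\<not> (\<forall>q\<in>Q. z q = 0)"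
  shows "emeasure \<mu> {x \<in> space \<mu>. c * norm_on Q x * norm_on Q y < inner_on Q y x}
       = emeasure \<mu> {x \<in> space \<mu>. c * norm_on Q x * norm_on Q z < inner_on Q z x}"
proof -
  have sp: "space \<mu> = extensional Q" using sets_eq_imp_space_eq[OF sets] by (auto simp: space_PiM PiE_def)
  note [measurable_cong] = sets
  define a where "a = (\<lambda>i. 1 / norm_on Q y * y i)"
  define b where "b = (\<lambda>i. 1 / norm_on Q z * z i)"
  have ny: "norm_on Q y > 0" and nz: "norm_on Q z > 0" using y norm_on_pos[OF Q] by blast+
  have "norm_on Q a = norm_on Q b" using ny nz unfolding a_def b_def norm_on_scale by simp
  then have ab: "inner_on Q a a = inner_on Q b b" by (simp add: norm_on_square[symmetric])
  let ?u = "\<lambda>i. a i - b i"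
  have Y: "c * norm_on Q x * norm_on Q y < inner_on Q y x \<longleftrightarrow> c * norm_on Q x < inner_on Q a x" for x
    unfolding a_def inner_on_scale_left using ny by (simp add: field_simps)
  have Z: "c * norm_on Q x * norm_on Q z < inner_on Q z x \<longleftrightarrow> c * norm_on Q x < inner_on Q b x" for x
    unfolding b_def inner_on_scale_left using nz by (simp add: field_simps)
  have mr: "refl_on_set Q ?u \<in> measurable \<mu> (PiM Q (\<lambda>_. borel))"
    using measurable_refl_on_set by (simp add: measurable_cong_sets[OF sets refl])
  have "emeasure \<mu> {x \<in> space \<mu>. c * norm_on Q x < inner_on Q a x}
      = emeasure (distr \<mu> (PiM Q (\<lambda>_. borel)) (refl_on_set Q ?u)) {x \<in> space \<mu>. c * norm_on Q x < inner_on Q a x}"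
    by (simp add: inv)
  also have "\<dots> = emeasure \<mu> (refl_on_set Q ?u -` {x \<in> space \<mu>. c * norm_on Q x < inner_on Q a x} \<inter> space \<mu>)"
  proof (rule emeasure_distr[OF mr])
    have "{x \<in> space \<mu>. c * norm_on Q x < inner_on Q a x} \<in> sets \<mu>" by measurable
    then show "{x \<in> space \<mu>. c * norm_on Q x < inner_on Q a x} \<in> sets (PiM Q (\<lambda>_. borel))" using sets by simp
  qed
  also have "refl_on_set Q ?u -` {x \<in> space \<mu>. c * norm_on Q x < inner_on Q a x} \<inter> space \<mu>
     = {x \<in> space \<mu>. c * norm_on Q x < inner_on Q b x}"
  proof -
    have 1: "refl_on_set Q ?u x \<in> space \<mu>" for x by (simp add: sp refl_on_set_def)
    have 2: "norm_on Q (refl_on_set Q ?u x) = norm_on Q x" for x by (simp add: norm_on_def inner_on_refl[OF Q])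
    have 3: "inner_on Q a (refl_on_set Q ?u x) = inner_on Q b x" for x
      unfolding inner_on_refl_adjoint by (intro inner_on_cong refl_on_set_swap[OF Q ab] refl)
    show ?thesis using 1 2 3 by auto
  qed
  finally show ?thesis by (simp add: Y Z)
qed

text \<open>Both sides count pairs \<open>(x, y)\<close> at small angle: by invariance every spherical cap has the same
  mass, independent of its centre and also of the measure, and a cap around a point well inside an
  open cone stays inside the cone.\<close>
lemma emeasure_cone_le_of_invariant:
  fixes \<mu> \<nu> :: "('a \<Rightarrow> real) measure" and v :: "'j \<Rightarrow> 'a \<Rightarrow> real"
  assumes Q: "finite Q" and "prob_space \<mu>" "prob_space \<nu>"
    and sets: "sets \<mu> = sets (PiM Q (\<lambda>_. borel))" "sets \<nu> = sets (PiM Q (\<lambda>_. borel))"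
    and inv: "\<And>u. distr \<mu> (PiM Q (\<lambda>_. borel)) (refl_on_set Q u) = \<mu>"
             "\<And>u. distr \<nu> (PiM Q (\<lambda>_. borel)) (refl_on_set Q u) = \<nu>"
    and nz: "AE x in \<mu>. \<not> (\<forall>q\<in>Q. x q = 0)" "AE x in \<nu>. \<not> (\<forall>q\<in>Q. x q = 0)"
    and J: "finite J"
  shows "emeasure \<nu> {x \<in> space \<nu>. \<forall>j\<in>J. inner_on Q (v j) x > 0}
     \<le> emeasure \<mu> {x \<in> space \<mu>. \<forall>j\<in>J. inner_on Q (v j) x > 0}"
proof -
  interpret M: prob_space \<mu> by fact
  interpret N: prob_space \<nu> by fact
  interpret PP: pair_prob_space \<mu> \<nu> ..
  note [measurable_cong] = sets
  have sp: "space \<mu> = extensional Q" "space \<nu> = extensional Q"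
    using sets_eq_imp_space_eq[OF sets(1)] sets_eq_imp_space_eq[OF sets(2)] by (auto simp: space_PiM PiE_def)
  define B where "B = {x \<in> extensional Q. \<forall>j\<in>J. inner_on Q (v j) x > 0}"
  have BN[measurable]: "B \<in> sets \<nu>"
  proof -
    have "{x \<in> space \<nu>. \<forall>j\<in>J. inner_on Q (v j) x > 0} \<in> sets \<nu>" using J by measurable
    then show ?thesis unfolding B_def sp .
  qed
  then have BM[measurable]: "B \<in> sets \<mu>" unfolding sets .
  \<comment> \<open>The points of the cone whose angle to each bounding hyperplane has a sine above
    \<open>h\<close>. These sets exhaust \<open>B\<close> as \<open>h\<close> tends to
    \<open>0\<close>.\<close>
  define Bh where "Bh = (\<lambda>h. {x \<in> extensional Q. \<forall>j\<in>J. inner_on Q (v j) x > h * (norm_on Q (v j) * norm_on Q x)})"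
  have BhN[measurable]: "Bh h \<in> sets \<nu>" for h
  proof -
    have "{x \<in> space \<nu>. \<forall>j\<in>J. inner_on Q (v j) x > h * (norm_on Q (v j) * norm_on Q x)} \<in> sets \<nu>"
      using J by measurable
    then show ?thesis unfolding Bh_def sp .
  qed
  have key: "emeasure \<nu> (Bh h) \<le> emeasure \<mu> B" if h: "0 < h" "h \<le> 1" for h
  proof -
    \<comment> \<open>The squared distance of two unit vectors is \<open>2\<close> minus twice their
      inner product, so an inner product above \<open>c\<close> means a distance below
      \<open>h\<close>.\<close>
    define c where "c = 1 - h\<^sup>2 / 2"
    have "h\<^sup>2 \<le> 1" using h by (simp add: power_le_one)
    then have c: "0 < c" "c < 1" using h by (auto simp: c_def)
    define cap where "cap = (\<lambda>y. {x \<in> extensional Q. c * norm_on Q x * norm_on Q y < inner_on Q y x})"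
    obtain y0 :: "'a \<Rightarrow> real" where y0: "\<not> (\<forall>q\<in>Q. y0 q = 0)"
    proof -
      have "\<exists>x. \<not> (\<forall>q\<in>Q. x q = (0::real))"
      proof (rule ccontr)
        assume "\<not> (\<exists>x. \<not> (\<forall>q\<in>Q. x q = (0::real)))"
        then have "AE x in \<mu>. False" using nz(1) by (auto elim: eventually_mono)
        then show False by (simp add: M.AE_False)
      qed
      then show ?thesis using that by blast
    qed
    define kM where "kM = emeasure \<mu> (cap y0)"
    define kN where "kN = emeasure \<nu> (cap y0)"
    have capM: "emeasure \<mu> (cap y) = kM" if "\<not> (\<forall>q\<in>Q. y q = 0)" for y
      using cap_measure_const[OF Q sets(1) inv(1) that y0, of c] by (simp add: cap_def kM_def sp)
    have capN: "emeasure \<nu> (cap y) = kN" if "\<not> (\<forall>q\<in>Q. y q = 0)" for y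
      using cap_measure_const[OF Q sets(2) inv(2) that y0, of c] by (simp add: cap_def kN_def sp)
    have capm: "cap y \<in> sets \<mu>" for y
    proof -
      have "{x \<in> space \<mu>. c * norm_on Q x * norm_on Q y < inner_on Q y x} \<in> sets \<mu>"
        by (rule sets_cap[OF sets(1)])
      then show ?thesis unfolding cap_def sp .
    qed
    have kM0: "kM \<noteq> 0"
    proof
      assume k0: "kM = 0"
      let ?Y = "{y \<in> PiE Q (\<lambda>_. \<rat> :: real set). \<not> (\<forall>q\<in>Q. y q = 0)}"
      have cY: "countable ?Y"
        by (rule countable_subset[of _ "PiE Q (\<lambda>_. \<rat>)"]) (auto intro!: countable_PiE Q countable_rat)
      have "AE x in \<mu>. \<forall>y\<in>?Y. x \<notin> cap y"
        using capm capM k0 by (intro AE_ball_countable[OF cY, THEN iffD2] ballI AE_not_in) (auto simp: null_sets_def)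
      with nz(1) AE_space[of \<mu>] have "AE x in \<mu>. False"
      proof eventually_elim
        fix x assume x: "\<not> (\<forall>q\<in>Q. x q = 0)" and xs: "x \<in> space \<mu>" and no: "\<forall>y\<in>?Y. x \<notin> cap y"
        from rational_point_in_cap[OF Q x c] obtain y where
          y: "y \<in> PiE Q (\<lambda>_. \<rat>)" "c * norm_on Q x * norm_on Q y < inner_on Q y x" by auto
        have "y \<in> ?Y"
        proof -
          have "\<forall>q\<in>Q. y q = 0 \<Longrightarrow> False" using y(2) by (simp add: inner_on_def norm_on_def)
          then show ?thesis using y(1) by blast
        qed
        then show False using no y xs by (auto simp: cap_def sp)
      qed
      then show False by (simp add: M.AE_False)
    qed
    define S where "S = {p \<in> space (\<mu> \<Otimes>\<^sub>M \<nu>). c * norm_on Q (fst p) * norm_on Q (snd p) < inner_on Q (snd p) (fst p)}"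
    have S[measurable]: "S \<in> sets (\<mu> \<Otimes>\<^sub>M \<nu>)" unfolding S_def by measurable
    have Sx: "Pair x -` S = cap x" if "x \<in> space \<mu>" for x
      using that by (auto simp: S_def cap_def space_pair_measure sp inner_on_commute mult_ac)
    have Sy: "(\<lambda>x. (x, y)) -` S = cap y" if "y \<in> space \<nu>" for y
      using that by (auto simp: S_def cap_def space_pair_measure sp)
    have kk: "kM = kN"
    proof -
      have "emeasure (\<mu> \<Otimes>\<^sub>M \<nu>) S = (\<integral>\<^sup>+x. emeasure \<nu> (Pair x -` S) \<partial>\<mu>)"
        by (rule N.emeasure_pair_measure_alt[OF S])
      also have "\<dots> = (\<integral>\<^sup>+x. kN \<partial>\<mu>)"
        using nz(1) AE_space[of \<mu>] by (intro nn_integral_cong_AE, eventually_elim) (simp add: Sx capN)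
      finally have 1: "emeasure (\<mu> \<Otimes>\<^sub>M \<nu>) S = kN" by (simp add: M.emeasure_space_1)
      have "emeasure (\<mu> \<Otimes>\<^sub>M \<nu>) S = (\<integral>\<^sup>+y. emeasure \<mu> ((\<lambda>x. (x, y)) -` S) \<partial>\<nu>)"
        by (rule PP.emeasure_pair_measure_alt2[OF S])
      also have "\<dots> = (\<integral>\<^sup>+y. kM \<partial>\<nu>)"
        using nz(2) AE_space[of \<nu>] by (intro nn_integral_cong_AE, eventually_elim) (simp add: Sy capM)
      finally show ?thesis using 1 by (simp add: N.emeasure_space_1)
    qed
    \<comment> \<open>Pairs at small angle with \<open>x \<in> B\<close>. Slices at fixed
      \<open>x\<close> give the mass \<open>kN * emeasure \<mu> B\<close>; slices at fixed
      \<open>y\<close> give at least \<open>kM * emeasure \<nu> (Bh h)\<close>, because caps around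
      points of \<open>Bh h\<close> stay in \<open>B\<close>. The factors agree and cancel.\<close>
    define T where "T = S \<inter> (B \<times> space \<nu>)"
    have T[measurable]: "T \<in> sets (\<mu> \<Otimes>\<^sub>M \<nu>)" unfolding T_def by measurable
    have "emeasure (\<mu> \<Otimes>\<^sub>M \<nu>) T = (\<integral>\<^sup>+x. emeasure \<nu> (Pair x -` T) \<partial>\<mu>)"
      by (rule N.emeasure_pair_measure_alt[OF T])
    also have "\<dots> = (\<integral>\<^sup>+x. kN * indicator B x \<partial>\<mu>)"
      using nz(1) AE_space[of \<mu>]
    proof (intro nn_integral_cong_AE, eventually_elim)
      fix x assume x: "\<not> (\<forall>q\<in>Q. x q = 0)" "x \<in> space \<mu>"
      show "emeasure \<nu> (Pair x -` T) = kN * indicator B x"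
      proof (cases "x \<in> B")
        case True
        then have "Pair x -` T = Pair x -` S" by (auto simp: T_def S_def space_pair_measure)
        then show ?thesis using True Sx[OF x(2)] capN[OF x(1)] by simp
      next
        case False
        then have "Pair x -` T = {}" by (auto simp: T_def)
        then show ?thesis using False by simp
      qed
    qed
    also have "\<dots> = kN * emeasure \<mu> B" by (rule nn_integral_cmult_indicator) (rule BM)
    finally have 1: "emeasure (\<mu> \<Otimes>\<^sub>M \<nu>) T = kN * emeasure \<mu> B" .
    have incl: "x \<in> B" if y: "y \<in> Bh h" and x: "x \<in> cap y" for x y
    proof -
      define n where "n = norm_on Q x"
      define l where "l = norm_on Q y"
      have i: "c * n * l < inner_on Q y x" using x by (simp add: cap_def n_def l_def)
      have n: "n > 0" and l: "l > 0"
      proof -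
        have "0 \<le> c * n * l" using c by (simp add: n_def l_def)
        with i have "inner_on Q y x > 0" by linarith
        moreover have "inner_on Q y x = 0" if "(\<forall>q\<in>Q. x q = 0) \<or> (\<forall>q\<in>Q. y q = 0)"
          using that unfolding inner_on_def by (intro sum.neutral) auto
        ultimately have "\<not> (\<forall>q\<in>Q. x q = 0)" "\<not> (\<forall>q\<in>Q. y q = 0)" by force+
        then show "n > 0" "l > 0" unfolding n_def l_def using norm_on_pos[OF Q] by blast+
      qed
      let ?w = "\<lambda>q. (1/n) * x q - (1/l) * y q"
      have "(norm_on Q ?w)\<^sup>2 = (1/n)\<^sup>2 * n\<^sup>2 + (1/l)\<^sup>2 * l\<^sup>2 - 2 * ((1/n) * (1/l) * inner_on Q y x)"
        unfolding norm_on_square n_def[symmetric] inner_on_diff_left inner_on_diff_right inner_on_scale_left inner_on_scale_right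
        unfolding n_def l_def norm_on_square
        by (simp add: power2_eq_square inner_on_commute[of Q y x] algebra_simps)
      also have "\<dots> = 2 - 2 * (inner_on Q y x / (n * l))" using n l by (simp add: power_divide)
      also have "\<dots> < 2 - 2 * c" using i n l by (simp add: field_simps)
      also have "\<dots> = h\<^sup>2" by (simp add: c_def)
      finally have w: "norm_on Q ?w < h" by (rule power_less_imp_less_base) (use h in simp)
      have "inner_on Q (v j) x > 0" if j: "j \<in> J" for j
      proof -
        have "h * (norm_on Q (v j) * l) < inner_on Q (v j) y" using y j by (simp add: Bh_def l_def)
        then have a: "h * norm_on Q (v j) < (1/l) * inner_on Q (v j) y" using l by (simp add: field_simps)
        have "\<bar>inner_on Q (v j) ?w\<bar> \<le> norm_on Q (v j) * norm_on Q ?w" by (rule Cauchy_Schwarz_inner_on)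
        also have "\<dots> \<le> norm_on Q (v j) * h" using w by (intro mult_left_mono) auto
        finally have "inner_on Q (v j) ?w \<ge> - (norm_on Q (v j) * h)" by simp
        moreover have "inner_on Q (v j) ?w = (1/n) * inner_on Q (v j) x - (1/l) * inner_on Q (v j) y"
          by (simp only: inner_on_diff_right inner_on_scale_right)
        ultimately have "(1/n) * inner_on Q (v j) x > 0" using a by (simp add: mult.commute)
        then show ?thesis using n by (simp add: zero_less_divide_iff)
      qed
      then show ?thesis using x by (simp add: B_def cap_def)
    qed
    have "kM * emeasure \<nu> (Bh h) = (\<integral>\<^sup>+y. kM * indicator (Bh h) y \<partial>\<nu>)"
      by (rule nn_integral_cmult_indicator[symmetric]) (rule BhN)
    also have "\<dots> \<le> (\<integral>\<^sup>+y. emeasure \<mu> ((\<lambda>x. (x, y)) -` T) \<partial>\<nu>)"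
      using nz(2) AE_space[of \<nu>]
    proof (intro nn_integral_mono_AE, eventually_elim)
      fix y assume y: "\<not> (\<forall>q\<in>Q. y q = 0)" "y \<in> space \<nu>"
      show "kM * indicator (Bh h) y \<le> emeasure \<mu> ((\<lambda>x. (x, y)) -` T)"
      proof (cases "y \<in> Bh h")
        case True
        have "(\<lambda>x. (x, y)) -` T = cap y"
          using Sy[OF y(2)] incl[OF True] y(2) by (auto simp: T_def)
        then show ?thesis using True capM[OF y(1)] by simp
      qed simp
    qed
    also have "\<dots> = emeasure (\<mu> \<Otimes>\<^sub>M \<nu>) T" by (rule PP.emeasure_pair_measure_alt2[OF T, symmetric])
    finally have "kM * emeasure \<nu> (Bh h) \<le> kM * emeasure \<mu> B" unfolding 1 kk .
    moreover have "kM < top" unfolding kM_def by (simp add: less_top[symmetric] M.emeasure_finite)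
    ultimately show ?thesis using kM0 by (simp add: ennreal_mult_le_mult_iff)
  qed
  define F where "F = (\<lambda>n. Bh (1 / real (Suc n)))"
  have "incseq F"
  proof (rule incseq_SucI, rule subsetI)
    fix n x assume x: "x \<in> F n"
    have "1 / real (Suc (Suc n)) * (norm_on Q (v j) * norm_on Q x) \<le> 1 / real (Suc n) * (norm_on Q (v j) * norm_on Q x)" for j
      by (intro mult_right_mono mult_nonneg_nonneg) (auto simp: field_simps)
    then show "x \<in> F (Suc n)" using x unfolding F_def Bh_def by (auto intro: le_less_trans)
  qed
  moreover have "(\<Union>n. F n) = B"
  proof (intro equalityI subsetI)
    fix x assume "x \<in> (\<Union>n. F n)"
    then obtain n where "x \<in> F n" by auto
    moreover have "0 \<le> 1 / real (Suc n) * (norm_on Q (v j) * norm_on Q x)" for j by simp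
    ultimately show "x \<in> B" unfolding F_def Bh_def B_def by (blast intro: le_less_trans)
  next
    fix x assume x: "x \<in> B"
    have "eventually (\<lambda>n. 1 / real (Suc n) * (norm_on Q (v j) * norm_on Q x) < inner_on Q (v j) x) sequentially"
      if "j \<in> J" for j
    proof (rule order_tendstoD(2))
      show "(\<lambda>n. 1 / real (Suc n) * (norm_on Q (v j) * norm_on Q x)) \<longlonglongrightarrow> 0"
        using tendsto_mult_right[OF LIMSEQ_inverse_real_of_nat, of "norm_on Q (v j) * norm_on Q x"]
        by (simp add: inverse_eq_divide)
      show "0 < inner_on Q (v j) x" using x that by (simp add: B_def)
    qed
    then have "eventually (\<lambda>n. \<forall>j\<in>J. 1 / real (Suc n) * (norm_on Q (v j) * norm_on Q x) < inner_on Q (v j) x) sequentially"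
      using J by (intro eventually_ball_finite) auto
    then obtain n where "\<forall>j\<in>J. 1 / real (Suc n) * (norm_on Q (v j) * norm_on Q x) < inner_on Q (v j) x"
      by (auto simp: eventually_sequentially)
    then show "x \<in> (\<Union>n. F n)" using x by (auto simp: F_def Bh_def B_def intro!: exI[of _ n])
  qed
  moreover have "range F \<subseteq> sets \<nu>" unfolding F_def using BhN by auto
  ultimately have "emeasure \<nu> B = (SUP n. emeasure \<nu> (F n))" using SUP_emeasure_incseq[of F \<nu>] by simp
  also have "\<dots> \<le> emeasure \<mu> B"
    unfolding F_def by (intro SUP_least key) auto
  finally show ?thesis by (simp add: B_def sp)
qed

section \<open>Probability that a pair of a primal and a dual vector satisfies cone
  conditions\<close>

lemma emeasure_gauss_Un_Times:
  assumes fin: "finite Q" "finite R" "Q \<inter> R = {}"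
    and B: "B \<in> sets (PiM Q (\<lambda>_. borel))" and C: "C \<in> sets (PiM R (\<lambda>_. borel))"
  shows "emeasure (gauss (Q \<union> R)) {g \<in> space (gauss (Q \<union> R)). restrict g Q \<in> B \<and> restrict g R \<in> C}
     = emeasure (gauss Q) B * emeasure (gauss R) C"
proof -
  interpret N: product_sigma_finite "\<lambda>_. stdn" by (rule product_sigma_finite_stdn)
  interpret GR: prob_space "gauss R" by (rule prob_space_gauss)
  have d: "distr (gauss Q \<Otimes>\<^sub>M gauss R) (gauss (Q \<union> R)) (merge Q R) = gauss (Q \<union> R)"
    unfolding gauss_def using fin by (intro N.distr_merge)
  have mm: "merge Q R \<in> measurable (gauss Q \<Otimes>\<^sub>M gauss R) (gauss (Q \<union> R))"
    unfolding gauss_def by (rule measurable_merge)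
  let ?E = "{g \<in> space (gauss (Q \<union> R)). restrict g Q \<in> B \<and> restrict g R \<in> C}"
  have rQ: "(\<lambda>g. restrict g Q) \<in> measurable (gauss (Q \<union> R)) (PiM Q (\<lambda>_. borel))"
    by (simp add: measurable_cong_sets[OF sets_gauss refl] measurable_restrict_subset)
  have rR: "(\<lambda>g. restrict g R) \<in> measurable (gauss (Q \<union> R)) (PiM R (\<lambda>_. borel))"
    by (simp add: measurable_cong_sets[OF sets_gauss refl] measurable_restrict_subset)
  have "?E = ((\<lambda>g. restrict g Q) -` B \<inter> space (gauss (Q \<union> R))) \<inter> ((\<lambda>g. restrict g R) -` C \<inter> space (gauss (Q \<union> R)))"
    by auto
  also have "\<dots> \<in> sets (gauss (Q \<union> R))"
    by (intro sets.Int measurable_sets[OF rQ B] measurable_sets[OF rR C])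
  finally have E: "?E \<in> sets (gauss (Q \<union> R))" .
  have BE: "B \<subseteq> extensional Q" and CE: "C \<subseteq> extensional R"
    using sets.sets_into_space[OF B] sets.sets_into_space[OF C] by (auto simp: space_PiM PiE_def)
  have pre: "merge Q R -` ?E \<inter> space (gauss Q \<Otimes>\<^sub>M gauss R) = B \<times> C"
  proof -
    have "restrict (merge Q R (x, y)) Q = x" if "x \<in> extensional Q" for x and y :: "'a \<Rightarrow> real"
      using that by (auto simp: merge_def restrict_def extensional_def fun_eq_iff)
    moreover have "restrict (merge Q R (x, y)) R = y" if "y \<in> extensional R" for x and y :: "'a \<Rightarrow> real"
      using that fin(3) by (auto simp: merge_def restrict_def extensional_def fun_eq_iff)
    moreover have "merge Q R p \<in> extensional (Q \<union> R)" for p :: "('a \<Rightarrow> real) \<times> ('a \<Rightarrow> real)"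
      by (cases p) (auto simp: merge_def extensional_def)
    ultimately show ?thesis using BE CE by (auto simp: space_gauss space_pair_measure)
  qed
  have "emeasure (gauss (Q \<union> R)) ?E = emeasure (distr (gauss Q \<Otimes>\<^sub>M gauss R) (gauss (Q \<union> R)) (merge Q R)) ?E"
    by (simp add: d)
  also have "\<dots> = emeasure (gauss Q \<Otimes>\<^sub>M gauss R) (B \<times> C)"
    unfolding pre[symmetric] by (rule emeasure_distr[OF mm E])
  also have "\<dots> = emeasure (gauss Q) B * emeasure (gauss R) C"
    using B C by (intro GR.emeasure_pair_measure_Times) (auto simp: sets_gauss)
  finally show ?thesis .
qed

lemma AE_gauss_nonzero:
  assumes "finite Q" "Q \<noteq> {}"
  shows "AE x in gauss Q. \<not> (\<forall>q\<in>Q. x q = 0)"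
proof -
  obtain q where q: "q \<in> Q" using assms by auto
  have "AE x in gauss Q. x q \<noteq> 0"
    unfolding gauss_def using q by (intro AE_PiM_component[OF prob_space_stdn] AE_stdn_neq)
  then show ?thesis using q by (auto elim: eventually_mono)
qed

lemma measurable_gauss_cong: "f \<in> measurable (gauss I) M \<longleftrightarrow> f \<in> measurable (PiM I (\<lambda>_. borel)) M"
  by (rule arg_cong2[where f="(\<in>)"] refl measurable_cong_sets sets_gauss)+

text \<open>Reflecting the rows of \<open>A\<close> along a vector supported on \<open>Q\<close>
  preserves the law of \<open>A\<close> and reflects \<open>X A\<close>. Hence the law of
  \<open>X A\<close> on \<open>Q\<close> is invariant, and it can be compared with a Gaussian vector
  on cones.\<close>

lemma emeasure_equivariant_cone:
  fixes X :: "('a \<times> 'b \<Rightarrow> real) \<Rightarrow> 'b \<Rightarrow> real" and v :: "'j \<Rightarrow> 'b \<Rightarrow> real"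
  assumes fin: "finite M" "finite N" "finite J" and Q: "Q \<subseteq> N" "Q \<noteq> {}"
    and X: "\<And>q. q \<in> Q \<Longrightarrow> (\<lambda>A. X A q) \<in> borel_measurable (PiM (M \<times> N) (\<lambda>_. borel))"
    and equi: "\<And>u. (\<And>i. i \<notin> Q \<Longrightarrow> u i = 0) \<Longrightarrow>
       AE A in gauss (M \<times> N). \<forall>q\<in>Q. X (row_refl M N u A) q = refl_on_set Q u (X A) q"
    and nz: "AE A in gauss (M \<times> N). \<not> (\<forall>q\<in>Q. X A q = 0)"
  shows "emeasure (gauss Q) {x \<in> space (gauss Q). \<forall>j\<in>J. inner_on Q (v j) x > 0}
    \<le> emeasure (gauss (M \<times> N)) {A \<in> space (gauss (M \<times> N)). \<forall>j\<in>J. inner_on Q (v j) (X A) > 0}"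
proof -
  let ?G = "gauss (M \<times> N)" and ?PQ = "PiM Q (\<lambda>_. borel :: real measure)"
  have fQ: "finite Q" using fin(2) Q(1) by (rule finite_subset[rotated])
  interpret G: prob_space ?G by (rule prob_space_gauss)
  define f where "f = (\<lambda>A. \<lambda>q\<in>Q. X A q)"
  have mf: "f \<in> measurable (PiM (M \<times> N) (\<lambda>_. borel)) ?PQ" unfolding f_def using X by (intro measurable_restrict)
  then have mfG: "f \<in> measurable ?G ?PQ" unfolding measurable_gauss_cong .
  define \<mu> where "\<mu> = distr ?G ?PQ f"
  have sets\<mu>: "sets \<mu> = sets ?PQ" by (simp add: \<mu>_def)
  have space\<mu>: "space \<mu> = extensional Q" by (auto simp: \<mu>_def space_PiM PiE_def)
  have inv: "distr \<mu> ?PQ (refl_on_set Q u) = \<mu>" for u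
  proof -
    \<comment> \<open>Equivariance is available only for directions that vanish off
      \<open>Q\<close>; on \<open>Q\<close> the truncation defines the same reflection.\<close>
    define u' where "u' = (\<lambda>i. if i \<in> Q then u i else 0)"
    have u': "refl_on_set Q u = refl_on_set Q u'"
      unfolding refl_on_set_def u'_def by (auto simp: fun_eq_iff inner_on_def)
    have mr: "row_refl M N u' \<in> measurable ?G (PiM (M \<times> N) (\<lambda>_. borel))"
      unfolding measurable_gauss_cong by (rule measurable_row_refl)
    have "distr \<mu> ?PQ (refl_on_set Q u) = distr ?G ?PQ (refl_on_set Q u' \<circ> f)"
      unfolding \<mu>_def u' by (rule distr_distr[OF measurable_refl_on_set mfG])
    also have "\<dots> = distr ?G ?PQ (f \<circ> row_refl M N u')"
    proof (rule distr_cong_AE)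
      have "AE A in ?G. \<forall>q\<in>Q. X (row_refl M N u' A) q = refl_on_set Q u' (X A) q"
        by (rule equi) (simp add: u'_def)
      then show "AE A in ?G. (refl_on_set Q u' \<circ> f) A = (f \<circ> row_refl M N u') A"
      proof eventually_elim
        case (elim A)
        have "refl_on_set Q u' (f A) = refl_on_set Q u' (X A)"
          unfolding f_def refl_on_set_def by (auto simp: fun_eq_iff)
        also have "\<dots> = f (row_refl M N u' A)"
        proof
          fix q show "refl_on_set Q u' (X A) q = f (row_refl M N u' A) q"
            using elim by (cases "q \<in> Q") (auto simp: f_def, simp add: refl_on_set_def)
        qed
        finally show ?case by simp
      qed
      show "refl_on_set Q u' \<circ> f \<in> measurable ?G ?PQ"
        using mfG measurable_refl_on_set by (rule measurable_comp)
      show "f \<circ> row_refl M N u' \<in> measurable ?G ?PQ"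
        using mr mf by (rule measurable_comp)
    qed auto
    also have "\<dots> = distr (distr ?G (PiM (M \<times> N) (\<lambda>_. borel)) (row_refl M N u')) ?PQ f"
      by (rule distr_distr[OF mf mr, symmetric])
    also have "\<dots> = \<mu>" unfolding distr_gauss_row_refl[OF fin(1,2)] \<mu>_def ..
    finally show ?thesis .
  qed
  have nz\<mu>: "AE x in \<mu>. \<not> (\<forall>q\<in>Q. x q = 0)"
  proof -
    have "{x \<in> space ?PQ. norm_on Q x \<noteq> 0} \<in> sets ?PQ" by measurable
    then have m: "{x \<in> space ?PQ. \<not> (\<forall>q\<in>Q. x q = 0)} \<in> sets ?PQ" unfolding norm_on_eq_0_iff[OF fQ] .
    show ?thesis unfolding \<mu>_def using nz
      by (subst AE_distr_iff[OF mfG m]) (auto simp: f_def)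
  qed
  have "emeasure (gauss Q) {x \<in> space (gauss Q). \<forall>j\<in>J. inner_on Q (v j) x > 0}
    \<le> emeasure \<mu> {x \<in> space \<mu>. \<forall>j\<in>J. inner_on Q (v j) x > 0}"
  proof (rule emeasure_cone_le_of_invariant[OF fQ _ prob_space_gauss sets\<mu> sets_gauss inv distr_gauss_refl[OF fQ] nz\<mu> AE_gauss_nonzero[OF fQ Q(2)] fin(3)])
    show "prob_space \<mu>" unfolding \<mu>_def using mfG by (rule G.prob_space_distr)
  qed
  also have "\<dots> = emeasure ?G (f -` {x \<in> space \<mu>. \<forall>j\<in>J. inner_on Q (v j) x > 0} \<inter> space ?G)"
  proof -
    have "{x \<in> space ?PQ. \<forall>j\<in>J. inner_on Q (v j) x > 0} \<in> sets ?PQ" using fin(3) by measurable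
    then show ?thesis unfolding \<mu>_def space_distr by (rule emeasure_distr[OF mfG])
  qed
  also have "f -` {x \<in> space \<mu>. \<forall>j\<in>J. inner_on Q (v j) x > 0} \<inter> space ?G
     = {A \<in> space ?G. \<forall>j\<in>J. inner_on Q (v j) (X A) > 0}"
    unfolding space\<mu> by (auto simp: f_def)
  finally show ?thesis .
qed

text \<open>Condition on the columns outside \<open>R\<close>. Then \<open>X A\<close> and
  \<open>Y A\<close> are fixed, while the columns in \<open>R\<close> are still fresh, so their
  combination with coefficients \<open>Y A\<close> lies in the cone \<open>C\<close> with a
  probability that does not depend on the condition. The probability thus factors, just as it does
  for the two blocks of a Gaussian vector.\<close>

lemma emeasure_certificate_ge:
  fixes X :: "('a \<times> 'b \<Rightarrow> real) \<Rightarrow> 'b \<Rightarrow> real" and Y :: "('a \<times> 'b \<Rightarrow> real) \<Rightarrow> 'a \<Rightarrow> real"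
    and v :: "'j \<Rightarrow> 'b \<Rightarrow> real"
  assumes fin: "finite M" "finite N" "finite J" and Q: "Q \<subseteq> N" "Q \<noteq> {}" and R: "R \<subseteq> N" "Q \<inter> R = {}"
    and X: "\<And>q. q \<in> Q \<Longrightarrow> (\<lambda>A. X A q) \<in> borel_measurable (PiM (M \<times> N) (\<lambda>_. borel))"
    and Y: "\<And>l. l \<in> M \<Longrightarrow> (\<lambda>A. Y A l) \<in> borel_measurable (PiM (M \<times> N) (\<lambda>_. borel))"
    and depX: "\<And>A A' q. (\<And>l i. l \<in> M \<Longrightarrow> i \<in> N - R \<Longrightarrow> A (l, i) = A' (l, i)) \<Longrightarrow> q \<in> Q \<Longrightarrow> X A q = X A' q"
    and depY: "\<And>A A' l. (\<And>l i. l \<in> M \<Longrightarrow> i \<in> N - R \<Longrightarrow> A (l, i) = A' (l, i)) \<Longrightarrow> l \<in> M \<Longrightarrow> Y A l = Y A' l"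
    and equi: "\<And>u. (\<And>i. i \<notin> Q \<Longrightarrow> u i = 0) \<Longrightarrow>
       AE A in gauss (M \<times> N). \<forall>q\<in>Q. X (row_refl M N u A) q = refl_on_set Q u (X A) q"
    and nzX: "AE A in gauss (M \<times> N). \<not> (\<forall>q\<in>Q. X A q = 0)"
    and nzY: "AE A in gauss (M \<times> N). \<not> (\<forall>l\<in>M. Y A l = 0)"
    and C: "C \<in> sets (PiM R (\<lambda>_. borel))"
    and cone: "\<And>c x. c > 0 \<Longrightarrow> x \<in> extensional R \<Longrightarrow> (\<lambda>i\<in>R. c * x i) \<in> C \<longleftrightarrow> x \<in> C"
  shows "emeasure (gauss (Q \<union> R)) {g \<in> space (gauss (Q \<union> R)). (\<forall>j\<in>J. inner_on Q (v j) g > 0) \<and> restrict g R \<in> C}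
    \<le> emeasure (gauss (M \<times> N)) {A \<in> space (gauss (M \<times> N)). (\<forall>j\<in>J. inner_on Q (v j) (X A) > 0) \<and>
           (\<lambda>i\<in>R. inner_on M (Y A) (\<lambda>l. A (l, i))) \<in> C}" (is "_ \<le> emeasure ?G ?Ev")
    and "{A \<in> space (gauss (M \<times> N)). (\<forall>j\<in>J. inner_on Q (v j) (X A) > 0) \<and>
           (\<lambda>i\<in>R. inner_on M (Y A) (\<lambda>l. A (l, i))) \<in> C} \<in> sets (gauss (M \<times> N))"
proof -
  interpret NN: product_sigma_finite "\<lambda>_. stdn" by (rule product_sigma_finite_stdn)
  have fQ: "finite Q" and fR: "finite R" using fin(2) Q R by (auto intro: finite_subset)
  define I1 where "I1 = M \<times> (N - R)"
  define I2 where "I2 = M \<times> R"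
  have I: "I1 \<inter> I2 = {}" "finite I1" "finite I2" "I1 \<union> I2 = M \<times> N"
    using fin R fR by (auto simp: I1_def I2_def)
  interpret G2: prob_space "gauss I2" by (rule prob_space_gauss)
  let ?P = "PiM (M \<times> N) (\<lambda>_. borel :: real measure)"
  note X[measurable] Y[measurable] C[measurable]
  have eG: "Measurable.pred ?G p \<longleftrightarrow> Measurable.pred ?P p" for p
    by (rule measurable_gauss_cong)
  have pX: "Measurable.pred ?P (\<lambda>A. \<forall>j\<in>J. inner_on Q (v j) (X A) > 0)" using fin(3) by measurable
  have pY: "Measurable.pred ?P (\<lambda>A. \<not> (\<forall>l\<in>M. Y A l = 0))" using fin(1) by measurable
  have mC: "(\<lambda>A. \<lambda>i\<in>R. inner_on M (Y A) (\<lambda>l. A (l, i))) \<in> measurable ?P (PiM R (\<lambda>_. borel))"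
    using R by (intro measurable_restrict measurable_inner_on Y) auto
  have pC: "Measurable.pred ?P (\<lambda>A. (\<lambda>i\<in>R. inner_on M (Y A) (\<lambda>l. A (l, i))) \<in> C)"
    by (rule measurable_compose[OF mC]) simp
  show sEv: "?Ev \<in> sets ?G"
    using pX pC unfolding eG[symmetric] by (intro predE pred_intros_logic)
  \<comment> \<open>Where \<open>Y A\<close> vanishes, the combination of the fresh columns is zero
    instead of a nondegenerate Gaussian vector. This null set is removed, so that every remaining
    slice has measure exactly \<open>emeasure (gauss R) C\<close>.\<close>
  define E' where "E' = {A \<in> space ?G. (\<forall>j\<in>J. inner_on Q (v j) (X A) > 0) \<and> \<not> (\<forall>l\<in>M. Y A l = 0)}"
  have sE': "E' \<in> sets ?G"
  proof -
    have "E' = {A \<in> space ?G. \<forall>j\<in>J. inner_on Q (v j) (X A) > 0} \<inter> {A \<in> space ?G. \<not> (\<forall>l\<in>M. Y A l = 0)}"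
      by (auto simp: E'_def)
    then show ?thesis using pX pY unfolding eG[symmetric] by (simp only:) (intro sets.Int predE)
  qed
  define Ev' where "Ev' = ?Ev \<inter> E'"
  have sEv': "Ev' \<in> sets ?G" unfolding Ev'_def using sEv sE' by (rule sets.Int)
  define E1 where "E1 = {x. (\<forall>j\<in>J. inner_on Q (v j) (X x) > 0) \<and> \<not> (\<forall>l\<in>M. Y x l = 0)}"
  have depXm: "X (merge I1 I2 (x, y)) q = X x q" if "q \<in> Q" for x y q
    using that by (intro depX) (auto simp: merge_def I1_def)
  have depYm: "Y (merge I1 I2 (x, y)) l = Y x l" if "l \<in> M" for x y l
    using that by (intro depY) (auto simp: merge_def I1_def)
  have iX: "inner_on Q (v j) (X (merge I1 I2 (x, y))) = inner_on Q (v j) (X x)" for x y j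
    by (intro inner_on_cong) (auto simp: depXm)
  have sp: "merge I1 I2 (x, y) \<in> space ?G" for x y
    unfolding space_gauss I(4)[symmetric] by (auto simp: merge_def extensional_def)
  have mE1: "merge I1 I2 (x, y) \<in> E' \<longleftrightarrow> x \<in> E1" for x y
    unfolding E'_def E1_def using sp by (simp add: iX depYm)
  have fold: "emeasure ?G S = (\<integral>\<^sup>+x. emeasure (gauss I2) ((\<lambda>y. merge I1 I2 (x, y)) -` S \<inter> space (gauss I2)) \<partial>gauss I1)"
    and foldm: "(\<lambda>x. emeasure (gauss I2) ((\<lambda>y. merge I1 I2 (x, y)) -` S \<inter> space (gauss I2))) \<in> borel_measurable (gauss I1)"
    if "S \<in> sets ?G" for S
    using that NN.emeasure_fold_integral[OF I(1-3), of S] NN.emeasure_fold_measurable[OF I(1-3), of S]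
    unfolding gauss_def I(4) by auto
  have fE': "emeasure (gauss I2) ((\<lambda>y. merge I1 I2 (x, y)) -` E' \<inter> space (gauss I2)) = indicator E1 x" for x
  proof (cases "x \<in> E1")
    case True
    then have "(\<lambda>y. merge I1 I2 (x, y)) -` E' \<inter> space (gauss I2) = space (gauss I2)" using mE1 by auto
    then show ?thesis using True by (simp add: G2.emeasure_space_1)
  next
    case False
    then have "(\<lambda>y. merge I1 I2 (x, y)) -` E' \<inter> space (gauss I2) = {}" using mE1 by auto
    then show ?thesis using False by simp
  qed
  have fEv': "emeasure (gauss I2) ((\<lambda>y. merge I1 I2 (x, y)) -` Ev' \<inter> space (gauss I2)) = emeasure (gauss R) C * indicator E1 x" for x
  proof (cases "x \<in> E1")
    case True
    have "(\<lambda>i\<in>R. inner_on M (Y (merge I1 I2 (x, y))) (\<lambda>l. merge I1 I2 (x, y) (l, i))) = (\<lambda>i\<in>R. inner_on M (Y x) (\<lambda>l. y (l, i)))" for y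
    proof (intro restrict_ext inner_on_cong)
      fix i l assume "i \<in> R" "l \<in> M"
      then show "merge I1 I2 (x, y) (l, i) = y (l, i)" by (simp add: merge_def I1_def I2_def)
    qed (rule depYm)
    then have "(\<lambda>y. merge I1 I2 (x, y)) -` Ev' \<inter> space (gauss I2) = {y \<in> space (gauss I2). (\<lambda>i\<in>R. inner_on M (Y x) (\<lambda>l. y (l, i))) \<in> C}"
      using True mE1 sp unfolding Ev'_def by (auto simp: E1_def iX)
    then show ?thesis using True emeasure_gauss_linear_image_cone[OF fin(1) fR _ C cone, of "Y x"]
      by (simp add: I2_def E1_def)
  next
    case False
    then have "(\<lambda>y. merge I1 I2 (x, y)) -` Ev' \<inter> space (gauss I2) = {}" using mE1 by (auto simp: Ev'_def)
    then show ?thesis using False by simp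
  qed
  have mI: "(\<lambda>x. indicator E1 x :: ennreal) \<in> borel_measurable (gauss I1)"
    using foldm[OF sE'] unfolding fE' .
  have "emeasure ?G Ev' = emeasure (gauss R) C * emeasure ?G E'"
    unfolding fold[OF sEv'] fold[OF sE'] fE' fEv' by (rule nn_integral_cmult[OF mI])
  moreover have "emeasure ?G E' = emeasure ?G {A \<in> space ?G. \<forall>j\<in>J. inner_on Q (v j) (X A) > 0}"
  proof (rule emeasure_eq_AE[OF _ sE'])
    show "AE A in ?G. A \<in> E' \<longleftrightarrow> A \<in> {A \<in> space ?G. \<forall>j\<in>J. inner_on Q (v j) (X A) > 0}"
      using nzY by eventually_elim (auto simp: E'_def)
    show "{A \<in> space ?G. \<forall>j\<in>J. inner_on Q (v j) (X A) > 0} \<in> sets ?G"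
      using pX unfolding eG[symmetric] by (rule predE)
  qed
  ultimately have 1: "emeasure ?G Ev' = emeasure (gauss R) C * emeasure ?G {A \<in> space ?G. \<forall>j\<in>J. inner_on Q (v j) (X A) > 0}"
    by simp
  let ?B = "{x \<in> space (gauss Q). \<forall>j\<in>J. inner_on Q (v j) x > 0}"
  have sB: "?B \<in> sets (PiM Q (\<lambda>_. borel))"
  proof -
    have "{x \<in> space (PiM Q (\<lambda>_. borel)). \<forall>j\<in>J. inner_on Q (v j) x > 0} \<in> sets (PiM Q (\<lambda>_. borel))" using fin(3) by measurable
    then show ?thesis by (simp add: space_gauss space_PiM PiE_def)
  qed
  have "{g \<in> space (gauss (Q \<union> R)). (\<forall>j\<in>J. inner_on Q (v j) g > 0) \<and> restrict g R \<in> C}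
     = {g \<in> space (gauss (Q \<union> R)). restrict g Q \<in> ?B \<and> restrict g R \<in> C}"
    by (auto simp: space_gauss)
  then have "emeasure (gauss (Q \<union> R)) {g \<in> space (gauss (Q \<union> R)). (\<forall>j\<in>J. inner_on Q (v j) g > 0) \<and> restrict g R \<in> C}
     = emeasure (gauss Q) ?B * emeasure (gauss R) C"
    using emeasure_gauss_Un_Times[OF fQ fR R(2) sB C] by simp
  also have "\<dots> \<le> emeasure ?G {A \<in> space ?G. \<forall>j\<in>J. inner_on Q (v j) (X A) > 0} * emeasure (gauss R) C"
    using emeasure_equivariant_cone[OF fin Q X equi nzX, of v] by (intro mult_right_mono) auto
  also have "\<dots> = emeasure ?G Ev'" using 1 by (simp add: mult.commute)
  also have "\<dots> \<le> emeasure ?G ?Ev" by (rule emeasure_mono[OF _ sEv]) (auto simp: Ev'_def)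
  finally show "emeasure (gauss (Q \<union> R)) {g \<in> space (gauss (Q \<union> R)). (\<forall>j\<in>J. inner_on Q (v j) g > 0) \<and> restrict g R \<in> C}
    \<le> emeasure ?G ?Ev" .
qed

lemma inner_on_support:
  assumes "Q \<subseteq> N" "finite N" "\<And>i. i \<notin> Q \<Longrightarrow> u i = 0"
  shows "inner_on N u x = inner_on Q u x"
  unfolding inner_on_def using assms by (intro sum.mono_neutral_right) auto

lemma row_refl_support:
  assumes "Q \<subseteq> N" "finite N" "\<And>i. i \<notin> Q \<Longrightarrow> u i = 0" "l \<in> M" "i \<in> N"
  shows "row_refl M N u A (l, i) = (if i \<in> Q then refl_on_set Q u (\<lambda>j. A (l, j)) i else A (l, i))"
  using assms(4,5) assms(3)[of i] unfolding row_refl_def refl_on_set_def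
  by (simp add: inner_on_support[OF assms(1-3)])

lemma AE_gauss_row_refl:
  assumes "finite M" "finite N" "AE A in gauss (M \<times> N). P A"
  shows "AE A in gauss (M \<times> N). P (row_refl M N u A)"
proof -
  have m: "row_refl M N u \<in> measurable (gauss (M \<times> N)) (PiM (M \<times> N) (\<lambda>_. borel))"
    unfolding measurable_gauss_cong by (rule measurable_row_refl)
  have "AE A in distr (gauss (M \<times> N)) (PiM (M \<times> N) (\<lambda>_. borel)) (row_refl M N u). P A"
    unfolding distr_gauss_row_refl[OF assms(1,2)] by (rule assms(3))
  from AE_distrD[OF m this] show ?thesis .
qed

lemma refl_on_set_lincomb:
  assumes "i \<in> Q"
  shows "refl_on_set Q u (\<lambda>i. \<Sum>l\<in>L. c l * x l i) i = (\<Sum>l\<in>L. c l * refl_on_set Q u (x l) i)"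
proof -
  have "inner_on Q u (\<lambda>i. \<Sum>l\<in>L. c l * x l i) = (\<Sum>l\<in>L. c l * inner_on Q u (x l))"
    by (simp only: inner_on_sum_right inner_on_scale_right)
  then show ?thesis using assms
    by (simp add: refl_on_set_def sum_subtractf right_diff_distrib sum_distrib_left sum_distrib_right
        sum_divide_distrib mult_ac)
qed

text \<open>With \<open>B\<close> the submatrix of rows \<open>D\<close> and columns \<open>qs\<close> (at least as many rows as columns) and \<open>g\<close> the
  row \<open>p\<close>, \<open>under_coef\<close> solves \<open>B\<^sup>T B c = g\<close>; the combination of the rows of \<open>A\<close> with coefficients
  \<open>under_dual\<close> vanishes on the columns \<open>qs\<close>.\<close>
definition under_coef :: "'a set \<Rightarrow> 'a \<Rightarrow> 'b list \<Rightarrow> ('a \<times> 'b \<Rightarrow> real) \<Rightarrow> 'b \<Rightarrow> real" where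
  "under_coef D p qs A = gs_coef qs D (\<lambda>q l. A (l, q)) (\<lambda>q. A (p, q))"

definition under_dual :: "'a set \<Rightarrow> 'a \<Rightarrow> 'b list \<Rightarrow> ('a \<times> 'b \<Rightarrow> real) \<Rightarrow> 'a \<Rightarrow> real" where
  "under_dual D p qs A l = (if l = p then 1 else - (\<Sum>q\<in>set qs. under_coef D p qs A q * A (l, q)))"

lemma under_coef_solves:
  assumes "distinct qs" "gs_ok qs D (\<lambda>q l. A (l, q))" "q \<in> set qs"
  shows "(\<Sum>l\<in>D. A (l, q) * (\<Sum>q'\<in>set qs. under_coef D p qs A q' * A (l, q'))) = A (p, q)"
  using gs_coef_solves[OF assms, of "\<lambda>q. A (p, q)"]
  unfolding under_coef_def inner_on_def lincomb_def .

text \<open>Multiplying \<open>A\<close> from the right by a reflection \<open>H\<close> on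
  \<open>Q\<close> replaces \<open>B\<close> by \<open>B H\<close> and \<open>g\<close> by
  \<open>H g\<close>, so the solution \<open>c\<close> of the normal equations becomes
  \<open>H c\<close>. Primal and dual vectors depend on the columns \<open>Q\<close> only, and the
  dual is nonzero because its entry at \<open>p\<close> is \<open>1\<close>.\<close>

lemma under_certificate_ge:
  fixes N :: "'b set" and v :: "'j \<Rightarrow> 'b \<Rightarrow> real"
  assumes fin: "finite D" "finite N" "finite J" and p: "p \<notin> D"
    and qs: "distinct qs" "set qs \<subseteq> N" "qs \<noteq> []" "length qs \<le> card D"
    and C: "C \<in> sets (PiM (N - set qs) (\<lambda>_. borel))"
    and cone: "\<And>c x. c > 0 \<Longrightarrow> x \<in> extensional (N - set qs) \<Longrightarrow> (\<lambda>i\<in>N - set qs. c * x i) \<in> C \<longleftrightarrow> x \<in> C"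
  defines "Q \<equiv> set qs" and "R \<equiv> N - set qs" and "M \<equiv> insert p D"
  shows "emeasure (gauss N) {g \<in> space (gauss N). (\<forall>j\<in>J. inner_on Q (v j) g > 0) \<and> restrict g R \<in> C}
    \<le> emeasure (gauss (M \<times> N)) {A \<in> space (gauss (M \<times> N)). (\<forall>j\<in>J. inner_on Q (v j) (under_coef D p qs A) > 0) \<and>
           (\<lambda>i\<in>R. inner_on M (under_dual D p qs A) (\<lambda>l. A (l, i))) \<in> C}"
    and "{A \<in> space (gauss (M \<times> N)). (\<forall>j\<in>J. inner_on Q (v j) (under_coef D p qs A) > 0) \<and>
           (\<lambda>i\<in>R. inner_on M (under_dual D p qs A) (\<lambda>l. A (l, i))) \<in> C} \<in> sets (gauss (M \<times> N))"
    and "AE A in gauss (M \<times> N). gs_ok qs D (\<lambda>q l. A (l, q))"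
proof -
  have finM: "finite M" using fin by (simp add: M_def)
  have DM: "D \<subseteq> M" "p \<in> M" by (auto simp: M_def)
  have QN: "Q \<subseteq> N" "Q \<noteq> {}" "R \<subseteq> N" "Q \<inter> R = {}" "Q \<union> R = N" "finite Q" using qs by (auto simp: Q_def R_def)
  let ?P = "PiM (M \<times> N) (\<lambda>_. borel :: real measure)"
  have mA: "(\<lambda>A. A (l, i)) \<in> borel_measurable ?P" if "l \<in> M" "i \<in> N" for l i
    using that by simp
  have mX: "(\<lambda>A. under_coef D p qs A q) \<in> borel_measurable ?P" if "q \<in> Q" for q
    unfolding under_coef_def using that QN DM by (intro measurable_gs_coef mA) (auto simp: Q_def)
  have mY: "(\<lambda>A. under_dual D p qs A l) \<in> borel_measurable ?P" if "l \<in> M" for l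
  proof (cases "l = p")
    case False
    have "(\<lambda>A. - (\<Sum>q\<in>set qs. under_coef D p qs A q * A (l, q))) \<in> borel_measurable ?P"
      using that QN by (intro borel_measurable_uminus borel_measurable_sum borel_measurable_times mX mA) (auto simp: Q_def)
    then show ?thesis using False by (simp add: under_dual_def)
  qed (simp add: under_dual_def)
  have depX: "under_coef D p qs A q = under_coef D p qs A' q"
    if "\<And>l i. l \<in> M \<Longrightarrow> i \<in> N - R \<Longrightarrow> A (l, i) = A' (l, i)" "q \<in> Q" for A A' q
    unfolding under_coef_def using that(2) QN DM by (intro gs_coef_cong that(1)) (auto simp: Q_def R_def)
  have depY: "under_dual D p qs A l = under_dual D p qs A' l"
    if dep: "\<And>l i. l \<in> M \<Longrightarrow> i \<in> N - R \<Longrightarrow> A (l, i) = A' (l, i)" and lM: "l \<in> M" for A A' l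
  proof -
    have "under_coef D p qs A q * A (l, q) = under_coef D p qs A' q * A' (l, q)" if q: "q \<in> set qs" for q
    proof -
      have "under_coef D p qs A q = under_coef D p qs A' q"
        by (rule depX) (use dep q in \<open>auto simp: Q_def\<close>)
      moreover have "A (l, q) = A' (l, q)" using q QN(1) by (intro dep) (auto simp: R_def Q_def lM)
      ultimately show ?thesis by simp
    qed
    then show ?thesis unfolding under_dual_def by simp
  qed
  show ok: "AE A in gauss (M \<times> N). gs_ok qs D (\<lambda>q l. A (l, q))"
    using fin finM qs DM by (intro AE_gs_ok[where f="\<lambda>q l. (l, q)"]) (auto simp: inj_on_def)
  have nzX: "AE A in gauss (M \<times> N). \<not> (\<forall>q\<in>Q. under_coef D p qs A q = 0)"
  proof -
    obtain q where q: "q \<in> Q" using QN by auto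
    have "AE A in gauss (M \<times> N). A (p, q) \<noteq> 0"
      unfolding gauss_def using q QN DM by (intro AE_PiM_component[OF prob_space_stdn] AE_stdn_neq) auto
    with ok show ?thesis
    proof eventually_elim
      case (elim A)
      show ?case
      proof
        assume "\<forall>q\<in>Q. under_coef D p qs A q = 0"
        then show False using under_coef_solves[OF qs(1) elim(1), of q p] q elim(2) by (simp add: Q_def)
      qed
    qed
  qed
  have nzY: "AE A in gauss (M \<times> N). \<not> (\<forall>l\<in>M. under_dual D p qs A l = 0)"
    using DM by (intro AE_I2) (auto simp: under_dual_def intro!: bexI[of _ p])
  have equi: "AE A in gauss (M \<times> N). \<forall>q\<in>Q. under_coef D p qs (row_refl M N u A) q = refl_on_set Q u (under_coef D p qs A) q"
    if u: "\<And>i. i \<notin> Q \<Longrightarrow> u i = 0" for u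
    using ok AE_gauss_row_refl[OF finM fin(2) ok, of u]
  proof eventually_elim
    case (elim A)
    define A' where "A' = row_refl M N u A"
    define c where "c = under_coef D p qs A"
    have A': "A' (l, q) = refl_on_set Q u (\<lambda>j. A (l, j)) q" if "l \<in> M" "q \<in> Q" for l q
      using row_refl_support[OF QN(1) fin(2) u that(1), where i=q and A=A] that QN by (auto simp: A'_def)
    have lc: "lincomb (set qs) (refl_on_set Q u c) (\<lambda>q l. A' (l, q)) l = inner_on Q c (\<lambda>j. A (l, j))" if "l \<in> D" for l
    proof -
      have "lincomb (set qs) (refl_on_set Q u c) (\<lambda>q l. A' (l, q)) l = inner_on Q (refl_on_set Q u c) (refl_on_set Q u (\<lambda>j. A (l, j)))"
        unfolding lincomb_def inner_on_def Q_def[symmetric] using A' that DM by (intro sum.cong) auto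
      then show ?thesis by (simp add: inner_on_refl_refl[OF QN(6)])
    qed
    have "refl_on_set Q u c q = gs_coef qs D (\<lambda>q l. A' (l, q)) (\<lambda>q. A' (p, q)) q" if "q \<in> Q" for q
    proof (rule gs_coef_unique[OF fin(1) qs(1)])
      show "gs_ok qs D (\<lambda>q l. A' (l, q))" using elim(2) by (simp add: A'_def)
      show "q \<in> set qs" using that by (simp add: Q_def)
      fix q assume "q \<in> set qs"
      then have q: "q \<in> Q" by (simp add: Q_def)
      have "inner_on D (\<lambda>l. A' (l, q)) (lincomb (set qs) (refl_on_set Q u c) (\<lambda>q l. A' (l, q)))
         = (\<Sum>l\<in>D. inner_on Q c (\<lambda>j. A (l, j)) * refl_on_set Q u (\<lambda>j. A (l, j)) q)"
        unfolding inner_on_def[of D] using lc A' q DM by (intro sum.cong refl) (auto simp: mult.commute)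
      also have "\<dots> = refl_on_set Q u (\<lambda>i. \<Sum>l\<in>D. inner_on Q c (\<lambda>j. A (l, j)) * A (l, i)) q"
        by (rule refl_on_set_lincomb[OF q, symmetric])
      also have "\<dots> = refl_on_set Q u (\<lambda>j. A (p, j)) q"
      proof -
        have "(\<Sum>l\<in>D. inner_on Q c (\<lambda>j. A (l, j)) * A (l, i)) = A (p, i)" if "i \<in> Q" for i
          using under_coef_solves[OF qs(1) elim(1), of i p] that
          unfolding Q_def c_def inner_on_def by (simp add: mult.commute)
        then show ?thesis unfolding refl_on_set_def using q by (simp add: inner_on_def)
      qed
      also have "\<dots> = A' (p, q)" using A' DM q by simp
      finally show "inner_on D (\<lambda>l. A' (l, q)) (lincomb (set qs) (refl_on_set Q u c) (\<lambda>q l. A' (l, q))) = A' (p, q)" .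
    qed
    then show ?case unfolding A'_def c_def under_coef_def[of D p qs "row_refl M N u A"] by simp
  qed
  note E = emeasure_certificate_ge[OF finM fin(2,3) QN(1-4) mX mY depX depY equi nzX nzY C[folded R_def] cone[folded R_def], of v]
  show "emeasure (gauss N) {g \<in> space (gauss N). (\<forall>j\<in>J. inner_on Q (v j) g > 0) \<and> restrict g R \<in> C}
    \<le> emeasure (gauss (M \<times> N)) {A \<in> space (gauss (M \<times> N)). (\<forall>j\<in>J. inner_on Q (v j) (under_coef D p qs A) > 0) \<and>
           (\<lambda>i\<in>R. inner_on M (under_dual D p qs A) (\<lambda>l. A (l, i))) \<in> C}"
    using E(1) unfolding QN(5) by blast
  show "{A \<in> space (gauss (M \<times> N)). (\<forall>j\<in>J. inner_on Q (v j) (under_coef D p qs A) > 0) \<and>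
           (\<lambda>i\<in>R. inner_on M (under_dual D p qs A) (\<lambda>l. A (l, i))) \<in> C} \<in> sets (gauss (M \<times> N))"
    using E(2) by blast
qed

text \<open>With at least as many columns \<open>Q\<close> as rows, \<open>over_vec\<close> is the solution of least norm, supported on \<open>Q\<close>,
  of the linear system whose right-hand side is the column \<open>s\<close>.\<close>
definition over_dual :: "'a list \<Rightarrow> 'b set \<Rightarrow> 'b \<Rightarrow> ('a \<times> 'b \<Rightarrow> real) \<Rightarrow> 'a \<Rightarrow> real" where
  "over_dual ls Q s A = gs_coef ls Q (\<lambda>l q. A (l, q)) (\<lambda>l. A (l, s))"

definition over_vec :: "'a list \<Rightarrow> 'b set \<Rightarrow> 'b \<Rightarrow> ('a \<times> 'b \<Rightarrow> real) \<Rightarrow> 'b \<Rightarrow> real" where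
  "over_vec ls Q s A q = (\<Sum>l\<in>set ls. over_dual ls Q s A l * A (l, q))"

lemma over_vec_solves:
  assumes "distinct ls" "gs_ok ls Q (\<lambda>l q. A (l, q))" "l \<in> set ls"
  shows "inner_on Q (\<lambda>q. A (l, q)) (over_vec ls Q s A) = A (l, s)"
  using gs_coef_solves[OF assms, of "\<lambda>l. A (l, s)"]
  unfolding over_dual_def over_vec_def[abs_def] lincomb_def .

text \<open>A reflection \<open>H\<close> on \<open>Q\<close> replaces the block \<open>B\<close> by
  \<open>B H\<close>; it changes neither the Gram matrix of its rows nor the column
  \<open>s\<close>, which lies outside \<open>Q\<close>. So \<open>over_dual\<close> is invariant,
  and \<open>over_vec\<close>, a combination of the rows of \<open>B\<close>, is multiplied by
  \<open>H\<close>.\<close>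

lemma over_certificate_ge:
  fixes N :: "'b set" and v :: "'j \<Rightarrow> 'b \<Rightarrow> real"
  assumes fin: "finite T" "finite J" and s: "s \<notin> T"
    and ls: "distinct ls" "ls \<noteq> []" "length ls \<le> card Q" and Q: "Q \<subseteq> T"
    and C: "C \<in> sets (PiM (T - Q) (\<lambda>_. borel))"
    and cone: "\<And>c x. c > 0 \<Longrightarrow> x \<in> extensional (T - Q) \<Longrightarrow> (\<lambda>i\<in>T - Q. c * x i) \<in> C \<longleftrightarrow> x \<in> C"
  defines "R \<equiv> T - Q" and "M \<equiv> set ls" and "N \<equiv> insert s T"
  shows "emeasure (gauss T) {g \<in> space (gauss T). (\<forall>j\<in>J. inner_on Q (v j) g > 0) \<and> restrict g R \<in> C}
    \<le> emeasure (gauss (M \<times> N)) {A \<in> space (gauss (M \<times> N)). (\<forall>j\<in>J. inner_on Q (v j) (over_vec ls Q s A) > 0) \<and>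
           (\<lambda>i\<in>R. inner_on M (over_dual ls Q s A) (\<lambda>l. A (l, i))) \<in> C}"
    and "{A \<in> space (gauss (M \<times> N)). (\<forall>j\<in>J. inner_on Q (v j) (over_vec ls Q s A) > 0) \<and>
           (\<lambda>i\<in>R. inner_on M (over_dual ls Q s A) (\<lambda>l. A (l, i))) \<in> C} \<in> sets (gauss (M \<times> N))"
    and "AE A in gauss (M \<times> N). gs_ok ls Q (\<lambda>l q. A (l, q))"
proof -
  have finM: "finite M" "finite N" using fin by (auto simp: M_def N_def)
  have QN: "Q \<subseteq> N" "Q \<noteq> {}" "R \<subseteq> N" "Q \<inter> R = {}" "Q \<union> R = T" "finite Q" "s \<in> N" "s \<notin> R" "s \<notin> Q"
    using Q ls s fin by (auto simp: R_def N_def intro: finite_subset)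
  let ?P = "PiM (M \<times> N) (\<lambda>_. borel :: real measure)"
  have mA: "(\<lambda>A. A (l, i)) \<in> borel_measurable ?P" if "l \<in> M" "i \<in> N" for l i
    using that by simp
  have mY: "(\<lambda>A. over_dual ls Q s A l) \<in> borel_measurable ?P" if "l \<in> M" for l
    unfolding over_dual_def using that QN by (intro measurable_gs_coef mA) (auto simp: M_def)
  have mX: "(\<lambda>A. over_vec ls Q s A q) \<in> borel_measurable ?P" if "q \<in> Q" for q
    unfolding over_vec_def using that QN by (intro borel_measurable_sum borel_measurable_times mY mA) (auto simp: M_def)
  have depY: "over_dual ls Q s A l = over_dual ls Q s A' l"
    if "\<And>l i. l \<in> M \<Longrightarrow> i \<in> N - R \<Longrightarrow> A (l, i) = A' (l, i)" "l \<in> M" for A A' l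
    unfolding over_dual_def using that(2) QN by (intro gs_coef_cong that(1)) (auto simp: M_def)
  have depX: "over_vec ls Q s A q = over_vec ls Q s A' q"
    if "\<And>l i. l \<in> M \<Longrightarrow> i \<in> N - R \<Longrightarrow> A (l, i) = A' (l, i)" "q \<in> Q" for A A' q
    unfolding over_vec_def
  proof (intro sum.cong refl)
    fix l assume "l \<in> set ls"
    then have "l \<in> M" by (simp add: M_def)
    then have "over_dual ls Q s A l = over_dual ls Q s A' l"
      by (intro depY that(1))
    moreover have "A (l, q) = A' (l, q)" using that(2) QN \<open>l \<in> M\<close> by (intro that(1)) auto
    ultimately show "over_dual ls Q s A l * A (l, q) = over_dual ls Q s A' l * A' (l, q)" by simp
  qed
  show ok: "AE A in gauss (M \<times> N). gs_ok ls Q (\<lambda>l q. A (l, q))"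
    using fin finM ls QN by (intro AE_gs_ok[where f="\<lambda>l q. (l, q)"]) (auto simp: inj_on_def M_def)
  have nzX: "AE A in gauss (M \<times> N). \<not> (\<forall>q\<in>Q. over_vec ls Q s A q = 0)"
  proof -
    obtain l where l: "l \<in> M" using ls by (cases ls) (auto simp: M_def)
    have "AE A in gauss (M \<times> N). A (l, s) \<noteq> 0"
      unfolding gauss_def using l QN by (intro AE_PiM_component[OF prob_space_stdn] AE_stdn_neq) auto
    with ok show ?thesis
    proof eventually_elim
      case (elim A)
      show ?case
      proof
        assume "\<forall>q\<in>Q. over_vec ls Q s A q = 0"
        then have "inner_on Q (\<lambda>q. A (l, q)) (over_vec ls Q s A) = 0" by (simp add: inner_on_def)
        then show False using over_vec_solves[OF ls(1) elim(1), of l s] l elim(2) by (simp add: M_def)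
      qed
    qed
  qed
  have nzY: "AE A in gauss (M \<times> N). \<not> (\<forall>l\<in>M. over_dual ls Q s A l = 0)"
    using nzX
  proof eventually_elim
    case (elim A)
    show ?case
    proof
      assume "\<forall>l\<in>M. over_dual ls Q s A l = 0"
      then have "over_vec ls Q s A q = 0" for q by (simp add: over_vec_def M_def)
      then show False using elim by simp
    qed
  qed
  have equi: "AE A in gauss (M \<times> N). \<forall>q\<in>Q. over_vec ls Q s (row_refl M N u A) q = refl_on_set Q u (over_vec ls Q s A) q"
    if u: "\<And>i. i \<notin> Q \<Longrightarrow> u i = 0" for u
    using ok AE_gauss_row_refl[OF finM ok, of u]
  proof eventually_elim
    case (elim A)
    define A' where "A' = row_refl M N u A"
    define y where "y = over_dual ls Q s A"
    have A': "A' (l, q) = refl_on_set Q u (\<lambda>j. A (l, j)) q" if "l \<in> M" "q \<in> Q" for l q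
      using row_refl_support[OF QN(1) finM(2) u that(1), where i=q and A=A] that QN by (auto simp: A'_def)
    have A's: "A' (l, s) = A (l, s)" if "l \<in> M" for l
      using row_refl_support[OF QN(1) finM(2) u that(1), where i=s and A=A] QN by (auto simp: A'_def)
    have lc: "lincomb (set ls) y (\<lambda>l q. A' (l, q)) q = refl_on_set Q u (over_vec ls Q s A) q" if "q \<in> Q" for q
      unfolding lincomb_def over_vec_def[abs_def] refl_on_set_lincomb[OF that] y_def using A' that
      by (intro sum.cong) (auto simp: M_def)
    have y': "y l = over_dual ls Q s A' l" if "l \<in> M" for l
      unfolding over_dual_def[of ls Q s A']
    proof (rule gs_coef_unique[OF QN(6) ls(1)])
      show "gs_ok ls Q (\<lambda>l q. A' (l, q))" using elim(2) by (simp add: A'_def)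
      show "l \<in> set ls" using that by (simp add: M_def)
      fix l assume l: "l \<in> set ls"
      have "inner_on Q (\<lambda>q. A' (l, q)) (lincomb (set ls) y (\<lambda>l q. A' (l, q)))
         = inner_on Q (refl_on_set Q u (\<lambda>j. A (l, j))) (refl_on_set Q u (over_vec ls Q s A))"
        using lc A' l by (intro inner_on_cong) (auto simp: M_def)
      also have "\<dots> = A (l, s)" using over_vec_solves[OF ls(1) elim(1) l] by (simp add: inner_on_refl_refl[OF QN(6)])
      finally show "inner_on Q (\<lambda>q. A' (l, q)) (lincomb (set ls) y (\<lambda>l q. A' (l, q))) = A' (l, s)"
        using A's l by (simp add: M_def)
    qed
    have "over_vec ls Q s A' q = lincomb (set ls) y (\<lambda>l q. A' (l, q)) q" for q
      unfolding over_vec_def lincomb_def using y' by (simp add: M_def)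
    then show ?case using lc by (simp add: A'_def)
  qed
  note E = emeasure_certificate_ge[OF finM fin(2) QN(1-4) mX mY depX depY equi nzX nzY C[folded R_def] cone[folded R_def], of v]
  show "emeasure (gauss T) {g \<in> space (gauss T). (\<forall>j\<in>J. inner_on Q (v j) g > 0) \<and> restrict g R \<in> C}
    \<le> emeasure (gauss (M \<times> N)) {A \<in> space (gauss (M \<times> N)). (\<forall>j\<in>J. inner_on Q (v j) (over_vec ls Q s A) > 0) \<and>
           (\<lambda>i\<in>R. inner_on M (over_dual ls Q s A) (\<lambda>l. A (l, i))) \<in> C}"
    using E(1) unfolding QN(5) by blast
  show "{A \<in> space (gauss (M \<times> N)). (\<forall>j\<in>J. inner_on Q (v j) (over_vec ls Q s A) > 0) \<and>
           (\<lambda>i\<in>R. inner_on M (over_dual ls Q s A) (\<lambda>l. A (l, i))) \<in> C} \<in> sets (gauss (M \<times> N))"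
    using E(2) by blast
qed

section \<open>Faces of the cone and their certificates\<close>

text \<open>The reflection along \<open>axis_vec K i0\<close> exchanges the unit vector \<open>i0\<close> and the normalised indicator of \<open>K\<close>,
  and so turns the zero-sum vectors on \<open>K\<close> into the coordinate subspace \<open>K - {i0}\<close>.\<close>
definition axis_vec :: "'b set \<Rightarrow> 'b \<Rightarrow> 'b \<Rightarrow> real" where
  "axis_vec K i0 = (\<lambda>i. (if i \<in> K then 1 / sqrt (card K) else 0) - (if i = i0 then 1 else 0))"

definition delta :: "'b \<Rightarrow> 'b \<Rightarrow> real" where
  "delta j = (\<lambda>i. if i = j then 1 else 0)"

locale axis_refl =
  fixes T K :: "'b set" and i0 :: 'b
  assumes finT: "finite T" and KT: "K \<subseteq> T" and i0: "i0 \<in> K"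
begin

abbreviation "u \<equiv> axis_vec K i0"
abbreviation "H \<equiv> refl_on_set T u"
abbreviation "Q \<equiv> K - {i0}"

definition "\<kappa> = sqrt (card K)"

lemma finK: "finite K" using finT KT by (rule finite_subset[rotated])

lemma kpos: "0 < \<kappa>" using i0 finK by (auto simp: \<kappa>_def card_gt_0_iff)

definition "unif = (\<lambda>i. if i \<in> K then 1 / \<kappa> else 0)"

lemma u_eq: "u = (\<lambda>i. unif i - delta i0 i)"
  by (auto simp: axis_vec_def unif_def delta_def \<kappa>_def)

lemma inner_delta: "j \<in> T \<Longrightarrow> inner_on T (delta j) x = x j"
  unfolding delta_def using finT by (rule inner_on_delta)

lemma inner_unif: "inner_on T unif x = (\<Sum>i\<in>K. x i) / \<kappa>"
proof -
  have "inner_on T unif x = inner_on K unif x"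
    using KT finT by (intro inner_on_support) (auto simp: unif_def)
  then show ?thesis by (simp add: inner_on_def unif_def sum_divide_distrib)
qed

lemma inner_unif_ev: "inner_on T unif unif = inner_on T (delta i0) (delta i0)"
proof -
  have "(\<Sum>i\<in>K. unif i) = card K / \<kappa>" by (simp add: unif_def)
  moreover have "\<kappa> * \<kappa> = card K" by (simp add: \<kappa>_def)
  ultimately have "inner_on T unif unif = (\<kappa> * \<kappa>) / \<kappa> / \<kappa>" by (simp add: inner_unif)
  then have "inner_on T unif unif = 1" using kpos by simp
  then show ?thesis using i0 KT by (subst inner_delta) (auto simp: delta_def)
qed

lemma H_unif: "i \<in> T \<Longrightarrow> H unif i = delta i0 i"
  unfolding u_eq by (rule refl_on_set_swap[OF finT inner_unif_ev])

lemma H_inner: "inner_on T x (H y) = inner_on T (H x) y"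
  by (rule inner_on_refl_adjoint)

lemma H_isometry: "inner_on T (H x) (H y) = inner_on T x y"
  by (rule inner_on_refl_refl[OF finT])

lemma H_apply: "j \<in> T \<Longrightarrow> H x j = inner_on T (H (delta j)) x"
  by (simp add: inner_delta[symmetric] H_inner)

lemma H_involution: "j \<in> T \<Longrightarrow> H (H x) j = x j"
  by (subst inner_delta[symmetric], simp, subst H_inner, subst H_isometry, rule inner_delta)

lemma H_off: "i \<in> T - K \<Longrightarrow> H x i = x i"
  using i0 by (auto simp: refl_on_set_def axis_vec_def)

lemma sum_H: "(\<Sum>i\<in>K. H x i) = \<kappa> * x i0"
proof -
  have "inner_on T unif (H x) = inner_on T (delta i0) x"
    unfolding H_inner by (intro inner_on_cong H_unif refl)
  also have "\<dots> = x i0" using i0 KT by (intro inner_delta) auto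
  finally show ?thesis unfolding inner_unif using kpos by (simp add: field_simps)
qed

lemma H_i0: "H x i0 = (\<Sum>i\<in>K. x i) / \<kappa>"
proof -
  have "\<kappa> * H x i0 = (\<Sum>i\<in>K. H (H x) i)" by (simp add: sum_H)
  also have "\<dots> = (\<Sum>i\<in>K. x i)" using KT by (intro sum.cong refl H_involution) auto
  finally show ?thesis using kpos by (simp add: field_simps)
qed

text \<open>The \<open>i0\<close> entry of the reflected unit vector at \<open>j\<close> is
  \<open>1 / \<kappa>\<close>. An entry on \<open>K\<close> thus splits into a zero-sum part, which
  sees only \<open>Q\<close>, and the mean over \<open>K\<close>, which is carried by the coordinate
  \<open>i0\<close>.\<close>

lemma H_on: 
  assumes j: "j \<in> K"
  shows "H x j = inner_on Q (H (delta j)) x + x i0 / \<kappa>"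
proof -
  have "H x j = inner_on T (H (delta j)) x" using j KT by (intro H_apply) auto
  also have "\<dots> = inner_on K (H (delta j)) x"
    unfolding inner_on_def using finT KT j
    by (intro sum.mono_neutral_right) (auto simp: H_off delta_def[of j])
  also have "\<dots> = H (delta j) i0 * x i0 + inner_on Q (H (delta j)) x"
    unfolding inner_on_def using i0 finK by (subst sum.remove[of _ i0]) auto
  also have "H (delta j) i0 = 1 / \<kappa>"
    using j finK by (simp add: H_i0 delta_def)
  finally show ?thesis by simp
qed

lemma H_lincomb: "i \<in> T \<Longrightarrow> H (\<lambda>i. \<Sum>l\<in>L. c l * x l i) i = (\<Sum>l\<in>L. c l * H (x l) i)"
  by (rule refl_on_set_lincomb)

lemma H_cong: "(\<And>i. i \<in> T \<Longrightarrow> x i = y i) \<Longrightarrow> H x = H y"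
  unfolding refl_on_set_def by (auto simp: inner_on_def fun_eq_iff)

lemma H_diff: "i \<in> T \<Longrightarrow> H (\<lambda>i. x i - y i) i = H x i - H y i"
  unfolding refl_on_set_def by (simp add: inner_on_diff_right algebra_simps diff_divide_distrib)

lemma H_sum_zero: "i \<in> T \<Longrightarrow> (\<And>i. i \<in> T \<Longrightarrow> x i = 0) \<Longrightarrow> H x i = 0"
  unfolding refl_on_set_def by (simp add: inner_on_def)

end

section \<open>Cells of Gaussian vectors attached to the faces\<close>

definition mean_on :: "'b set \<Rightarrow> ('b \<Rightarrow> real) \<Rightarrow> real" where
  "mean_on K g = (\<Sum>i\<in>K. g i) / card K"

text \<open>The Gaussian vectors whose projection onto the cone
  \<open>{w. (\<forall>i\<in>T - S. 0 \<le> w i) \<and> sum w T \<le> 0}\<close> lies in the relative interior of the face of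
  vectors supported on \<open>S \<union> J\<close> with zero sum.\<close>
definition face_cell :: "'b set \<Rightarrow> 'b set \<Rightarrow> 'b set \<Rightarrow> ('b \<Rightarrow> real) \<Rightarrow> bool" where
  "face_cell T S J g \<longleftrightarrow> 0 < mean_on (S \<union> J) g \<and> (\<forall>j\<in>J. mean_on (S \<union> J) g < g j)
     \<and> (\<forall>i\<in>T - (S \<union> J). g i < mean_on (S \<union> J) g)"

lemma (in axis_refl) mean_H: "mean_on K (H x) = x i0 / \<kappa>"
proof -
  have "\<kappa> * \<kappa> = card K" by (simp add: \<kappa>_def)
  then have "mean_on K (H x) = (\<kappa> * x i0) / (\<kappa> * \<kappa>)" by (simp add: mean_on_def sum_H)
  then show ?thesis using kpos by simp
qed

text \<open>The conditions of \<open>face_cell\<close> on the coordinates outside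
  \<open>K - {i0}\<close>, written after the reflection, when \<open>x i0 / sqrt (card K)\<close> is
  the mean over \<open>K\<close>.\<close>

definition cell_cone :: "'b set \<Rightarrow> 'b set \<Rightarrow> 'b \<Rightarrow> ('b \<Rightarrow> real) set" where
  "cell_cone T K i0 = {x \<in> extensional (T - (K - {i0})). 0 < x i0 \<and> (\<forall>i\<in>T - K. x i < x i0 / sqrt (card K))}"

text \<open>This is the purpose of the reflection. Comparisons of entries in \<open>J\<close> with
  the mean involve only coordinates in \<open>Q\<close>, all other conditions only coordinates in
  \<open>T - Q\<close>; the cell becomes a product of two cones, the form that the certificate
  lemmas require.\<close>

lemma (in axis_refl) face_cell_H:
  assumes K: "K = S \<union> J" and J: "i0 \<notin> J"
  shows "face_cell T S J (H g) \<longleftrightarrow> (\<forall>j\<in>J. 0 < inner_on Q (H (delta j)) g) \<and> restrict g (T - Q) \<in> cell_cone T K i0"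
proof -
  have 1: "0 < g i0 / \<kappa> \<longleftrightarrow> 0 < g i0" using kpos by (simp add: zero_less_divide_iff)
  have 2: "g i0 / \<kappa> < H g j \<longleftrightarrow> 0 < inner_on Q (H (delta j)) g" if "j \<in> J" for j
    using H_on[of j g] that K by simp
  have 3: "restrict g (T - Q) \<in> cell_cone T K i0 \<longleftrightarrow> 0 < g i0 \<and> (\<forall>i\<in>T - K. g i < g i0 / \<kappa>)"
    using i0 KT by (auto simp: cell_cone_def \<kappa>_def)
  show ?thesis unfolding face_cell_def K[symmetric] mean_H 1 3 using 2 H_off by auto
qed

lemma (in axis_refl) cell_cone_measurable: "cell_cone T K i0 \<in> sets (PiM (T - Q) (\<lambda>_. borel))"
proof -
  have "i0 \<in> T - Q" using i0 KT by auto
  have "{x \<in> space (PiM (T - Q) (\<lambda>_. borel)). 0 < x i0 \<and> (\<forall>i\<in>T - K. x i < x i0 / sqrt (card K))} \<in> sets (PiM (T - Q) (\<lambda>_. borel :: real measure))"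
    using \<open>i0 \<in> T - Q\<close> finT
    by (intro predE pred_intros_logic pred_intros_finite borel_measurable_pred_less) auto
  then show ?thesis by (simp add: cell_cone_def space_PiM PiE_def)
qed

lemma (in axis_refl) cell_cone_cone:
  assumes "c > 0" "x \<in> extensional (T - Q)"
  shows "(\<lambda>i\<in>T - Q. c * x i) \<in> cell_cone T K i0 \<longleftrightarrow> x \<in> cell_cone T K i0"
proof -
  have "c * x i < c * x i0 / sqrt (card K) \<longleftrightarrow> x i < x i0 / sqrt (card K)" for i
    using assms(1) by (metis mult_less_cancel_left_pos times_divide_eq_right)
  then show ?thesis using assms i0 KT by (auto simp: cell_cone_def zero_less_mult_iff)
qed

lemma measurable_face_cell:
  assumes "finite T" "S \<subseteq> T" "J \<subseteq> T"
  shows "{g \<in> space (gauss T). face_cell T S J g} \<in> sets (gauss T)"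
proof (rule predE)
  have fJ: "finite J" using assms by (auto intro: finite_subset)
  have m: "mean_on (S \<union> J) \<in> borel_measurable (PiM T (\<lambda>_. borel))"
    unfolding mean_on_def using assms by (intro borel_measurable_divide borel_measurable_sum) auto
  show "Measurable.pred (gauss T) (face_cell T S J)"
    unfolding measurable_gauss_cong face_cell_def using m fJ assms
    by (intro pred_intros_logic pred_intros_finite borel_measurable_pred_less) auto
qed

lemma (in axis_refl) emeasure_face_cell:
  assumes K: "K = S \<union> J" and J: "i0 \<notin> J"
  shows "emeasure (gauss T) {g \<in> space (gauss T). face_cell T S J g}
    = emeasure (gauss T) {g \<in> space (gauss T). (\<forall>j\<in>J. 0 < inner_on Q (H (delta j)) g) \<and> restrict g (T - Q) \<in> cell_cone T K i0}"
proof -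
  let ?P = "PiM T (\<lambda>_. borel :: real measure)"
  have "{g \<in> space (gauss T). face_cell T S J g} \<in> sets (gauss T)"
    using finT K KT by (intro measurable_face_cell) auto
  then have c: "{g \<in> space (gauss T). face_cell T S J g} \<in> sets ?P" by (simp only: sets_gauss)
  have mr: "H \<in> measurable (gauss T) ?P" unfolding measurable_gauss_cong by (rule measurable_refl_on_set)
  have "emeasure (gauss T) {g \<in> space (gauss T). face_cell T S J g}
     = emeasure (distr (gauss T) ?P H) {g \<in> space (gauss T). face_cell T S J g}"
    by (simp add: distr_gauss_refl[OF finT])
  also have "\<dots> = emeasure (gauss T) (H -` {g \<in> space (gauss T). face_cell T S J g} \<inter> space (gauss T))"
    by (rule emeasure_distr[OF mr c])
  also have "H -` {g \<in> space (gauss T). face_cell T S J g} \<inter> space (gauss T)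
    = {g \<in> space (gauss T). (\<forall>j\<in>J. 0 < inner_on Q (H (delta j)) g) \<and> restrict g (T - Q) \<in> cell_cone T K i0}"
    using face_cell_H[OF K J] by (auto simp: space_gauss refl_on_set_def)
  finally show ?thesis .
qed

text \<open>The conditions on \<open>w\<close> are the optimality conditions for minimising
  \<open>(\<Sum>l\<in>D. (inner_on T (\<lambda>i. A (l, i)) w)\<^sup>2) / 2 - inner_on T (\<lambda>i. A (p, i)) w\<close> over the cone, with the
  minimiser in the face of \<open>S \<union> J\<close>; this is why \<open>J\<close> is unique.\<close>
definition under_cert :: "'a set \<Rightarrow> 'a \<Rightarrow> 'b set \<Rightarrow> 'b set \<Rightarrow> 'b set \<Rightarrow> ('a \<times> 'b \<Rightarrow> real) \<Rightarrow> bool" where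
  "under_cert D p T S J A \<longleftrightarrow> (\<exists>w \<tau>. 0 < \<tau> \<and> (\<forall>i\<in>T - (S \<union> J). w i = 0) \<and> (\<Sum>i\<in>T. w i) = 0 \<and> (\<forall>j\<in>J. 0 < w j) \<and>
     (\<forall>i\<in>S \<union> J. A (p, i) - (\<Sum>l\<in>D. inner_on T (\<lambda>i. A (l, i)) w * A (l, i)) = \<tau>) \<and>
     (\<forall>i\<in>T - (S \<union> J). A (p, i) - (\<Sum>l\<in>D. inner_on T (\<lambda>i. A (l, i)) w * A (l, i)) < \<tau>)) \<and>
   (\<forall>x. (\<forall>i\<in>T - (S \<union> J). x i = 0) \<and> (\<Sum>i\<in>T. x i) = 0 \<and> (\<forall>l\<in>D. inner_on T (\<lambda>i. A (l, i)) x = 0) \<longrightarrow> (\<forall>i\<in>T. x i = 0))"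

text \<open>The optimality conditions for the vector of least norm in the cone that \<open>A\<close> maps to the column \<open>s\<close>.\<close>
definition over_cert :: "'a set \<Rightarrow> 'b \<Rightarrow> 'b set \<Rightarrow> 'b set \<Rightarrow> 'b set \<Rightarrow> ('a \<times> 'b \<Rightarrow> real) \<Rightarrow> bool" where
  "over_cert M s T S J A \<longleftrightarrow> (\<exists>y w \<tau>. 0 < \<tau> \<and> (\<forall>i\<in>T - (S \<union> J). w i = 0) \<and> (\<Sum>i\<in>T. w i) = 0 \<and> (\<forall>j\<in>J. 0 < w j) \<and>
     (\<forall>i\<in>S \<union> J. (\<Sum>l\<in>M. y l * A (l, i)) = w i + \<tau>) \<and>
     (\<forall>i\<in>T - (S \<union> J). (\<Sum>l\<in>M. y l * A (l, i)) < \<tau>) \<and>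
     (\<forall>l\<in>M. inner_on T (\<lambda>i. A (l, i)) w = A (l, s)))"

text \<open>The directions from a vector supported on \<open>S\<close> that keep nonnegativity off
  \<open>S\<close> and do not increase the sum of the entries. On \<open>S\<close> the sign is free,
  as positive entries tolerate small steps of either sign.\<close>

definition cone_vec :: "'b set \<Rightarrow> 'b set \<Rightarrow> ('b \<Rightarrow> real) \<Rightarrow> bool" where
  "cone_vec T S v \<longleftrightarrow> (\<forall>i\<in>T - S. 0 \<le> v i) \<and> (\<Sum>i\<in>T. v i) \<le> 0"

text \<open>Subtracting the constant \<tau> from \<open>z\<close> splits the pairing into \<tau>
  times a nonpositive sum and a sum of nonpositive terms over the indices off
  \<open>S \<union> J\<close>. So \<open>z\<close> lies in the polar cone, and if the pairing
  vanishes then so does each part: this is complementary slackness.\<close>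

lemma inner_le_on_cone:
  fixes z w :: "'b \<Rightarrow> real"
  assumes "finite T" "cone_vec T S w" "S \<union> J \<subseteq> T"
    and z: "\<And>i. i \<in> S \<union> J \<Longrightarrow> z i = \<tau>" "\<And>i. i \<in> T - (S \<union> J) \<Longrightarrow> z i < \<tau>" and \<tau>: "0 < \<tau>"
  shows "inner_on T z w \<le> 0"
    and "inner_on T z w = 0 \<Longrightarrow> (\<Sum>i\<in>T. w i) = 0"
    and "inner_on T z w = 0 \<Longrightarrow> i \<in> T - (S \<union> J) \<Longrightarrow> w i = 0"
proof -
  let ?K = "S \<union> J"
  have "inner_on T z w = (\<Sum>i\<in>T. \<tau> * w i) - (\<Sum>i\<in>T. (\<tau> - z i) * w i)"
    by (simp add: inner_on_def sum_subtractf[symmetric] algebra_simps)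
  also have "(\<Sum>i\<in>T. (\<tau> - z i) * w i) = (\<Sum>i\<in>T - ?K. (\<tau> - z i) * w i)"
    using assms by (intro sum.mono_neutral_right) auto
  finally have eq: "inner_on T z w = \<tau> * (\<Sum>i\<in>T. w i) - (\<Sum>i\<in>T - ?K. (\<tau> - z i) * w i)"
    by (simp add: sum_distrib_left)
  have nn: "0 \<le> (\<tau> - z i) * w i" if "i \<in> T - ?K" for i
    using z(2)[OF that] assms(2) that by (auto simp: cone_vec_def intro!: mult_nonneg_nonneg)
  then have 1: "0 \<le> (\<Sum>i\<in>T - ?K. (\<tau> - z i) * w i)" by (rule sum_nonneg)
  have 2: "\<tau> * (\<Sum>i\<in>T. w i) \<le> 0" using \<tau> assms(2) by (auto simp: cone_vec_def mult_le_0_iff)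
  show "inner_on T z w \<le> 0" using eq 1 2 by simp
  assume "inner_on T z w = 0"
  then have 3: "\<tau> * (\<Sum>i\<in>T. w i) = 0" "(\<Sum>i\<in>T - ?K. (\<tau> - z i) * w i) = 0" using eq 1 2 by auto
  then show "(\<Sum>i\<in>T. w i) = 0" using \<tau> by simp
  show "i \<in> T - ?K \<Longrightarrow> w i = 0"
  proof -
    assume i: "i \<in> T - ?K"
    have "(\<tau> - z i) * w i = 0" using 3(2) nn i assms(1) by (subst (asm) sum_nonneg_eq_0_iff) auto
    then show "w i = 0" using z(2)[OF i] by simp
  qed
qed

text \<open>The negative gradient is a combination of the rows \<open>insert p D\<close>, hence
  orthogonal to every kernel vector. Complementary slackness then puts a kernel vector of the cone
  into the span of the face, on which the rows \<open>D\<close> are injective by the second clause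
  of the certificate.\<close>

lemma under_cert_trivial_kernel:
  assumes fin: "finite T" "finite D" "p \<notin> D" and SJ: "S \<union> J \<subseteq> T" and cert: "under_cert D p T S J A"
    and v: "cone_vec T S v" "\<And>l. l \<in> insert p D \<Longrightarrow> inner_on T (\<lambda>i. A (l, i)) v = 0"
  shows "\<forall>i\<in>T. v i = 0"
proof -
  obtain w \<tau> where \<tau>: "0 < \<tau>"
    and z: "\<And>i. i \<in> S \<union> J \<Longrightarrow> A (p, i) - (\<Sum>l\<in>D. inner_on T (\<lambda>i. A (l, i)) w * A (l, i)) = \<tau>"
      "\<And>i. i \<in> T - (S \<union> J) \<Longrightarrow> A (p, i) - (\<Sum>l\<in>D. inner_on T (\<lambda>i. A (l, i)) w * A (l, i)) < \<tau>"
    using cert[unfolded under_cert_def, THEN conjunct1]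
    by (elim exE conjE) (rule that; (assumption | erule (1) bspec))
  have inj: "\<And>x. (\<forall>i\<in>T - (S \<union> J). x i = 0) \<Longrightarrow> (\<Sum>i\<in>T. x i) = 0 \<Longrightarrow> (\<forall>l\<in>D. inner_on T (\<lambda>i. A (l, i)) x = 0) \<Longrightarrow> \<forall>i\<in>T. x i = 0"
    using cert[unfolded under_cert_def, THEN conjunct2] by blast
  define zf where "zf = (\<lambda>i. A (p, i) - (\<Sum>l\<in>D. inner_on T (\<lambda>i. A (l, i)) w * A (l, i)))"
  have "inner_on T v zf = inner_on T v (\<lambda>i. A (p, i)) - (\<Sum>l\<in>D. inner_on T (\<lambda>i. A (l, i)) w * inner_on T v (\<lambda>i. A (l, i)))"
    unfolding zf_def by (simp only: inner_on_diff_right inner_on_sum_right inner_on_scale_right)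
  also have "\<dots> = 0" using v(2) by (simp add: inner_on_commute[of T v])
  finally have "inner_on T zf v = 0" by (simp add: inner_on_commute)
  have zf: "\<And>i. i \<in> S \<union> J \<Longrightarrow> zf i = \<tau>" "\<And>i. i \<in> T - (S \<union> J) \<Longrightarrow> zf i < \<tau>"
    using z unfolding zf_def by blast+
  from inner_le_on_cone(2,3)[OF fin(1) v(1) SJ zf \<tau> \<open>inner_on T zf v = 0\<close>]
  show ?thesis using v(2) by (intro inj) auto
qed

text \<open>Monotonicity of the gradient: pairing the difference of the two negative gradients with
  \<open>w - w'\<close> gives minus a sum of squares, while the optimality conditions make the same
  number nonnegative. So the mixed pairings vanish, and complementary slackness places each
  minimiser in the face of the other.\<close>

lemma under_cert_unique:
  assumes fin: "finite T" and J: "J \<subseteq> T - S" "J' \<subseteq> T - S" "S \<subseteq> T"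
    and cert: "under_cert D p T S J A" "under_cert D p T S J' A"
  shows "J = J'"
proof -
  define zf where "zf w i = A (p, i) - (\<Sum>l\<in>D. inner_on T (\<lambda>i. A (l, i)) w * A (l, i))" for w i
  obtain w \<tau> where w: "0 < \<tau>" "\<And>i. i \<in> T - (S \<union> J) \<Longrightarrow> w i = 0" "(\<Sum>i\<in>T. w i) = 0" "\<And>j. j \<in> J \<Longrightarrow> 0 < w j"
    "\<And>i. i \<in> S \<union> J \<Longrightarrow> zf w i = \<tau>" "\<And>i. i \<in> T - (S \<union> J) \<Longrightarrow> zf w i < \<tau>"
    using cert(1)[unfolded under_cert_def, THEN conjunct1, folded zf_def]
    by (elim exE conjE) (rule that; (assumption | erule (1) bspec))
  obtain w' \<tau>' where w': "0 < \<tau>'" "\<And>i. i \<in> T - (S \<union> J') \<Longrightarrow> w' i = 0" "(\<Sum>i\<in>T. w' i) = 0" "\<And>j. j \<in> J' \<Longrightarrow> 0 < w' j"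
    "\<And>i. i \<in> S \<union> J' \<Longrightarrow> zf w' i = \<tau>'" "\<And>i. i \<in> T - (S \<union> J') \<Longrightarrow> zf w' i < \<tau>'"
    using cert(2)[unfolded under_cert_def, THEN conjunct1, folded zf_def]
    by (elim exE conjE) (rule that; (assumption | erule (1) bspec))
  have K: "S \<union> J \<subseteq> T" "S \<union> J' \<subseteq> T" using J by auto
  have cw: "cone_vec T S w" unfolding cone_vec_def
  proof
    show "\<forall>i\<in>T - S. 0 \<le> w i"
    proof
      fix i assume "i \<in> T - S"
      then show "0 \<le> w i" using w(2)[of i] w(4)[of i] by (cases "i \<in> J") auto
    qed
  qed (simp add: w(3))
  have cw': "cone_vec T S w'" unfolding cone_vec_def
  proof
    show "\<forall>i\<in>T - S. 0 \<le> w' i"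
    proof
      fix i assume "i \<in> T - S"
      then show "0 \<le> w' i" using w'(2)[of i] w'(4)[of i] by (cases "i \<in> J'") auto
    qed
  qed (simp add: w'(3))
  have zw: "inner_on T (zf w) w = 0"
  proof -
    have "inner_on T (zf w) w = (\<Sum>i\<in>T. \<tau> * w i)" unfolding inner_on_def
    proof (intro sum.cong refl)
      fix i assume "i \<in> T"
      then show "zf w i * w i = \<tau> * w i" using w(2)[of i] w(5)[of i] by (cases "i \<in> S \<union> J") auto
    qed
    then show ?thesis using w(3) by (simp add: sum_distrib_left[symmetric])
  qed
  have zw': "inner_on T (zf w') w' = 0"
  proof -
    have "inner_on T (zf w') w' = (\<Sum>i\<in>T. \<tau>' * w' i)" unfolding inner_on_def
    proof (intro sum.cong refl)
      fix i assume "i \<in> T"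
      then show "zf w' i * w' i = \<tau>' * w' i" using w'(2)[of i] w'(5)[of i] by (cases "i \<in> S \<union> J'") auto
    qed
    then show ?thesis using w'(3) by (simp add: sum_distrib_left[symmetric])
  qed
  have le: "inner_on T (zf w) w' \<le> 0" by (rule inner_le_on_cone(1)[OF fin cw' K(1) w(5,6,1)])
  have le': "inner_on T (zf w') w \<le> 0" by (rule inner_le_on_cone(1)[OF fin cw K(2) w'(5,6,1)])
  have expand: "inner_on T x (zf w) = inner_on T x (\<lambda>i. A (p, i)) - (\<Sum>l\<in>D. inner_on T (\<lambda>i. A (l, i)) w * inner_on T x (\<lambda>i. A (l, i)))" for x w
    unfolding zf_def[abs_def] by (simp only: inner_on_diff_right inner_on_sum_right inner_on_scale_right)
  have "inner_on T (zf w) w + inner_on T (zf w') w' - inner_on T (zf w) w' - inner_on T (zf w') w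
    = - (\<Sum>l\<in>D. (inner_on T (\<lambda>i. A (l, i)) w - inner_on T (\<lambda>i. A (l, i)) w')\<^sup>2)"
    unfolding inner_on_commute[of T "zf _"] expand
    unfolding inner_on_commute[of T w] inner_on_commute[of T w']
    by (simp add: sum_subtractf sum.distrib power2_eq_square algebra_simps sum_distrib_left)
  also have "\<dots> \<le> 0" by (simp add: sum_nonneg)
  finally have z: "inner_on T (zf w) w' = 0" "inner_on T (zf w') w = 0" using zw zw' le le' by auto
  have "w' i = 0" if "i \<in> T - (S \<union> J)" for i
    by (rule inner_le_on_cone(3)[OF fin cw' K(1) w(5,6,1) z(1) that])
  then have "J' \<subseteq> J" using w'(4) J by force
  moreover have "w i = 0" if "i \<in> T - (S \<union> J')" for i
    by (rule inner_le_on_cone(3)[OF fin cw K(2) w'(5,6,1) z(2) that])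
  then have "J \<subseteq> J'" using w(4) J by force
  ultimately show ?thesis by auto
qed

text \<open>A cone vector \<open>w\<close> mapped to the column \<open>s\<close> becomes a kernel
  vector once \<open>- 1\<close> is put at \<open>s\<close>. The sum only decreases, and the
  negative entry is admissible because \<open>s\<close> is added to the indices of free
  sign.\<close>

lemma over_cert_nontrivial_kernel:
  assumes fin: "finite T" "s \<notin> T" and J: "S \<union> J \<subseteq> T" and cert: "over_cert M s T S J A"
  shows "\<exists>v. cone_vec (insert s T) (insert s S) v \<and> v s \<noteq> 0 \<and> (\<forall>l\<in>M. inner_on (insert s T) (\<lambda>i. A (l, i)) v = 0)"
proof -
  obtain w where w: "\<And>i. i \<in> T - (S \<union> J) \<Longrightarrow> w i = 0" "(\<Sum>i\<in>T. w i) = 0" "\<And>j. j \<in> J \<Longrightarrow> 0 < w j"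
    "\<And>l. l \<in> M \<Longrightarrow> inner_on T (\<lambda>i. A (l, i)) w = A (l, s)"
    using cert unfolding over_cert_def by blast
  define v where "v = w(s := - 1)"
  have vT: "v i = w i" if "i \<in> T" for i using that fin by (auto simp: v_def)
  have "(\<Sum>i\<in>insert s T. v i) = - 1" using fin w(2) vT by (simp add: v_def)
  moreover have "0 \<le> v i" if "i \<in> insert s T - insert s S" for i
    using that w(1)[of i] w(3)[of i] vT[of i] by force
  moreover have "inner_on (insert s T) (\<lambda>i. A (l, i)) v = 0" if "l \<in> M" for l
  proof -
    have "inner_on (insert s T) (\<lambda>i. A (l, i)) v = - A (l, s) + inner_on T (\<lambda>i. A (l, i)) w"
      using fin vT by (simp add: inner_on_def v_def)
    then show ?thesis using w(4)[OF that] by simp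
  qed
  ultimately show ?thesis by (intro exI[of _ v]) (auto simp: cone_vec_def v_def)
qed

text \<open>Both vectors have the same image, so their difference is orthogonal to every combination
  of the rows. The two optimality conditions therefore add up to \<open>inner_on T (\<lambda>i. w i
  - w' i) (\<lambda>i. w i - w' i) \<le> 0\<close>, as for projections onto a convex set, and
  \<open>J\<close> is recovered from the support.\<close>

lemma over_cert_unique:
  assumes fin: "finite T" and J: "J \<subseteq> T - S" "J' \<subseteq> T - S" "S \<subseteq> T"
    and cert: "over_cert M s T S J A" "over_cert M s T S J' A"
  shows "J = J'"
proof -
  define zf where "zf y i = (\<Sum>l\<in>M. y l * A (l, i))" for y i
  obtain y w \<tau> where w: "0 < \<tau>" "\<And>i. i \<in> T - (S \<union> J) \<Longrightarrow> w i = 0" "(\<Sum>i\<in>T. w i) = 0" "\<And>j. j \<in> J \<Longrightarrow> 0 < w j"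
    "\<And>i. i \<in> S \<union> J \<Longrightarrow> zf y i = w i + \<tau>" "\<And>i. i \<in> T - (S \<union> J) \<Longrightarrow> zf y i < \<tau>"
    "\<And>l. l \<in> M \<Longrightarrow> inner_on T (\<lambda>i. A (l, i)) w = A (l, s)"
    using cert(1)[unfolded over_cert_def, folded zf_def]
    by (elim exE conjE) (rule that; (assumption | erule (1) bspec))
  obtain y' w' \<tau>' where w': "0 < \<tau>'" "\<And>i. i \<in> T - (S \<union> J') \<Longrightarrow> w' i = 0" "(\<Sum>i\<in>T. w' i) = 0" "\<And>j. j \<in> J' \<Longrightarrow> 0 < w' j"
    "\<And>i. i \<in> S \<union> J' \<Longrightarrow> zf y' i = w' i + \<tau>'" "\<And>i. i \<in> T - (S \<union> J') \<Longrightarrow> zf y' i < \<tau>'"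
    "\<And>l. l \<in> M \<Longrightarrow> inner_on T (\<lambda>i. A (l, i)) w' = A (l, s)"
    using cert(2)[unfolded over_cert_def, folded zf_def]
    by (elim exE conjE) (rule that; (assumption | erule (1) bspec))
  have K: "S \<union> J \<subseteq> T" "S \<union> J' \<subseteq> T" using J by auto
  have cw: "cone_vec T S w" unfolding cone_vec_def
  proof
    show "\<forall>i\<in>T - S. 0 \<le> w i"
    proof
      fix i assume "i \<in> T - S"
      then show "0 \<le> w i" using w(2)[of i] w(4)[of i] by (cases "i \<in> J") auto
    qed
  qed (simp add: w(3))
  have cw': "cone_vec T S w'" unfolding cone_vec_def
  proof
    show "\<forall>i\<in>T - S. 0 \<le> w' i"
    proof
      fix i assume "i \<in> T - S"
      then show "0 \<le> w' i" using w'(2)[of i] w'(4)[of i] by (cases "i \<in> J'") auto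
    qed
  qed (simp add: w'(3))
  have r: "(\<lambda>i. zf y i - w i) i = \<tau>" if "i \<in> S \<union> J" for i using w(5)[OF that] by simp
  have r2: "(\<lambda>i. zf y i - w i) i < \<tau>" if "i \<in> T - (S \<union> J)" for i using w(2,6)[OF that] by simp
  have r': "(\<lambda>i. zf y' i - w' i) i = \<tau>'" if "i \<in> S \<union> J'" for i using w'(5)[OF that] by simp
  have r2': "(\<lambda>i. zf y' i - w' i) i < \<tau>'" if "i \<in> T - (S \<union> J')" for i using w'(2,6)[OF that] by simp
  have rw: "inner_on T (\<lambda>i. zf y i - w i) w = 0"
  proof -
    have "inner_on T (\<lambda>i. zf y i - w i) w = (\<Sum>i\<in>T. \<tau> * w i)" unfolding inner_on_def
    proof (intro sum.cong refl)
      fix i assume "i \<in> T"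
      then show "(zf y i - w i) * w i = \<tau> * w i" using w(2)[of i] r[of i] by (cases "i \<in> S \<union> J") auto
    qed
    then show ?thesis using w(3) by (simp add: sum_distrib_left[symmetric])
  qed
  have rw': "inner_on T (\<lambda>i. zf y' i - w' i) w' = 0"
  proof -
    have "inner_on T (\<lambda>i. zf y' i - w' i) w' = (\<Sum>i\<in>T. \<tau>' * w' i)" unfolding inner_on_def
    proof (intro sum.cong refl)
      fix i assume "i \<in> T"
      then show "(zf y' i - w' i) * w' i = \<tau>' * w' i" using w'(2)[of i] r'[of i] by (cases "i \<in> S \<union> J'") auto
    qed
    then show ?thesis using w'(3) by (simp add: sum_distrib_left[symmetric])
  qed
  have le: "inner_on T (\<lambda>i. zf y i - w i) w' \<le> 0" by (rule inner_le_on_cone(1)[OF fin cw' K(1) r r2 w(1)])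
  have le': "inner_on T (\<lambda>i. zf y' i - w' i) w \<le> 0" by (rule inner_le_on_cone(1)[OF fin cw K(2) r' r2' w'(1)])
  have expand: "inner_on T x (zf y) = (\<Sum>l\<in>M. y l * inner_on T x (\<lambda>i. A (l, i)))" for x y
    unfolding zf_def[abs_def] by (simp only: inner_on_sum_right inner_on_scale_right)
  have e: "inner_on T (zf x) w' = inner_on T (zf x) w" for x
    unfolding inner_on_commute[of T "zf _"] expand
    by (intro sum.cong refl) (use w(7) w'(7) in \<open>simp add: inner_on_commute[of T w] inner_on_commute[of T w']\<close>)
  have "inner_on T (\<lambda>i. w i - w' i) (\<lambda>i. w i - w' i)
      = inner_on T w w + inner_on T w' w' - 2 * inner_on T w w'"
    unfolding inner_on_diff_left inner_on_diff_right by (simp add: inner_on_commute)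
  also have "\<dots> \<le> 0" using rw rw' le le' e[of y] e[of y'] unfolding inner_on_diff_left
    by (simp add: inner_on_commute[of T w' w])
  finally have "inner_on T (\<lambda>i. w i - w' i) (\<lambda>i. w i - w' i) = 0"
    using inner_on_self_nonneg[of T "\<lambda>i. w i - w' i"] by simp
  then have ww: "w i = w' i" if "i \<in> T" for i using that inner_on_self_eq_0_iff[OF fin] by auto
  show ?thesis
  proof (intro equalityI subsetI)
    fix j assume j: "j \<in> J" then have "w' j > 0" using w(4)[OF j] ww[of j] J by auto
    then show "j \<in> J'" using w'(2)[of j] j J by force
  next
    fix j assume j: "j \<in> J'" then have "w j > 0" using w'(4)[OF j] ww[of j] J by auto
    then show "j \<in> J" using w(2)[of j] j J by force
  qed
qed

section \<open>From solved linear systems to certificates\<close>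

context axis_refl
begin

lemma row_refl_T:
  assumes "T \<subseteq> N" "finite N" "l \<in> M" "i \<in> N"
  shows "row_refl M N u A (l, i) = (if i \<in> T then H (\<lambda>j. A (l, j)) i else A (l, i))"
  using assms KT i0 by (intro row_refl_support) (auto simp: axis_vec_def)

lemma row_refl_involution:
  assumes "T \<subseteq> N" "finite N" "A \<in> extensional (M \<times> N)"
  shows "row_refl M N u (row_refl M N u A) = A"
proof
  fix p show "row_refl M N u (row_refl M N u A) p = A p"
  proof (cases "p \<in> M \<times> N")
    case True
    then obtain l i where p: "p = (l, i)" "l \<in> M" "i \<in> N" by auto
    have "H (\<lambda>j. row_refl M N u A (l, j)) = H (H (\<lambda>j. A (l, j)))"
      by (rule H_cong) (use assms(1) p in \<open>auto simp: row_refl_T[OF assms(1,2) p(2)]\<close>)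
    then show ?thesis using p by (simp add: row_refl_T[OF assms(1,2) p(2)] H_involution)
  next
    case False
    then show ?thesis using extensional_arb[OF assms(3) False] by (simp add: row_refl_def)
  qed
qed

text \<open>In reflected coordinates the span of the face is the coordinate space \<open>Q\<close>,
  where the normal equations have been solved. Since \<open>H\<close> is a symmetric isometry, all
  pairings carry over when both the rows and the solution are reflected.\<close>

lemma under_cert_row_refl:
  assumes K: "K = S \<union> J" and J: "i0 \<notin> J" and D: "finite D" "p \<notin> D"
    and qs: "distinct qs" "set qs = Q" and ok: "gs_ok qs D (\<lambda>q l. A (l, q))"
    and B: "\<forall>j\<in>J. 0 < inner_on Q (H (delta j)) (under_coef D p qs A)"
    and C: "(\<lambda>i\<in>T - Q. inner_on (insert p D) (under_dual D p qs A) (\<lambda>l. A (l, i))) \<in> cell_cone T K i0"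
  shows "under_cert D p T S J (row_refl (insert p D) T u A)"
proof -
  define A' where "A' = row_refl (insert p D) T u A"
  have A': "A' (l, i) = H (\<lambda>j. A (l, j)) i" if "l \<in> insert p D" "i \<in> T" for l i
    using that finT by (simp add: A'_def row_refl_T)
  define c where "c = under_coef D p qs A"
  define ch where "ch = (\<lambda>i. if i \<in> Q then c i else 0)"
  define w where "w = H ch"
  define z where "z = (\<lambda>i. A (p, i) - (\<Sum>l\<in>D. inner_on Q c (\<lambda>j. A (l, j)) * A (l, i)))"
  \<comment> \<open>The normal equations say that \<open>z\<close> vanishes on \<open>Q\<close>.
    Hence \<open>H z\<close> is constant on \<open>K\<close>, with the value carried by the
    coordinate \<open>i0\<close>.\<close>
  define \<tau> where "\<tau> = z i0 / \<kappa>"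
  have ch: "inner_on T x ch = inner_on Q x c" for x
  proof -
    have "inner_on T x ch = inner_on T ch x" by (rule inner_on_commute)
    also have "\<dots> = inner_on Q ch x" using KT finT by (intro inner_on_support) (auto simp: ch_def)
    also have "\<dots> = inner_on Q x c" by (subst inner_on_commute, intro inner_on_cong) (simp_all add: ch_def)
    finally show ?thesis .
  qed
  have zdual: "inner_on (insert p D) (under_dual D p qs A) (\<lambda>l. A (l, i)) = z i" for i
  proof -
    have "inner_on (insert p D) (under_dual D p qs A) (\<lambda>l. A (l, i))
       = A (p, i) + (\<Sum>l\<in>D. - (\<Sum>q\<in>set qs. c q * A (l, q)) * A (l, i))"
      unfolding inner_on_def using D
      by (simp add: under_dual_def) (intro sum.cong refl, auto simp: c_def)
    then show ?thesis unfolding z_def inner_on_def qs by (simp add: sum_negf)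
  qed
  have zQ: "z q = 0" if "q \<in> Q" for q
    using under_coef_solves[OF qs(1) ok, of q p] that
    unfolding z_def inner_on_def qs c_def by (simp add: mult.commute)
  have innerw: "inner_on T (\<lambda>i. A' (l, i)) w = inner_on Q c (\<lambda>j. A (l, j))" if "l \<in> insert p D" for l
  proof -
    have "inner_on T (\<lambda>i. A' (l, i)) w = inner_on T (H (\<lambda>j. A (l, j))) (H ch)"
      unfolding w_def using A' that by (intro inner_on_cong) auto
    then show ?thesis unfolding H_isometry ch by (simp add: inner_on_commute)
  qed
  have zA': "A' (p, i) - (\<Sum>l\<in>D. inner_on T (\<lambda>i. A' (l, i)) w * A' (l, i)) = H z i" if "i \<in> T" for i
  proof -
    have "H z i = H (\<lambda>j. A (p, j)) i - (\<Sum>l\<in>D. inner_on Q c (\<lambda>j. A (l, j)) * H (\<lambda>j. A (l, j)) i)"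
      unfolding z_def H_diff[OF that] H_lincomb[OF that] ..
    then show ?thesis using that by (simp add: A' innerw)
  qed
  have C': "0 < z i0" "\<And>i. i \<in> T - K \<Longrightarrow> z i < \<tau>"
  proof -
    have "i0 \<in> T - Q" using i0 KT by auto
    then show "0 < z i0" using C by (simp add: cell_cone_def zdual)
    show "z i < \<tau>" if "i \<in> T - K" for i
      using C \<open>i0 \<in> T - Q\<close> that by (auto simp: cell_cone_def zdual \<tau>_def \<kappa>_def)
  qed
  have zK: "H z i = \<tau>" if "i \<in> K" for i
  proof -
    have "inner_on Q (H (delta i)) z = 0" unfolding inner_on_def using zQ by (intro sum.neutral) auto
    then show ?thesis using H_on[OF that, of z] by (simp add: \<tau>_def)
  qed
  have w0: "w i = 0" if "i \<in> T - K" for i using H_off[OF that, of ch] that by (simp add: w_def ch_def)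
  have sw: "(\<Sum>i\<in>T. w i) = 0"
  proof -
    have "(\<Sum>i\<in>T. w i) = (\<Sum>i\<in>K. w i)" using finT KT w0 by (intro sum.mono_neutral_right) auto
    then show ?thesis by (simp add: w_def sum_H ch_def)
  qed
  have wJ: "0 < w j" if "j \<in> J" for j
  proof -
    have "inner_on Q (H (delta j)) ch = inner_on Q (H (delta j)) c" by (intro inner_on_cong) (auto simp: ch_def)
    then have "w j = inner_on Q (H (delta j)) c" using H_on[of j ch] that K by (simp add: w_def ch_def)
    then show ?thesis using B that by (simp add: c_def)
  qed
  have "\<tau> > 0" using C'(1) kpos by (simp add: \<tau>_def)
  \<comment> \<open>For a zero-sum vector \<open>x\<close> supported on \<open>K\<close>, the vector
    \<open>H x\<close> is supported on \<open>Q\<close>, where the independence of the columns given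
    by \<open>gs_ok\<close> applies.\<close>
  have inj: "\<forall>i\<in>T. x i = 0" if x: "\<forall>i\<in>T - K. x i = 0" "(\<Sum>i\<in>T. x i) = 0" "\<forall>l\<in>D. inner_on T (\<lambda>i. A' (l, i)) x = 0" for x
  proof -
    have s: "(\<Sum>i\<in>T. x i) = (\<Sum>i\<in>K. x i)" using finT KT x(1) by (intro sum.mono_neutral_right) auto
    have h0: "H x i0 = 0" using s x(2) by (simp add: H_i0)
    have hoff: "H x i = 0" if "i \<in> T - K" for i using H_off[OF that, of x] x(1) that by simp
    have "lincomb (set qs) (H x) (\<lambda>q l. A (l, q)) l = 0" if l: "l \<in> D" for l
    proof -
      have "0 = inner_on T (H (\<lambda>j. A (l, j))) x"
        using x(3) l A'[of l] by (auto simp: inner_on_def)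
      also have "\<dots> = inner_on T (\<lambda>j. A (l, j)) (H x)" by (rule H_inner[symmetric])
      also have "\<dots> = (\<Sum>j\<in>Q. A (l, j) * H x j)"
        unfolding inner_on_def using finT KT h0 hoff by (intro sum.mono_neutral_right) auto
      finally show ?thesis unfolding lincomb_def qs by (simp add: mult.commute)
    qed
    then have "H x q = 0" if "q \<in> Q" for q using gs_indep[OF qs(1) ok, of "H x" q] that qs by auto
    then have "H x i = 0" if "i \<in> T" for i using h0 hoff that by (cases "i = i0"; cases "i \<in> K") auto
    then have "x i = 0" if "i \<in> T" for i
      using H_sum_zero[OF that, of "H x"] H_involution[OF that, of x] by simp
    then show ?thesis by simp
  qed
  show ?thesis unfolding under_cert_def A'_def[symmetric] K[symmetric]
    using \<open>\<tau> > 0\<close> w0 sw wJ inj zA' zK C'(2) KT H_off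
    by (intro conjI exI[of _ w] exI[of _ \<tau>]) auto
qed

text \<open>The solution of least norm is itself a combination of the rows, so here \<open>z\<close>
  equals \<open>c\<close> on \<open>Q\<close> instead of vanishing there. This turns the constant
  value of \<open>H z\<close> on \<open>K\<close> into \<open>w i + \<tau>\<close>.\<close>

lemma over_cert_row_refl:
  assumes K: "K = S \<union> J" and J: "i0 \<notin> J" and s: "s \<notin> T"
    and ls: "distinct ls" and ok: "gs_ok ls Q (\<lambda>l q. A (l, q))"
    and B: "\<forall>j\<in>J. 0 < inner_on Q (H (delta j)) (over_vec ls Q s A)"
    and C: "(\<lambda>i\<in>T - Q. inner_on (set ls) (over_dual ls Q s A) (\<lambda>l. A (l, i))) \<in> cell_cone T K i0"
  shows "over_cert (set ls) s T S J (row_refl (set ls) (insert s T) u A)"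
proof -
  define A' where "A' = row_refl (set ls) (insert s T) u A"
  have A': "A' (l, i) = H (\<lambda>j. A (l, j)) i" if "l \<in> set ls" "i \<in> T" for l i
    unfolding A'_def using that finT by (subst row_refl_T) auto
  have A's: "A' (l, s) = A (l, s)" if "l \<in> set ls" for l
    unfolding A'_def using that finT s by (subst row_refl_T) auto
  define c where "c = over_vec ls Q s A"
  define y where "y = over_dual ls Q s A"
  define ch where "ch = (\<lambda>i. if i \<in> Q then c i else 0)"
  define w where "w = H ch"
  define z where "z = (\<lambda>i. \<Sum>l\<in>set ls. y l * A (l, i))"
  define \<tau> where "\<tau> = z i0 / \<kappa>"
  have ch: "inner_on T x ch = inner_on Q x c" for x
  proof -
    have "inner_on T x ch = inner_on T ch x" by (rule inner_on_commute)
    also have "\<dots> = inner_on Q ch x" using KT finT by (intro inner_on_support) (auto simp: ch_def)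
    also have "\<dots> = inner_on Q x c" by (subst inner_on_commute, intro inner_on_cong) (simp_all add: ch_def)
    finally show ?thesis .
  qed
  have zdual: "inner_on (set ls) (over_dual ls Q s A) (\<lambda>l. A (l, i)) = z i" for i
    by (simp add: inner_on_def z_def y_def)
  have zQ: "z q = c q" for q by (simp add: z_def c_def over_vec_def y_def)
  have innerw: "inner_on T (\<lambda>i. A' (l, i)) w = A' (l, s)" if "l \<in> set ls" for l
  proof -
    have "inner_on T (\<lambda>i. A' (l, i)) w = inner_on T (H (\<lambda>j. A (l, j))) (H ch)"
      unfolding w_def using A' that by (intro inner_on_cong) auto
    also have "\<dots> = inner_on Q (\<lambda>j. A (l, j)) c" unfolding H_isometry ch ..
    also have "\<dots> = A (l, s)" unfolding c_def by (rule over_vec_solves[OF ls ok that])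
    finally show ?thesis using A's[OF that] by simp
  qed
  have zA': "(\<Sum>l\<in>set ls. y l * A' (l, i)) = H z i" if "i \<in> T" for i
    unfolding z_def H_lincomb[OF that] using A' that by simp
  have C': "0 < z i0" "\<And>i. i \<in> T - K \<Longrightarrow> z i < \<tau>"
  proof -
    have "i0 \<in> T - Q" using i0 KT by auto
    then show "0 < z i0" using C by (simp add: cell_cone_def zdual)
    show "z i < \<tau>" if "i \<in> T - K" for i
      using C \<open>i0 \<in> T - Q\<close> that by (auto simp: cell_cone_def zdual \<tau>_def \<kappa>_def)
  qed
  have wK: "w i = inner_on Q (H (delta i)) c" if "i \<in> K" for i
  proof -
    have "inner_on Q (H (delta i)) ch = inner_on Q (H (delta i)) c" by (intro inner_on_cong) (auto simp: ch_def)
    then show ?thesis using H_on[OF that, of ch] by (simp add: w_def ch_def)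
  qed
  have zK: "H z i = w i + \<tau>" if "i \<in> K" for i
  proof -
    have "inner_on Q (H (delta i)) z = inner_on Q (H (delta i)) c" by (intro inner_on_cong) (auto simp: zQ)
    then show ?thesis using H_on[OF that, of z] wK[OF that] by (simp add: \<tau>_def)
  qed
  have w0: "w i = 0" if "i \<in> T - K" for i using H_off[OF that, of ch] that by (simp add: w_def ch_def)
  have sw: "(\<Sum>i\<in>T. w i) = 0"
  proof -
    have "(\<Sum>i\<in>T. w i) = (\<Sum>i\<in>K. w i)" using finT KT w0 by (intro sum.mono_neutral_right) auto
    then show ?thesis by (simp add: w_def sum_H ch_def)
  qed
  have wJ: "0 < w j" if "j \<in> J" for j using B wK[of j] that K by (auto simp: c_def)
  have "\<tau> > 0" using C'(1) kpos by (simp add: \<tau>_def)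
  show ?thesis unfolding over_cert_def A'_def[symmetric] K[symmetric]
    using \<open>\<tau> > 0\<close> w0 sw wJ zA' zK C'(2) KT H_off innerw
    by (intro exI[of _ y] exI[of _ w] exI[of _ \<tau>] conjI) auto
qed

end

section \<open>Probability of the certificate of a face\<close>

lemma emeasure_row_refl_vimage:
  assumes "finite M" "finite N" "E \<in> sets (gauss (M \<times> N))"
  shows "row_refl M N u -` E \<inter> space (gauss (M \<times> N)) \<in> sets (gauss (M \<times> N))"
    and "emeasure (gauss (M \<times> N)) (row_refl M N u -` E \<inter> space (gauss (M \<times> N))) = emeasure (gauss (M \<times> N)) E"
proof -
  let ?G = "gauss (M \<times> N)"
  have m: "row_refl M N u \<in> measurable ?G (PiM (M \<times> N) (\<lambda>_. borel))"
    unfolding measurable_gauss_cong by (rule measurable_row_refl)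
  have E: "E \<in> sets (PiM (M \<times> N) (\<lambda>_. borel))" using assms(3) by (simp only: sets_gauss)
  show "row_refl M N u -` E \<inter> space ?G \<in> sets ?G" by (rule measurable_sets[OF m E])
  show "emeasure ?G (row_refl M N u -` E \<inter> space ?G) = emeasure ?G E"
    using emeasure_distr[OF m E] unfolding distr_gauss_row_refl[OF assms(1,2)] by simp
qed

text \<open>\<open>under_cert\<close> contains an existential over real vectors; a measurable set of
  certified matrices avoids discussing its measurability. The bounds on
  \<open>card (S \<union> J)\<close> say that \<open>Q\<close>, which has one element less, is
  nonempty and not larger than \<open>D\<close>, so that its columns are almost surely
  independent.\<close>

lemma exists_measurable_under_cert:
  assumes fin: "finite T" "finite D" "p \<notin> D" and S: "S \<subseteq> T" "S \<noteq> {}" and J: "J \<subseteq> T - S"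
    and card: "2 \<le> card (S \<union> J)" "card (S \<union> J) \<le> Suc (card D)"
  shows "\<exists>E\<in>sets (gauss (insert p D \<times> T)). (\<forall>A\<in>E. under_cert D p T S J A) \<and>
    emeasure (gauss T) {g \<in> space (gauss T). face_cell T S J g} \<le> emeasure (gauss (insert p D \<times> T)) E"
proof -
  define K where "K = S \<union> J"
  obtain i0 where i0S: "i0 \<in> S" using S by auto
  have i0J: "i0 \<notin> J" using i0S J by auto
  interpret axis_refl T K i0 using fin S J i0S by unfold_locales (auto simp: K_def)
  let ?G = "gauss (insert p D \<times> T)"
  define qs where "qs = (SOME xs. set xs = Q \<and> distinct xs)"
  have qs: "set qs = Q" "distinct qs"
    using someI_ex[OF finite_distinct_list[of Q]] finK by (auto simp: qs_def)
  have lq: "length qs = card K - 1" using distinct_card[OF qs(2)] qs(1) i0 finK K_def by (simp add: card_Diff_singleton)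
  have qs': "set qs \<subseteq> T" "qs \<noteq> []" "length qs \<le> card D"
    using qs KT lq card by (auto simp: K_def)
  have fJ: "finite J" using J fin(1) by (auto intro: finite_subset)
  note C = cell_cone_measurable[folded qs(1)]
  note cc = cell_cone_cone[folded qs(1)]
  define E0 where "E0 = {A \<in> space ?G. (\<forall>j\<in>J. 0 < inner_on Q (H (delta j)) (under_coef D p qs A)) \<and>
     (\<lambda>i\<in>T - Q. inner_on (insert p D) (under_dual D p qs A) (\<lambda>l. A (l, i))) \<in> cell_cone T K i0}"
  note U = under_certificate_ge(1,2)[OF fin(2,1) fJ fin(3) qs(2) qs' C cc, where v="\<lambda>j. H (delta j)", unfolded qs(1), folded E0_def]
  note U3 = under_certificate_ge(3)[OF fin(2,1) fJ fin(3) qs(2) qs' C cc, unfolded qs(1)]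
  have U1: "emeasure (gauss T) {g \<in> space (gauss T). (\<forall>j\<in>J. 0 < inner_on Q (H (delta j)) g) \<and> restrict g (T - Q) \<in> cell_cone T K i0}
    \<le> emeasure ?G E0" by (rule U(1))
  have U2: "E0 \<in> sets ?G" by (rule U(2))
  have ok: "AE A in ?G. gs_ok qs D (\<lambda>q l. A (l, q))" by (rule U3)
  define E1 where "E1 = E0 \<inter> {A \<in> space ?G. gs_ok qs D (\<lambda>q l. A (l, q))}"
  have sok: "{A \<in> space ?G. gs_ok qs D (\<lambda>q l. A (l, q))} \<in> sets ?G"
  proof (rule predE)
    show "Measurable.pred ?G (\<lambda>A. gs_ok qs D (\<lambda>q l. A (l, q)))"
      unfolding measurable_gauss_cong using qs' by (intro measurable_gs_ok) auto
  qed
  have E1: "E1 \<in> sets ?G" unfolding E1_def using U2 sok by (rule sets.Int)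
  have "emeasure ?G E1 = emeasure ?G E0"
    using ok by (intro emeasure_eq_AE[OF _ E1 U2], eventually_elim) (auto simp: E1_def E0_def)
  then have ge: "emeasure (gauss T) {g \<in> space (gauss T). face_cell T S J g} \<le> emeasure ?G E1"
    using U1 emeasure_face_cell[OF K_def i0J] by simp
  \<comment> \<open>The certificate has been obtained for the reflected matrix. Pulling the event
    back along the reflection, a measure preserving involution, gives it for the matrix
    itself.\<close>
  define E where "E = row_refl (insert p D) T u -` E1 \<inter> space ?G"
  have Es: "E \<in> sets ?G" "emeasure ?G E = emeasure ?G E1"
    unfolding E_def using fin E1 by (auto intro!: emeasure_row_refl_vimage)
  have cert: "under_cert D p T S J A" if "A \<in> E" for A
  proof -
    define A' where "A' = row_refl (insert p D) T u A"
    have A': "A' \<in> E1" "A \<in> extensional (insert p D \<times> T)" using that by (auto simp: E_def A'_def space_gauss)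
    have "under_cert D p T S J (row_refl (insert p D) T u A')"
      using A'(1) qs by (intro under_cert_row_refl[OF K_def i0J fin(2,3) qs(2,1)]) (auto simp: E1_def E0_def)
    then show ?thesis unfolding A'_def using row_refl_involution[OF order_refl fin(1) A'(2)] by simp
  qed
  show ?thesis
  proof (intro bexI[of _ E] conjI ballI)
    show "emeasure (gauss T) {g \<in> space (gauss T). face_cell T S J g} \<le> emeasure ?G E"
      unfolding Es(2) by (rule ge)
  qed (rule cert Es(1), assumption?)+
qed

text \<open>The zero-sum condition takes one dimension from \<open>S \<union> J\<close>. The strict
  inequality leaves \<open>card M \<le> card Q\<close>, so the rows restricted to \<open>Q\<close>
  are almost surely independent.\<close>

lemma exists_measurable_over_cert:
  assumes fin: "finite T" "finite M" "M \<noteq> {}" "s \<notin> T" and S: "S \<subseteq> T" "S \<noteq> {}" and J: "J \<subseteq> T - S"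
    and card: "card M < card (S \<union> J)"
  shows "\<exists>E\<in>sets (gauss (M \<times> insert s T)). (\<forall>A\<in>E. over_cert M s T S J A) \<and>
    emeasure (gauss T) {g \<in> space (gauss T). face_cell T S J g} \<le> emeasure (gauss (M \<times> insert s T)) E"
proof -
  define K where "K = S \<union> J"
  obtain i0 where i0S: "i0 \<in> S" using S by auto
  have i0J: "i0 \<notin> J" using i0S J by auto
  interpret axis_refl T K i0 using fin S J i0S by unfold_locales (auto simp: K_def)
  let ?G = "gauss (M \<times> insert s T)"
  define ls where "ls = (SOME xs. set xs = M \<and> distinct xs)"
  have ls: "set ls = M" "distinct ls"
    using someI_ex[OF finite_distinct_list[of M]] fin by (auto simp: ls_def)
  have lq: "card Q = card K - 1" using i0 finK K_def by (simp add: card_Diff_singleton)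
  have ls': "ls \<noteq> []" "length ls \<le> card Q"
    using ls fin lq card distinct_card[OF ls(2)] by (auto simp: K_def)
  have QT: "Q \<subseteq> T" using KT by auto
  have fJ: "finite J" using J fin(1) by (auto intro: finite_subset)
  define E0 where "E0 = {A \<in> space ?G. (\<forall>j\<in>J. 0 < inner_on Q (H (delta j)) (over_vec ls Q s A)) \<and>
     (\<lambda>i\<in>T - Q. inner_on M (over_dual ls Q s A) (\<lambda>l. A (l, i))) \<in> cell_cone T K i0}"
  note U = over_certificate_ge(1,2)[OF fin(1) fJ fin(4) ls(2) ls' QT cell_cone_measurable cell_cone_cone, where v="\<lambda>j. H (delta j)", unfolded ls(1), folded E0_def]
  note U3 = over_certificate_ge(3)[OF fin(1) fJ fin(4) ls(2) ls' QT cell_cone_measurable cell_cone_cone, unfolded ls(1)]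
  have U1: "emeasure (gauss T) {g \<in> space (gauss T). (\<forall>j\<in>J. 0 < inner_on Q (H (delta j)) g) \<and> restrict g (T - Q) \<in> cell_cone T K i0}
    \<le> emeasure ?G E0" by (rule U(1))
  have U2: "E0 \<in> sets ?G" by (rule U(2))
  have ok: "AE A in ?G. gs_ok ls Q (\<lambda>l q. A (l, q))" by (rule U3)
  define E1 where "E1 = E0 \<inter> {A \<in> space ?G. gs_ok ls Q (\<lambda>l q. A (l, q))}"
  have sok: "{A \<in> space ?G. gs_ok ls Q (\<lambda>l q. A (l, q))} \<in> sets ?G"
  proof (rule predE)
    show "Measurable.pred ?G (\<lambda>A. gs_ok ls Q (\<lambda>l q. A (l, q)))"
      unfolding measurable_gauss_cong using QT ls by (intro measurable_gs_ok) auto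
  qed
  have E1: "E1 \<in> sets ?G" unfolding E1_def using U2 sok by (rule sets.Int)
  have "emeasure ?G E1 = emeasure ?G E0"
    using ok by (intro emeasure_eq_AE[OF _ E1 U2], eventually_elim) (auto simp: E1_def E0_def)
  then have ge: "emeasure (gauss T) {g \<in> space (gauss T). face_cell T S J g} \<le> emeasure ?G E1"
    using U1 emeasure_face_cell[OF K_def i0J] by simp
  define E where "E = row_refl M (insert s T) u -` E1 \<inter> space ?G"
  have Es: "E \<in> sets ?G" "emeasure ?G E = emeasure ?G E1"
    unfolding E_def using fin E1 by (auto intro!: emeasure_row_refl_vimage)
  have cert: "over_cert M s T S J A" if "A \<in> E" for A
  proof -
    define A' where "A' = row_refl M (insert s T) u A"
    have A': "A' \<in> E1" "A \<in> extensional (M \<times> insert s T)" using that by (auto simp: E_def A'_def space_gauss)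
    have "over_cert (set ls) s T S J (row_refl (set ls) (insert s T) u A')"
      using A'(1) ls by (intro over_cert_row_refl[OF K_def i0J fin(4) ls(2)]) (auto simp: E1_def E0_def)
    moreover have "row_refl M (insert s T) u (row_refl M (insert s T) u A) = A"
      by (rule row_refl_involution[OF subset_insertI _ A'(2)]) (use fin(1) in simp)
    ultimately show ?thesis unfolding A'_def ls by (simp only:)
  qed
  show ?thesis
  proof (intro bexI[of _ E] conjI ballI)
    show "emeasure (gauss T) {g \<in> space (gauss T). face_cell T S J g} \<le> emeasure ?G E"
      unfolding Es(2) by (rule ge)
  qed (rule cert Es(1), assumption?)+
qed

text \<open>Uniqueness of the face makes the certified events disjoint, so their measures add up
  inside \<open>Ev\<close>; for the Gaussian cells subadditivity goes in the right
  direction.\<close>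

lemma emeasure_disjoint_certs_ge:
  assumes fin: "finite T" "S \<subseteq> T" and JJ: "\<And>J. J \<in> JJ \<Longrightarrow> J \<subseteq> T - S"
    and ex: "\<And>J. J \<in> JJ \<Longrightarrow> \<exists>E\<in>sets G. (\<forall>A\<in>E. cert J A) \<and>
       emeasure (gauss T) {g \<in> space (gauss T). face_cell T S J g} \<le> emeasure G E"
    and uniq: "\<And>J J' A. J \<in> JJ \<Longrightarrow> J' \<in> JJ \<Longrightarrow> cert J A \<Longrightarrow> cert J' A \<Longrightarrow> J = J'"
    and Ev: "Ev \<in> sets G" "\<And>J A. J \<in> JJ \<Longrightarrow> A \<in> space G \<Longrightarrow> cert J A \<Longrightarrow> A \<in> Ev"
  shows "emeasure (gauss T) {g \<in> space (gauss T). \<exists>J\<in>JJ. face_cell T S J g} \<le> emeasure G Ev"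
proof -
  have fJJ: "finite JJ" using JJ fin(1) by (intro finite_subset[of JJ "Pow (T - S)"]) auto
  obtain E where E: "\<And>J. J \<in> JJ \<Longrightarrow> E J \<in> sets G" "\<And>J A. J \<in> JJ \<Longrightarrow> A \<in> E J \<Longrightarrow> cert J A"
    "\<And>J. J \<in> JJ \<Longrightarrow> emeasure (gauss T) {g \<in> space (gauss T). face_cell T S J g} \<le> emeasure G (E J)"
    using ex by metis
  have s: "{g \<in> space (gauss T). face_cell T S J g} \<in> sets (gauss T)" if "J \<in> JJ" for J
    using fin JJ[OF that] by (intro measurable_face_cell) auto
  have "{g \<in> space (gauss T). \<exists>J\<in>JJ. face_cell T S J g} = (\<Union>J\<in>JJ. {g \<in> space (gauss T). face_cell T S J g})" by auto
  then have "emeasure (gauss T) {g \<in> space (gauss T). \<exists>J\<in>JJ. face_cell T S J g}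
     \<le> (\<Sum>J\<in>JJ. emeasure (gauss T) {g \<in> space (gauss T). face_cell T S J g})"
    using fJJ s by (auto intro!: emeasure_subadditive_finite)
  also have "\<dots> \<le> (\<Sum>J\<in>JJ. emeasure G (E J))" by (intro sum_mono E(3))
  also have "\<dots> = emeasure G (\<Union>J\<in>JJ. E J)"
  proof (rule sum_emeasure)
    show "disjoint_family_on E JJ" unfolding disjoint_family_on_def using E(2) uniq by blast
  qed (use E fJJ in auto)
  also have "\<dots> \<le> emeasure G Ev"
    using E Ev(2) sets.sets_into_space by (intro emeasure_mono[OF _ Ev(1)]) blast
  finally show ?thesis .
qed

section \<open>Concentration of the face dimension\<close>

text \<open>Second order Taylor expansion. In the remainder, \<open>x\<^sup>2 / 2\<close> and the
  exponential at the intermediate point are each at most \<open>exp \<bar>x\<bar>\<close>; the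
  condition \<open>s \<le> 1\<close> frees this bound from \<open>s\<close>.\<close>

lemma exp_le_quadratic:
  fixes s x :: real
  assumes "0 \<le> s" "s \<le> 1"
  shows "exp (s * x) \<le> 1 + s * x + s\<^sup>2 * exp (2 * \<bar>x\<bar>)"
proof -
  obtain t where t: "\<bar>t\<bar> \<le> \<bar>s * x\<bar>" "exp (s * x) = (\<Sum>m<2. (s * x) ^ m / fact m) + exp t / fact 2 * (s * x) ^ 2"
    using Maclaurin_exp_le by blast
  have "\<bar>s * x\<bar> \<le> \<bar>x\<bar>" using assms by (simp add: abs_mult mult_left_le_one_le)
  then have e: "exp t \<le> exp \<bar>x\<bar>" using t(1) by simp
  have q: "x\<^sup>2 / 2 \<le> exp \<bar>x\<bar>"
    using exp_lower_Taylor_quadratic[of "\<bar>x\<bar>"] by simp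
  have "exp t / fact 2 * (s * x) ^ 2 = s\<^sup>2 * (exp t * (x\<^sup>2 / 2))" by (simp add: power_mult_distrib)
  also have "\<dots> \<le> s\<^sup>2 * (exp \<bar>x\<bar> * exp \<bar>x\<bar>)"
    using e q by (intro mult_left_mono mult_mono) auto
  also have "exp \<bar>x\<bar> * exp \<bar>x\<bar> = exp (2 * \<bar>x\<bar>)" by (simp add: exp_add[symmetric])
  finally show ?thesis using t(2) by (simp add: numeral_2_eq_2)
qed

lemma integrable_stdn_exp_abs: "integrable stdn (\<lambda>x. exp (2 * \<bar>x\<bar>))"
proof -
  have n: "std_normal_density x * exp (2 * x) = exp 2 * normal_density 2 1 x" for x
  proof -
    have "- x\<^sup>2 / 2 + 2 * x = 2 + - (x - 2)\<^sup>2 / 2" by (simp add: power2_eq_square field_simps)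
    then have "exp (- x\<^sup>2 / 2) * exp (2 * x) = exp 2 * exp (- (x - 2)\<^sup>2 / 2)" by (simp add: exp_add[symmetric])
    then show ?thesis by (simp add: normal_density_def)
  qed
  have n': "std_normal_density x * exp (- (2 * x)) = exp 2 * normal_density (- 2) 1 x" for x
  proof -
    have "- x\<^sup>2 / 2 + - (2 * x) = 2 + - (x + 2)\<^sup>2 / 2" by (simp add: power2_eq_square field_simps)
    then have "exp (- x\<^sup>2 / 2) * exp (- (2 * x)) = exp 2 * exp (- (x + 2)\<^sup>2 / 2)" by (simp add: exp_add[symmetric])
    then show ?thesis by (simp add: normal_density_def)
  qed
  have "integrable lborel (\<lambda>x. exp 2 * normal_density 2 1 x + exp 2 * normal_density (- 2) 1 x)" by simp
  then have "integrable lborel (\<lambda>x. std_normal_density x *\<^sub>R (exp (2 * x) + exp (- (2 * x))))"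
    by (simp add: n n' distrib_left)
  then have "integrable stdn (\<lambda>x. exp (2 * x) + exp (- (2 * x)))"
    by (subst integrable_density) auto
  then show ?thesis
  proof (rule Bochner_Integration.integrable_bound)
    have "exp (2 * \<bar>x\<bar>) \<le> exp (2 * x) + exp (- (2 * x))" for x :: real by (simp add: abs_if)
    then show "AE x in stdn. norm (exp (2 * \<bar>x\<bar>)) \<le> norm (exp (2 * x) + exp (- (2 * x)))"
      by (intro AE_I2) (simp add: abs_of_nonneg)
  qed simp
qed

lemma integrable_stdn_linear_growth:
  fixes f :: "real \<Rightarrow> real" and C :: real
  assumes [measurable]: "f \<in> borel_measurable borel" and f: "\<And>x. \<bar>f x\<bar> \<le> \<bar>x\<bar> + C"
  shows "integrable stdn f" "integrable stdn (\<lambda>x. exp (2 * \<bar>f x\<bar>))"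
proof -
  show e: "integrable stdn (\<lambda>x. exp (2 * \<bar>f x\<bar>))"
  proof (rule Bochner_Integration.integrable_bound)
    show "integrable stdn (\<lambda>x. exp (2 * C) * exp (2 * \<bar>x\<bar>))" using integrable_stdn_exp_abs by simp
    show "AE x in stdn. norm (exp (2 * \<bar>f x\<bar>)) \<le> norm (exp (2 * C) * exp (2 * \<bar>x\<bar>))"
    proof (rule AE_I2)
      fix x
      have "exp (2 * \<bar>f x\<bar>) \<le> exp (2 * C + 2 * \<bar>x\<bar>)" using f[of x] by simp
      then show "norm (exp (2 * \<bar>f x\<bar>)) \<le> norm (exp (2 * C) * exp (2 * \<bar>x\<bar>))" by (simp add: exp_add)
    qed
  qed simp
  show "integrable stdn f"
  proof (rule Bochner_Integration.integrable_bound[OF e])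
    show "AE x in stdn. norm (f x) \<le> norm (exp (2 * \<bar>f x\<bar>))"
    proof (rule AE_I2)
      fix x have "\<bar>f x\<bar> \<le> exp (2 * \<bar>f x\<bar>)" using exp_ge_add_one_self[of "2 * \<bar>f x\<bar>"] by linarith
      then show "norm (f x) \<le> norm (exp (2 * \<bar>f x\<bar>))" by simp
    qed
  qed simp
qed

lemma nn_integral_stdn_exp_le:
  fixes f :: "real \<Rightarrow> real" and s C E :: real
  assumes [measurable]: "f \<in> borel_measurable borel" and f: "\<And>x. \<bar>f x\<bar> \<le> \<bar>x\<bar> + C"
    and s: "0 \<le> s" "s \<le> 1" and E: "(\<integral>x. exp (2 * \<bar>f x\<bar>) \<partial>stdn) \<le> E"
  shows "(\<integral>\<^sup>+x. ennreal (exp (s * f x)) \<partial>stdn) \<le> ennreal (exp (s * (\<integral>x. f x \<partial>stdn) + s\<^sup>2 * E))"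
proof -
  interpret prob_space stdn by (rule prob_space_stdn)
  note i = integrable_stdn_linear_growth[OF assms(1) f]
  have "(\<integral>\<^sup>+x. ennreal (exp (s * f x)) \<partial>stdn) \<le> (\<integral>\<^sup>+x. ennreal (1 + s * f x + s\<^sup>2 * exp (2 * \<bar>f x\<bar>)) \<partial>stdn)"
    by (rule nn_integral_mono, rule ennreal_leI, rule exp_le_quadratic[OF s])
  also have "\<dots> = ennreal (\<integral>x. 1 + s * f x + s\<^sup>2 * exp (2 * \<bar>f x\<bar>) \<partial>stdn)"
  proof (rule nn_integral_eq_integral)
    show "integrable stdn (\<lambda>x. 1 + s * f x + s\<^sup>2 * exp (2 * \<bar>f x\<bar>))" using i by simp
    show "AE x in stdn. 0 \<le> 1 + s * f x + s\<^sup>2 * exp (2 * \<bar>f x\<bar>)"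
    proof (rule AE_I2)
      fix x show "0 \<le> 1 + s * f x + s\<^sup>2 * exp (2 * \<bar>f x\<bar>)"
        using exp_le_quadratic[OF s, of "f x"] exp_ge_zero[of "s * f x"] by linarith
    qed
  qed
  also have "(\<integral>x. 1 + s * f x + s\<^sup>2 * exp (2 * \<bar>f x\<bar>) \<partial>stdn) = 1 + s * (\<integral>x. f x \<partial>stdn) + s\<^sup>2 * (\<integral>x. exp (2 * \<bar>f x\<bar>) \<partial>stdn)"
    using i prob_space by simp
  also have "ennreal \<dots> \<le> ennreal (exp (s * (\<integral>x. f x \<partial>stdn) + s\<^sup>2 * E))"
  proof (rule ennreal_leI)
    have "s\<^sup>2 * (\<integral>x. exp (2 * \<bar>f x\<bar>) \<partial>stdn) \<le> s\<^sup>2 * E" using E by (intro mult_left_mono) auto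
    then show "1 + s * (\<integral>x. f x \<partial>stdn) + s\<^sup>2 * (\<integral>x. exp (2 * \<bar>f x\<bar>) \<partial>stdn) \<le> exp (s * (\<integral>x. f x \<partial>stdn) + s\<^sup>2 * E)"
      using exp_ge_add_one_self[of "s * (\<integral>x. f x \<partial>stdn) + s\<^sup>2 * E"] by linarith
  qed
  finally show ?thesis .
qed

lemma prod_mono_ennreal:
  fixes f g :: "'i \<Rightarrow> ennreal"
  assumes "\<And>i. i \<in> I \<Longrightarrow> f i \<le> g i"
  shows "(\<Prod>i\<in>I. f i) \<le> (\<Prod>i\<in>I. g i)"
  using assms by (induction I rule: infinite_finite_induct) (auto intro!: mult_mono)

text \<open>Markov's inequality for the exponential of \<open>s\<close> times the sum. Independence
  factorises the expectation, and the second order bound applies to each factor.\<close>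

lemma chernoff_gauss:
  fixes f1 f2 :: "real \<Rightarrow> real" and s C E :: real
  assumes T: "finite T" "S \<subseteq> T"
    and m[measurable]: "f1 \<in> borel_measurable borel" "f2 \<in> borel_measurable borel"
    and f: "\<And>x. \<bar>f1 x\<bar> \<le> \<bar>x\<bar> + C" "\<And>x. \<bar>f2 x\<bar> \<le> \<bar>x\<bar> + C"
    and s: "0 \<le> s" "s \<le> 1"
    and E: "(\<integral>x. exp (2 * \<bar>f1 x\<bar>) \<partial>stdn) \<le> E" "(\<integral>x. exp (2 * \<bar>f2 x\<bar>) \<partial>stdn) \<le> E"
  shows "measure (gauss T) {g \<in> space (gauss T). 0 \<le> (\<Sum>i\<in>S. f1 (g i)) + (\<Sum>i\<in>T - S. f2 (g i))}
    \<le> exp (s * (card S * (\<integral>x. f1 x \<partial>stdn) + card (T - S) * (\<integral>x. f2 x \<partial>stdn)) + s\<^sup>2 * card T * E)"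
proof -
  interpret N: product_sigma_finite "\<lambda>_. stdn" by (rule product_sigma_finite_stdn)
  interpret G: prob_space "gauss T" by (rule prob_space_gauss)
  define F where "F = (\<lambda>i x. ennreal (exp (s * (if i \<in> S then f1 x else f2 x))))"
  have fS: "finite S" using T by (auto intro: finite_subset)
  let ?Z = "\<lambda>g. (\<Sum>i\<in>S. f1 (g i)) + (\<Sum>i\<in>T - S. f2 (g i))"
  have Z: "?Z g = (\<Sum>i\<in>T. if i \<in> S then f1 (g i) else f2 (g i))" for g
    using T fS by (subst sum.If_cases) (auto simp: Int_absorb1 Diff_eq)
  have comp: "(\<lambda>g. g i) \<in> borel_measurable (gauss T)" if "i \<in> T" for i
    using that unfolding measurable_gauss_cong by simp
  have c1: "(\<lambda>g. f1 (g i)) \<in> borel_measurable (gauss T)" if "i \<in> S" for i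
    using that T by (intro measurable_compose[OF comp[of i] m(1)]) auto
  have c2: "(\<lambda>g. f2 (g i)) \<in> borel_measurable (gauss T)" if "i \<in> T - S" for i
    using that T by (intro measurable_compose[OF comp[of i] m(2)]) auto
  have mZ: "?Z \<in> borel_measurable (gauss T)"
    by (rule borel_measurable_add[OF borel_measurable_sum[OF c1] borel_measurable_sum[OF c2]])
  have sZ: "{g \<in> space (gauss T). 0 \<le> ?Z g} \<in> sets (gauss T)"
    by (rule borel_measurable_le[OF borel_measurable_const mZ])
  have prodF: "(\<Prod>i\<in>T. F i (g i)) = ennreal (exp (s * ?Z g))" for g
    unfolding F_def Z sum_distrib_left using T by (simp add: prod_ennreal exp_sum)
  have "emeasure (gauss T) {g \<in> space (gauss T). 0 \<le> ?Z g}
      = (\<integral>\<^sup>+g. indicator {g \<in> space (gauss T). 0 \<le> ?Z g} g \<partial>gauss T)"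
    by (rule nn_integral_indicator[OF sZ, symmetric])
  also have "\<dots> \<le> (\<integral>\<^sup>+g. (\<Prod>i\<in>T. F i (g i)) \<partial>gauss T)"
  proof (rule nn_integral_mono)
    fix g
    show "indicator {g \<in> space (gauss T). 0 \<le> ?Z g} g \<le> (\<Prod>i\<in>T. F i (g i))"
    proof (cases "0 \<le> ?Z g")
      case True
      have "1 \<le> exp (s * ?Z g)" unfolding one_le_exp_iff by (rule mult_nonneg_nonneg[OF s(1) True])
      then have "ennreal 1 \<le> (\<Prod>i\<in>T. F i (g i))" unfolding prodF by (rule ennreal_leI)
      moreover have "indicator X g \<le> (1 :: ennreal)" for X by (simp add: indicator_def)
      ultimately show ?thesis unfolding ennreal_1 by (rule order_trans[rotated])
    next
      case False
      then have "g \<notin> {g \<in> space (gauss T). 0 \<le> ?Z g}" by blast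
      then show ?thesis unfolding indicator_def by auto
    qed
  qed
  also have "\<dots> = (\<Prod>i\<in>T. \<integral>\<^sup>+x. F i x \<partial>stdn)"
    unfolding gauss_def using T by (intro N.product_nn_integral_prod) (auto simp: F_def)
  also have "\<dots> \<le> (\<Prod>i\<in>T. ennreal (exp (if i \<in> S then s * (\<integral>x. f1 x \<partial>stdn) + s\<^sup>2 * E else s * (\<integral>x. f2 x \<partial>stdn) + s\<^sup>2 * E)))"
    unfolding F_def using nn_integral_stdn_exp_le[OF m(1) f(1) s E(1)] nn_integral_stdn_exp_le[OF m(2) f(2) s E(2)]
    by (intro prod_mono_ennreal) auto
  also have "\<dots> = ennreal (exp (\<Sum>i\<in>T. if i \<in> S then s * (\<integral>x. f1 x \<partial>stdn) + s\<^sup>2 * E else s * (\<integral>x. f2 x \<partial>stdn) + s\<^sup>2 * E))"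
    using T by (simp add: prod_ennreal exp_sum)
  also have "(\<Sum>i\<in>T. if i \<in> S then s * (\<integral>x. f1 x \<partial>stdn) + s\<^sup>2 * E else s * (\<integral>x. f2 x \<partial>stdn) + s\<^sup>2 * E)
     = card S * (s * (\<integral>x. f1 x \<partial>stdn) + s\<^sup>2 * E) + card (T - S) * (s * (\<integral>x. f2 x \<partial>stdn) + s\<^sup>2 * E)"
    using T fS by (subst sum.If_cases) (auto simp: Int_absorb1 Diff_eq)
  also have "\<dots> = s * (card S * (\<integral>x. f1 x \<partial>stdn) + card (T - S) * (\<integral>x. f2 x \<partial>stdn)) + s\<^sup>2 * card T * E"
  proof -
    have "real (card T) = card S + card (T - S)"
      using T fS card_mono[of T S] by (simp add: card_Diff_subset)
    then show ?thesis by (simp add: algebra_simps)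
  qed
  finally show ?thesis unfolding G.emeasure_eq_measure by simp
qed

text \<open>The rate and the starting index are uniform in \<open>T\<close> and \<open>S\<close>.
  The tolerances \<open>1\<close> and \<open>2\<close> leave room for rounding \<beta> times
  \<open>n\<close> and for removing one distinguished index from both sets.\<close>

lemma chernoff_gauss_asymptotic:
  fixes f1 f2 :: "real \<Rightarrow> real" and \<beta> C :: real
  assumes \<beta>: "0 < \<beta>" "\<beta> < 1"
    and m: "f1 \<in> borel_measurable borel" "f2 \<in> borel_measurable borel"
    and f: "\<And>x. \<bar>f1 x\<bar> \<le> \<bar>x\<bar> + C" "\<And>x. \<bar>f2 x\<bar> \<le> \<bar>x\<bar> + C"
    and neg: "\<beta> * (\<integral>x. f1 x \<partial>stdn) + (1 - \<beta>) * (\<integral>x. f2 x \<partial>stdn) < 0"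
  shows "\<exists>c>0. \<exists>n0. \<forall>n\<ge>n0. \<forall>T S. finite T \<and> S \<subseteq> T \<and> \<bar>real (card T) - real n\<bar> \<le> 1 \<and> \<bar>real (card S) - \<beta> * real n\<bar> \<le> 2 \<longrightarrow>
    measure (gauss T) {g \<in> space (gauss T). 0 \<le> (\<Sum>i\<in>S. f1 (g i)) + (\<Sum>i\<in>T - S. f2 (g i))} \<le> exp (- c * real n)"
proof -
  define \<mu>1 where "\<mu>1 = (\<integral>x. f1 x \<partial>stdn)"
  define \<mu>2 where "\<mu>2 = (\<integral>x. f2 x \<partial>stdn)"
  \<comment> \<open>Half the drift per index: the mean of the sum is about
    \<open>- 2 * d * n\<close>, and one half is reserved for the quadratic term.\<close>
  define d where "d = - (\<beta> * \<mu>1 + (1 - \<beta>) * \<mu>2) / 2"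
  define E where "E = max 1 (max (\<integral>x. exp (2 * \<bar>f1 x\<bar>) \<partial>stdn) (\<integral>x. exp (2 * \<bar>f2 x\<bar>) \<partial>stdn))"
  \<comment> \<open>Balances the two orders: \<open>s * E \<le> d\<close> makes the quadratic term
    cost at most \<open>s * d\<close> per index, half of the linear gain.\<close>
  define s where "s = min 1 (d / E)"
  \<comment> \<open>Collects the bounded errors: \<open>2\<close> from \<open>card S\<close>,
    \<open>3 = 1 + 2\<close> from \<open>card (T - S)\<close>, and one \<open>d\<close> because
    \<open>card T\<close> may exceed \<open>n\<close> by one.\<close>
  define B where "B = 2 * \<bar>\<mu>1\<bar> + 3 * \<bar>\<mu>2\<bar> + d"
  have d: "d > 0" using neg by (simp add: d_def \<mu>1_def \<mu>2_def)
  have E: "E \<ge> 1" "E > 0" by (auto simp: E_def)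
  have s: "0 < s" "s \<le> 1" "s * E \<le> d"
  proof -
    have "s \<le> d / E" by (simp add: s_def)
    then show "s * E \<le> d" using E by (simp add: field_simps)
  qed (use d E in \<open>auto simp: s_def\<close>)
  obtain n0 :: nat where n0: "real n0 \<ge> 2 * B / d" using real_arch_simple by blast
  show ?thesis
  proof (intro exI[of _ "s * d / 2"] conjI exI[of _ n0] allI impI)
    show "0 < s * d / 2" using s d by simp
    fix n :: nat and T S :: "'a set" assume n: "n0 \<le> n"
      and TS: "finite T \<and> S \<subseteq> T \<and> \<bar>real (card T) - real n\<bar> \<le> 1 \<and> \<bar>real (card S) - \<beta> * real n\<bar> \<le> 2"
    define k where "k = real (card S)"
    define t where "t = real (card T)"
    have fS: "finite S" using TS by (auto intro: finite_subset)
    have cTS: "real (card (T - S)) = t - k"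
      using TS fS card_mono[of T S] by (simp add: card_Diff_subset k_def t_def)
    have k: "\<bar>k - \<beta> * n\<bar> \<le> 2" "\<bar>t - n\<bar> \<le> 1" using TS by (auto simp: k_def t_def)
    have "k * \<mu>1 + (t - k) * \<mu>2 = n * (\<beta> * \<mu>1 + (1 - \<beta>) * \<mu>2) + (k - \<beta> * n) * \<mu>1 + ((t - n) - (k - \<beta> * n)) * \<mu>2"
      by (simp add: algebra_simps)
    also have "(k - \<beta> * n) * \<mu>1 \<le> 2 * \<bar>\<mu>1\<bar>"
      using mult_right_mono[OF k(1), of "\<bar>\<mu>1\<bar>"] abs_ge_self[of "(k - \<beta> * n) * \<mu>1"] by (simp add: abs_mult)
    also have "((t - n) - (k - \<beta> * n)) * \<mu>2 \<le> 3 * \<bar>\<mu>2\<bar>"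
    proof -
      have "\<bar>(t - n) - (k - \<beta> * n)\<bar> \<le> 3" using k by linarith
      from mult_right_mono[OF this, of "\<bar>\<mu>2\<bar>"] abs_ge_self[of "((t - n) - (k - \<beta> * n)) * \<mu>2"]
      show ?thesis by (simp add: abs_mult)
    qed
    also have "n * (\<beta> * \<mu>1 + (1 - \<beta>) * \<mu>2) = - 2 * d * n" by (simp add: d_def field_simps)
    finally have mean: "k * \<mu>1 + (t - k) * \<mu>2 \<le> - 2 * d * n + 2 * \<bar>\<mu>1\<bar> + 3 * \<bar>\<mu>2\<bar>" by simp
    have "s\<^sup>2 * t * E = s * (t * (s * E))" by (simp add: power2_eq_square)
    also have "\<dots> \<le> s * (t * d)" using s by (intro mult_left_mono) (auto simp: t_def)
    also have "\<dots> \<le> s * ((n + 1) * d)" using k s d by (intro mult_left_mono mult_right_mono) auto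
    finally have sq: "s\<^sup>2 * t * E \<le> s * ((n + 1) * d)" .
    have "s * (k * \<mu>1 + (t - k) * \<mu>2) + s\<^sup>2 * t * E \<le> s * (- 2 * d * n + 2 * \<bar>\<mu>1\<bar> + 3 * \<bar>\<mu>2\<bar>) + s * ((n + 1) * d)"
      by (rule add_mono[OF mult_left_mono[OF mean less_imp_le[OF s(1)]] sq])
    also have "\<dots> = s * (B - d * n)" by (simp add: B_def algebra_simps)
    also have "\<dots> \<le> s * (- (d * n / 2))"
    proof (intro mult_left_mono)
      have "2 * B / d \<le> n" using n0 n by linarith
      then have "2 * B \<le> d * n" using d by (simp add: field_simps)
      then show "B - d * n \<le> - (d * n / 2)" by simp
    qed (use s in simp)
    finally have le: "s * (k * \<mu>1 + (t - k) * \<mu>2) + s\<^sup>2 * t * E \<le> - (s * d / 2) * n" by simp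
    have "measure (gauss T) {g \<in> space (gauss T). 0 \<le> (\<Sum>i\<in>S. f1 (g i)) + (\<Sum>i\<in>T - S. f2 (g i))}
      \<le> exp (s * (k * \<mu>1 + card (T - S) * \<mu>2) + s\<^sup>2 * t * E)"
      unfolding \<mu>1_def \<mu>2_def k_def t_def
    proof (rule chernoff_gauss[where C=C])
      show "(\<integral>x. exp (2 * \<bar>f1 x\<bar>) \<partial>stdn) \<le> E" "(\<integral>x. exp (2 * \<bar>f2 x\<bar>) \<partial>stdn) \<le> E"
        unfolding E_def by linarith+
    qed (use TS s m f in auto)
    also have "\<dots> \<le> exp (- (s * d / 2) * n)" using le by (simp add: cTS)
    finally show "measure (gauss T) {g \<in> space (gauss T). 0 \<le> (\<Sum>i\<in>S. f1 (g i)) + (\<Sum>i\<in>T - S. f2 (g i))} \<le> exp (- (s * d / 2) * real n)" .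
  qed
qed

text \<open>The cell is found from a root \<open>t\<close> of \<open>(\<Sum>i\<in>S. t - g i) =
  (\<Sum>i\<in>T - S. max 0 (g i - t))\<close>. With \<open>J\<close> the entries above
  \<open>t\<close>, this equation says precisely that \<open>t\<close> is the mean over
  \<open>S \<union> J\<close>. The two sign conditions place a root between \<open>t1\<close> and
  \<open>t2\<close>, which traps \<open>J\<close> between two explicit sets.\<close>

lemma face_cell_exists:
  fixes g :: "'b \<Rightarrow> real"
  assumes T: "finite T" "S \<subseteq> T" "S \<noteq> {}" and t: "0 < t1" "t1 < t2"
    and psi1: "(\<Sum>i\<in>S. t1 - g i) + (\<Sum>i\<in>T - S. - max 0 (g i - t1)) < 0"
    and psi2: "(\<Sum>i\<in>S. g i - t2) + (\<Sum>i\<in>T - S. max 0 (g i - t2)) < 0"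
    and ties: "\<And>J i. J \<subseteq> T - S \<Longrightarrow> i \<in> T - (S \<union> J) \<Longrightarrow> g i \<noteq> mean_on (S \<union> J) g"
  shows "\<exists>J. J \<subseteq> T - S \<and> face_cell T S J g \<and> {i \<in> T - S. t2 < g i} \<subseteq> J \<and> J \<subseteq> {i \<in> T - S. t1 < g i}"
proof -
  have fS: "finite S" using T by (auto intro: finite_subset)
  define f where "f = (\<lambda>t. (\<Sum>i\<in>S. t - g i) - (\<Sum>i\<in>T - S. max 0 (g i - t)))"
  have f1: "f t1 < 0" using psi1 by (simp add: f_def sum_negf)
  have f2: "f t2 > 0"
  proof -
    have "(\<Sum>i\<in>S. g i - t2) = - (\<Sum>i\<in>S. t2 - g i)" by (simp add: sum_negf[symmetric])
    then show ?thesis using psi2 by (simp add: f_def)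
  qed
  have cont: "continuous_on {t1..t2} f" unfolding f_def by (intro continuous_intros)
  obtain t where tt: "t1 \<le> t" "t \<le> t2" "f t = 0"
    using IVT'[of f t1 0 t2] f1 f2 t cont by auto
  have t12: "t1 < t" "t < t2" using tt f1 f2 by (auto simp: less_le)
  define J where "J = {i \<in> T - S. t < g i}"
  have J: "J \<subseteq> T - S" "finite J" using T by (auto simp: J_def)
  have "(\<Sum>i\<in>T - S. max 0 (g i - t)) = (\<Sum>i\<in>J. g i - t)"
  proof -
    have "(\<Sum>i\<in>T - S. max 0 (g i - t)) = (\<Sum>i\<in>J. max 0 (g i - t))"
      using T by (intro sum.mono_neutral_right) (auto simp: J_def max_def)
    also have "\<dots> = (\<Sum>i\<in>J. g i - t)" by (intro sum.cong) (auto simp: J_def max_def)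
    finally show ?thesis .
  qed
  then have "(\<Sum>i\<in>S. t - g i) = (\<Sum>i\<in>J. g i - t)" using tt(3) by (simp add: f_def)
  then have "card S * t - sum g S = sum g J - card J * t" by (simp add: sum_subtractf)
  moreover have "S \<inter> J = {}" using J by auto
  ultimately have "sum g (S \<union> J) = card (S \<union> J) * t"
    using fS J by (simp add: sum.union_disjoint card_Un_disjoint algebra_simps)
  moreover have "card (S \<union> J) \<noteq> 0" using T fS J by auto
  ultimately have mean: "mean_on (S \<union> J) g = t" by (simp add: mean_on_def)
  have "face_cell T S J g"
    unfolding face_cell_def mean
  proof (intro conjI ballI)
    fix i assume i: "i \<in> T - (S \<union> J)"
    then have "g i \<le> t" by (auto simp: J_def)
    moreover have "g i \<noteq> t" using ties[OF J(1) i] by (simp add: mean)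
    ultimately show "g i < t" by simp
  qed (use t t12 in \<open>auto simp: J_def\<close>)
  then show ?thesis using J t12 by (intro exI[of _ J]) (auto simp: J_def)
qed

text \<open>The index \<open>i\<close> lies outside the set over which the mean is taken, so a tie
  is a nontrivial linear equation, and there are finitely many of them.\<close>

lemma AE_gauss_no_ties:
  assumes T: "finite T" "S \<subseteq> T"
  shows "AE g in gauss T. \<forall>J. J \<subseteq> T - S \<longrightarrow> (\<forall>i\<in>T - (S \<union> J). g i \<noteq> mean_on (S \<union> J) g)"
proof -
  have "AE g in gauss T. \<forall>J\<in>Pow (T - S). \<forall>i\<in>T - (S \<union> J). g i \<noteq> mean_on (S \<union> J) g"
  proof (intro AE_finite_allI)
    show "finite (Pow (T - S))" using T by simp
    fix J assume J: "J \<in> Pow (T - S)"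
    show "finite (T - (S \<union> J))" using T by simp
    fix i assume i: "i \<in> T - (S \<union> J)"
    define v where "v = (\<lambda>k. (if k = i then 1 else 0) - (if k \<in> S \<union> J then 1 / real (card (S \<union> J)) else 0))"
    have "v i \<noteq> 0" using i by (simp add: v_def)
    then have "\<not> (\<forall>k\<in>T. v k = 0)" using i by auto
    from AE_gauss_inner_neq_0[OF T(1) this] show "AE g in gauss T. g i \<noteq> mean_on (S \<union> J) g"
    proof eventually_elim
      case (elim g)
      have "inner_on T (\<lambda>k. if k \<in> S \<union> J then 1 / real (card (S \<union> J)) else 0) g
        = inner_on (S \<union> J) (\<lambda>k. if k \<in> S \<union> J then 1 / real (card (S \<union> J)) else 0) g"
        using T J by (intro inner_on_support) auto
      also have "\<dots> = mean_on (S \<union> J) g"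
        by (simp add: inner_on_def mean_on_def sum_divide_distrib)
      finally have "inner_on T v g = g i - mean_on (S \<union> J) g"
        unfolding v_def inner_on_diff_left using i T by (simp add: inner_on_delta)
      then show ?case using elim by simp
    qed
  qed
  then show ?thesis by (auto elim: eventually_mono)
qed

lemma integral_stdn_id: "(\<integral>x. x \<partial>stdn) = 0"
proof -
  have "has_bochner_integral lborel (\<lambda>x. std_normal_density x * x ^ (2 * 0 + 1)) 0"
    by (rule std_normal_moment_odd)
  then have "(\<integral>x. std_normal_density x *\<^sub>R x \<partial>lborel) = 0" by (simp add: has_bochner_integral_iff)
  then show ?thesis by (subst integral_density) auto
qed

lemma measure_stdn_UNIV: "measure stdn UNIV = 1"
  using prob_space.prob_space[OF prob_space_stdn] by simp

lemma integral_stdn_indicator: "(\<integral>x. (if t < x then 1 else 0) \<partial>stdn) = measure stdn {t<..}"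
proof -
  have "(\<integral>x. (if t < x then 1 else 0) \<partial>stdn) = (\<integral>x. indicator {t<..} x \<partial>stdn)"
    by (intro Bochner_Integration.integral_cong) (auto simp: indicator_def)
  also have "\<dots> = measure stdn ({t<..} \<inter> space stdn)" by (rule Bochner_Integration.integral_indicator)
  finally show ?thesis by simp
qed

lemma four_exp_le:
  assumes "0 < c" "ln 4 * 2 / c \<le> real n"
  shows "4 * exp (- c * real n) \<le> exp (- (c / 2) * real n)"
proof -
  have "ln 4 * 2 \<le> c * n" using assms by (simp add: field_simps)
  then have "exp (ln 4 + - c * n) \<le> exp (- (c / 2) * n)" by simp
  then show ?thesis unfolding exp_add by simp
qed

text \<open>Since \<open>J\<close> depends on all entries at once, its size is not a sum of
  independent terms. Trapping the random threshold between the constants \<open>t1\<close> and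
  \<open>t2\<close> replaces it by the numbers of entries above these constants, which are such
  sums.\<close>

lemma face_cells_cover:
  fixes \<beta> t1 t2 a1 a2 :: real
  assumes \<beta>: "0 < \<beta>" "\<beta> < 1" and t: "0 < t1" "t1 < t2"
    and D1: "\<beta> * t1 - (1 - \<beta>) * (\<integral>x. max 0 (x - t1) \<partial>stdn) < 0"
    and D2: "0 < \<beta> * t2 - (1 - \<beta>) * (\<integral>x. max 0 (x - t2) \<partial>stdn)"
    and a1: "\<beta> + (1 - \<beta>) * measure stdn {t1<..} < a1"
    and a2: "a2 < \<beta> + (1 - \<beta>) * measure stdn {t2<..}"
  shows "\<exists>c>0. \<exists>n0. \<forall>n\<ge>n0. \<forall>T S :: 'a set. finite T \<and> S \<subseteq> T \<and> S \<noteq> {} \<and> \<bar>real (card T) - real n\<bar> \<le> 1 \<and> \<bar>real (card S) - \<beta> * real n\<bar> \<le> 2 \<longrightarrow>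
     1 - exp (- c * real n) \<le> measure (gauss T) {g \<in> space (gauss T).
        \<exists>J\<in>{J. J \<subseteq> T - S \<and> a2 * card T < card (S \<union> J) \<and> card (S \<union> J) < a1 * card T}. face_cell T S J g}"
proof -
  define Z where "Z = (\<lambda>f1 f2 (T :: 'a set) S g. (\<Sum>i\<in>S. f1 (g i :: real)) + (\<Sum>i\<in>T - S. f2 (g i)) :: real)"
  define sz where "sz = (\<lambda>n (T :: 'a set) S. finite T \<and> S \<subseteq> T \<and> \<bar>real (card T) - real n\<bar> \<le> 1 \<and> \<bar>real (card S) - \<beta> * real n\<bar> \<le> 2)"
  have im: "integrable stdn (\<lambda>x. max 0 (x - t))" for t :: real
    by (rule integrable_stdn_linear_growth[where C="\<bar>t\<bar>"]) auto
  have ii: "integrable stdn (\<lambda>x. if t < x then 1 else 0 :: real)" for t :: real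
    by (rule integrable_stdn_linear_growth[where C=1]) auto
  have ix: "integrable stdn (\<lambda>x. x)" by (rule integrable_stdn_linear_growth[where C=0]) auto
  have ic: "integrable stdn (\<lambda>x. c)" for c :: real by (rule integrable_stdn_linear_growth[where C="\<bar>c\<bar>"]) auto
  have "\<exists>c>0. \<exists>n0. \<forall>n\<ge>n0. \<forall>T S. sz n T S \<longrightarrow> measure (gauss T) {g \<in> space (gauss T). 0 \<le> Z (\<lambda>x. t1 - x) (\<lambda>x. - max 0 (x - t1)) T S g} \<le> exp (- c * real n)"
    unfolding Z_def sz_def
  proof (rule chernoff_gauss_asymptotic[OF \<beta>, where C="\<bar>t1\<bar>"])
    have "(\<integral>x. t1 - x \<partial>stdn) = t1" by (simp add: Bochner_Integration.integral_diff[OF ic ix] integral_stdn_id measure_stdn_UNIV)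
    then show "\<beta> * (\<integral>x. t1 - x \<partial>stdn) + (1 - \<beta>) * (\<integral>x. - max 0 (x - t1) \<partial>stdn) < 0" using D1 by simp
  qed auto
  then obtain c1 n1 where 1: "c1 > 0" "\<And>n T S. n \<ge> n1 \<Longrightarrow> sz n T S \<Longrightarrow> measure (gauss T) {g \<in> space (gauss T). 0 \<le> Z (\<lambda>x. t1 - x) (\<lambda>x. - max 0 (x - t1)) T S g} \<le> exp (- c1 * real n)"
    by blast
  have "\<exists>c>0. \<exists>n0. \<forall>n\<ge>n0. \<forall>T S. sz n T S \<longrightarrow> measure (gauss T) {g \<in> space (gauss T). 0 \<le> Z (\<lambda>x. x - t2) (\<lambda>x. max 0 (x - t2)) T S g} \<le> exp (- c * real n)"
    unfolding Z_def sz_def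
  proof (rule chernoff_gauss_asymptotic[OF \<beta>, where C="\<bar>t2\<bar>"])
    have "(\<integral>x. x - t2 \<partial>stdn) = - t2" by (simp add: Bochner_Integration.integral_diff[OF ix ic] integral_stdn_id measure_stdn_UNIV)
    then show "\<beta> * (\<integral>x. x - t2 \<partial>stdn) + (1 - \<beta>) * (\<integral>x. max 0 (x - t2) \<partial>stdn) < 0" using D2 by simp
  qed auto
  then obtain c2 n2 where 2: "c2 > 0" "\<And>n T S. n \<ge> n2 \<Longrightarrow> sz n T S \<Longrightarrow> measure (gauss T) {g \<in> space (gauss T). 0 \<le> Z (\<lambda>x. x - t2) (\<lambda>x. max 0 (x - t2)) T S g} \<le> exp (- c2 * real n)"
    by blast
  have "\<exists>c>0. \<exists>n0. \<forall>n\<ge>n0. \<forall>T S. sz n T S \<longrightarrow> measure (gauss T) {g \<in> space (gauss T). 0 \<le> Z (\<lambda>x. 1 - a1) (\<lambda>x. (if t1 < x then 1 else 0) - a1) T S g} \<le> exp (- c * real n)"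
    unfolding Z_def sz_def
  proof (rule chernoff_gauss_asymptotic[OF \<beta>, where C="1 + \<bar>a1\<bar>"])
    have e: "(\<integral>x. (if t1 < x then 1 else 0) - a1 \<partial>stdn) = measure stdn {t1<..} - a1"
      by (simp add: Bochner_Integration.integral_diff[OF ii ic] integral_stdn_indicator measure_stdn_UNIV)
    show "\<beta> * (\<integral>x. 1 - a1 \<partial>stdn) + (1 - \<beta>) * (\<integral>x. (if t1 < x then 1 else 0) - a1 \<partial>stdn) < 0"
      unfolding e using a1 by (simp add: measure_stdn_UNIV algebra_simps)
  qed auto
  then obtain c3 n3 where 3: "c3 > 0" "\<And>n T S. n \<ge> n3 \<Longrightarrow> sz n T S \<Longrightarrow> measure (gauss T) {g \<in> space (gauss T). 0 \<le> Z (\<lambda>x. 1 - a1) (\<lambda>x. (if t1 < x then 1 else 0) - a1) T S g} \<le> exp (- c3 * real n)"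
    by blast
  have "\<exists>c>0. \<exists>n0. \<forall>n\<ge>n0. \<forall>T S. sz n T S \<longrightarrow> measure (gauss T) {g \<in> space (gauss T). 0 \<le> Z (\<lambda>x. a2 - 1) (\<lambda>x. a2 - (if t2 < x then 1 else 0)) T S g} \<le> exp (- c * real n)"
    unfolding Z_def sz_def
  proof (rule chernoff_gauss_asymptotic[OF \<beta>, where C="1 + \<bar>a2\<bar>"])
    have e: "(\<integral>x. a2 - (if t2 < x then 1 else 0) \<partial>stdn) = a2 - measure stdn {t2<..}"
      by (simp add: Bochner_Integration.integral_diff[OF ic ii] integral_stdn_indicator measure_stdn_UNIV)
    show "\<beta> * (\<integral>x. a2 - 1 \<partial>stdn) + (1 - \<beta>) * (\<integral>x. a2 - (if t2 < x then 1 else 0) \<partial>stdn) < 0"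
      unfolding e using a2 by (simp add: measure_stdn_UNIV algebra_simps)
  qed auto
  then obtain c4 n4 where 4: "c4 > 0" "\<And>n T S. n \<ge> n4 \<Longrightarrow> sz n T S \<Longrightarrow> measure (gauss T) {g \<in> space (gauss T). 0 \<le> Z (\<lambda>x. a2 - 1) (\<lambda>x. a2 - (if t2 < x then 1 else 0)) T S g} \<le> exp (- c4 * real n)"
    by blast
  define c where "c = min (min c1 c2) (min c3 c4)"
  have c: "c > 0" "c \<le> c1" "c \<le> c2" "c \<le> c3" "c \<le> c4" using 1(1) 2(1) 3(1) 4(1) by (auto simp: c_def)
  \<comment> \<open>Beyond \<open>n5\<close> the union bound over four events of rate
    \<open>c\<close> is absorbed by halving the rate.\<close>
  obtain n5 :: nat where n5: "ln 4 * 2 / c \<le> n5" using real_arch_simple by blast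
  define n0 where "n0 = max (max n1 n2) (max (max n3 n4) n5)"
  show ?thesis
  proof (intro exI[of _ "c / 2"] conjI exI[of _ n0] allI impI)
    show "c / 2 > 0" using c by simp
    fix n :: nat and T S :: "'a set"
    assume n: "n0 \<le> n" and TS: "finite T \<and> S \<subseteq> T \<and> S \<noteq> {} \<and> \<bar>real (card T) - real n\<bar> \<le> 1 \<and> \<bar>real (card S) - \<beta> * real n\<bar> \<le> 2"
    have sz: "sz n T S" using TS by (simp add: sz_def)
    have T: "finite T" "S \<subseteq> T" "S \<noteq> {}" using TS by auto
    have fS: "finite S" using T by (auto intro: finite_subset)
    interpret G: prob_space "gauss T" by (rule prob_space_gauss)
    define Bad where "Bad = (\<lambda>f1 f2. {g \<in> space (gauss T). 0 \<le> Z f1 f2 T S g})"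
    define JJ where "JJ = {J. J \<subseteq> T - S \<and> a2 * card T < card (S \<union> J) \<and> card (S \<union> J) < a1 * card T}"
    define Good where "Good = {g \<in> space (gauss T). \<exists>J\<in>JJ. face_cell T S J g}"
    have comp: "(\<lambda>g. g i) \<in> borel_measurable (gauss T)" if "i \<in> T" for i
      using that unfolding measurable_gauss_cong by simp
    have sB: "Bad f1 f2 \<in> sets (gauss T)" if f: "f1 \<in> borel_measurable borel" "f2 \<in> borel_measurable borel" for f1 f2
    proof -
      have m1: "(\<lambda>g. f1 (g i)) \<in> borel_measurable (gauss T)" if "i \<in> S" for i
        using that T by (intro measurable_compose[OF comp[of i] f(1)]) auto
      have m2: "(\<lambda>g. f2 (g i)) \<in> borel_measurable (gauss T)" if "i \<in> T - S" for i
        using that T by (intro measurable_compose[OF comp[of i] f(2)]) auto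
      show ?thesis unfolding Bad_def Z_def
        by (rule borel_measurable_le[OF borel_measurable_const borel_measurable_add[OF borel_measurable_sum[OF m1] borel_measurable_sum[OF m2]]])
    qed
    have fJJ: "finite JJ" using T by (auto simp: JJ_def intro!: finite_subset[of _ "Pow (T - S)"])
    have sG: "Good \<in> sets (gauss T)"
    proof -
      have "Good = (\<Union>J\<in>JJ. {g \<in> space (gauss T). face_cell T S J g})" by (auto simp: Good_def)
      also have "\<dots> \<in> sets (gauss T)"
        using fJJ T by (intro sets.finite_UN measurable_face_cell) (auto simp: JJ_def)
      finally show ?thesis .
    qed
    \<comment> \<open>\<open>B1\<close> and \<open>B2\<close> are the events on which no root is
      forced between \<open>t1\<close> and \<open>t2\<close>. On \<open>B3\<close> too many entries
      lie above \<open>t1\<close>, on \<open>B4\<close> too few above \<open>t2\<close>.\<close>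
    define B1 where "B1 = Bad (\<lambda>x. t1 - x) (\<lambda>x. - max 0 (x - t1))"
    define B2 where "B2 = Bad (\<lambda>x. x - t2) (\<lambda>x. max 0 (x - t2))"
    define B3 where "B3 = Bad (\<lambda>x. 1 - a1) (\<lambda>x. (if t1 < x then 1 else 0) - a1)"
    define B4 where "B4 = Bad (\<lambda>x. a2 - 1) (\<lambda>x. a2 - (if t2 < x then 1 else 0))"
    have sBs: "B1 \<in> sets (gauss T)" "B2 \<in> sets (gauss T)" "B3 \<in> sets (gauss T)" "B4 \<in> sets (gauss T)"
      unfolding B1_def B2_def B3_def B4_def by (rule sB; measurable)+
    have le: "exp (- c' * real n) \<le> exp (- c * real n)" if "c \<le> c'" for c' using that by (simp add: mult_right_mono)
    have mB: "measure (gauss T) B1 \<le> exp (- c * real n)" "measure (gauss T) B2 \<le> exp (- c * real n)"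
      "measure (gauss T) B3 \<le> exp (- c * real n)" "measure (gauss T) B4 \<le> exp (- c * real n)"
      unfolding B1_def B2_def B3_def B4_def Bad_def
      using 1(2)[OF _ sz] 2(2)[OF _ sz] 3(2)[OF _ sz] 4(2)[OF _ sz] n le[OF c(2)] le[OF c(3)] le[OF c(4)] le[OF c(5)]
      by (force simp: n0_def intro: order_trans)+
    have incl: "g \<in> B1 \<union> B2 \<union> B3 \<union> B4 \<union> Good"
      if g: "g \<in> space (gauss T)" and ties: "\<forall>J. J \<subseteq> T - S \<longrightarrow> (\<forall>i\<in>T - (S \<union> J). g i \<noteq> mean_on (S \<union> J) g)" for g
    proof (rule ccontr)
      assume no: "g \<notin> B1 \<union> B2 \<union> B3 \<union> B4 \<union> Good"
      have cnt: "real (card {i \<in> T - S. t < g i}) = (\<Sum>i\<in>T - S. if t < g i then 1 else 0)" for t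
        using T by (subst sum.If_cases) (auto simp: Int_def)
      have p1: "(\<Sum>i\<in>S. t1 - g i) + (\<Sum>i\<in>T - S. - max 0 (g i - t1)) < 0"
        using no g by (simp add: B1_def Bad_def Z_def)
      have p2: "(\<Sum>i\<in>S. g i - t2) + (\<Sum>i\<in>T - S. max 0 (g i - t2)) < 0"
        using no g by (simp add: B2_def Bad_def Z_def)
      obtain J where J: "J \<subseteq> T - S" "face_cell T S J g" "{i \<in> T - S. t2 < g i} \<subseteq> J" "J \<subseteq> {i \<in> T - S. t1 < g i}"
        using face_cell_exists[OF T t p1 p2] ties by blast
      have fJ: "finite J" using J(1) T(1) by (auto intro: finite_subset)
      have cT: "real (card T) = card S + card (T - S)"
        using T fS card_mono[of T S] by (simp add: card_Diff_subset)
      have cSJ: "real (card (S \<union> J)) = card S + card J" using J(1) fJ fS by (subst card_Un_disjoint) auto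
      have "card J \<le> card {i \<in> T - S. t1 < g i}" using J(4) T by (intro card_mono) auto
      moreover have "card S * (1 - a1) + (card {i \<in> T - S. t1 < g i} - card (T - S) * a1) < 0"
        unfolding cnt using no g by (simp add: B3_def Bad_def Z_def sum_subtractf)
      ultimately have up: "card (S \<union> J) < a1 * card T" using cSJ cT by (simp add: algebra_simps)
      have "card {i \<in> T - S. t2 < g i} \<le> card J" using J(3) fJ by (intro card_mono) auto
      moreover have "card S * (a2 - 1) + (card (T - S) * a2 - card {i \<in> T - S. t2 < g i}) < 0"
        unfolding cnt using no g by (simp add: B4_def Bad_def Z_def sum_subtractf)
      ultimately have lo: "a2 * card T < card (S \<union> J)" using cSJ cT by (simp add: algebra_simps)
      have "J \<in> JJ" using J(1) up lo by (simp add: JJ_def)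
      then show False using no g J(2) by (auto simp: Good_def)
    qed
    have "1 = measure (gauss T) (B1 \<union> B2 \<union> B3 \<union> B4 \<union> Good)"
    proof -
      have "AE g in gauss T. g \<in> B1 \<union> B2 \<union> B3 \<union> B4 \<union> Good"
        using AE_gauss_no_ties[OF T(1,2)] AE_space[of "gauss T"] by eventually_elim (rule incl)
      then show ?thesis using sBs sG by (subst G.prob_eq_1[THEN iffD2]) auto
    qed
    also have "\<dots> \<le> measure (gauss T) B1 + measure (gauss T) B2 + measure (gauss T) B3 + measure (gauss T) B4 + measure (gauss T) Good"
      using sBs sG by (intro order_trans[OF measure_Un_le] add_mono order_refl sets.Un)
    finally have "1 - 4 * exp (- c * real n) \<le> measure (gauss T) Good" using mB by simp
    moreover have "4 * exp (- c * real n) \<le> exp (- (c / 2) * real n)"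
      using n n5 by (intro four_exp_le c) (auto simp: n0_def)
    ultimately show "1 - exp (- (c / 2) * real n) \<le> measure (gauss T) {g \<in> space (gauss T).
        \<exists>J\<in>{J. J \<subseteq> T - S \<and> a2 * card T < card (S \<union> J) \<and> card (S \<union> J) < a1 * card T}. face_cell T S J g}"
      unfolding Good_def JJ_def by linarith
  qed
qed

section \<open>The error function and the threshold\<close>

definition gtail :: "real \<Rightarrow> real" where "gtail t = measure stdn {t<..}"

lemma has_bochner_integral_gaussian: "has_bochner_integral lborel (\<lambda>x::real. exp (- x\<^sup>2)) (sqrt pi)"
proof -
  have "has_bochner_integral lborel (\<lambda>x::real. exp (- x\<^sup>2) * x ^ (2 * 0)) (2 *\<^sub>R (sqrt pi / 2))"
  proof (rule has_bochner_integral_even_function)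
    show "has_bochner_integral lborel (\<lambda>x::real. indicator {0..} x *\<^sub>R (exp (- x\<^sup>2) * x ^ (2 * 0))) (sqrt pi / 2)"
      using gaussian_moment_0 by simp
  qed simp
  then show ?thesis by simp
qed

lemma gtail_eq_gaussian: "gtail t = (\<integral>x. indicator {t / sqrt 2<..} x *\<^sub>R exp (- x\<^sup>2) \<partial>lborel) / sqrt pi"
proof -
  have "gtail t = (\<integral>x. indicator {t<..} x \<partial>stdn)" by (simp add: gtail_def)
  also have "\<dots> = (\<integral>x. std_normal_density x *\<^sub>R indicator {t<..} x \<partial>lborel)"
    by (rule integral_density) auto
  also have "\<dots> = \<bar>sqrt 2\<bar> *\<^sub>R (\<integral>x. std_normal_density (0 + sqrt 2 * x) *\<^sub>R indicator {t<..} (0 + sqrt 2 * x) \<partial>lborel)"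
    by (rule lborel_integral_real_affine) simp
  also have "(\<lambda>x. std_normal_density (0 + sqrt 2 * x) *\<^sub>R indicator {t<..} (0 + sqrt 2 * x))
     = (\<lambda>x. 1 / sqrt (2 * pi) * (indicator {t / sqrt 2<..} x *\<^sub>R exp (- x\<^sup>2)))"
    by (auto simp: fun_eq_iff indicator_def std_normal_density_def power_mult_distrib field_simps)
  also have "\<bar>sqrt 2\<bar> *\<^sub>R (\<integral>x. 1 / sqrt (2 * pi) * (indicator {t / sqrt 2<..} x *\<^sub>R exp (- x\<^sup>2)) \<partial>lborel)
     = (\<integral>x. indicator {t / sqrt 2<..} x *\<^sub>R exp (- x\<^sup>2) \<partial>lborel) / sqrt pi"
    by (subst integral_mult_right_zero) (simp add: real_sqrt_mult)
  finally show ?thesis .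
qed

text \<open>The half line integral of \<open>exp (- x\<^sup>2)\<close> is split at \<open>t\<close>;
  with oriented integrals this covers negative \<open>t\<close> too. The factor
  \<open>sqrt 2\<close> passes from this integrand to the normal density.\<close>

lemma erf_eq_gtail: "erf t = 1 - 2 * gtail (sqrt 2 * t)"
proof -
  let ?f = "\<lambda>x::real. exp (- x\<^sup>2)"
  have int: "integrable lborel ?f" using has_bochner_integral_gaussian by (simp add: has_bochner_integral_iff)
  have si: "set_integrable lborel A ?f" if "A \<in> sets borel" for A
    using int that unfolding set_integrable_def by (intro integrable_mult_indicator) auto
  have "(LBINT x=0..ereal t. ?f x) + (LBINT x=ereal t..\<infinity>. ?f x) = (LBINT x=0..\<infinity>. ?f x)"
    by (rule interval_integral_sum) (auto simp: interval_lebesgue_integrable_def si)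
  moreover have "(LBINT x=ereal t..\<infinity>. ?f x) = (\<integral>x. indicator {t<..} x *\<^sub>R ?f x \<partial>lborel)"
    by (simp add: interval_lebesgue_integral_def set_lebesgue_integral_def)
  moreover have "(LBINT x=0..\<infinity>. ?f x) = sqrt pi / 2"
  proof -
    have "(LBINT x=0..\<infinity>. ?f x) = (\<integral>x. indicator {0<..} x *\<^sub>R ?f x \<partial>lborel)"
      by (simp add: interval_lebesgue_integral_def set_lebesgue_integral_def zero_ereal_def)
    also have "\<dots> = (\<integral>x. indicator {0..} x *\<^sub>R ?f x \<partial>lborel)"
      by (rule integral_cong_AE) (auto intro!: eventually_mono[OF AE_lborel_singleton[of 0]] simp: indicator_def)
    also have "\<dots> = sqrt pi / 2" using gaussian_moment_0 by (simp add: has_bochner_integral_iff)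
    finally show ?thesis .
  qed
  ultimately have "(LBINT x=0..ereal t. ?f x) = sqrt pi / 2 - sqrt pi * gtail (sqrt 2 * t)"
    by (simp add: gtail_eq_gaussian)
  then show ?thesis by (simp add: erf_def field_simps)
qed

lemma gtail_eq_erf: "gtail t = (1 - erf (t / sqrt 2)) / 2"
  by (simp add: erf_eq_gtail)

lemma DERIV_erf: "(erf has_real_derivative 2 / sqrt pi * exp (- t\<^sup>2)) (at t)"
proof -
  let ?f = "\<lambda>x::real. exp (- x\<^sup>2)"
  define M where "M = \<bar>t\<bar> + 1"
  have "((\<lambda>u. LBINT y=0..u. ?f y) has_vector_derivative ?f t) (at t within {- M..M})"
  proof -
    have "continuous_on {- M..M} ?f" by (intro continuous_intros)
    then show ?thesis
      using interval_integral_FTC2[of "- M" 0 M ?f t] by (simp add: M_def zero_ereal_def)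
  qed
  moreover have "at t within {- M..M} = at t"
    by (rule at_within_interior) (auto simp: M_def)
  ultimately have "((\<lambda>u. LBINT y=0..u. ?f y) has_real_derivative ?f t) (at t)"
    by (simp add: has_real_derivative_iff_has_vector_derivative)
  then show ?thesis unfolding erf_def[abs_def] by (intro DERIV_cmult)
qed

lemma DERIV_gtail: "(gtail has_real_derivative - std_normal_density t) (at t)"
proof -
  have "((\<lambda>t. (1 - erf (t / sqrt 2)) / 2) has_real_derivative
      (0 - (2 / sqrt pi * exp (- (t / sqrt 2)\<^sup>2)) * (1 / sqrt 2)) / 2) (at t)"
  proof (intro DERIV_cdivide DERIV_diff DERIV_const)
    show "((\<lambda>t. erf (t / sqrt 2)) has_real_derivative 2 / sqrt pi * exp (- (t / sqrt 2)\<^sup>2) * (1 / sqrt 2)) (at t)"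
      by (rule DERIV_chain2[OF DERIV_erf]) (intro DERIV_cdivide DERIV_ident)
  qed
  moreover have "(0 - (2 / sqrt pi * exp (- (t / sqrt 2)\<^sup>2)) * (1 / sqrt 2)) / 2 = - std_normal_density t"
    by (simp add: std_normal_density_def power_divide real_sqrt_mult field_simps)
  ultimately show ?thesis by (simp add: gtail_eq_erf[abs_def])
qed

lemma DERIV_std_normal_density: "(std_normal_density has_real_derivative - t * std_normal_density t) (at t)"
proof -
  have "((\<lambda>x::real. exp (- x\<^sup>2 / 2)) has_real_derivative exp (- t\<^sup>2 / 2) * (- t)) (at t)"
    by (auto intro!: derivative_eq_intros)
  from DERIV_cmult[OF this, of "1 / sqrt (2 * pi)"]
  show ?thesis unfolding std_normal_density_def[abs_def] by (simp add: mult_ac)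
qed

lemma gtail_bounds: "0 \<le> gtail t" "gtail t \<le> 1"
  unfolding gtail_def using prob_space.prob_le_1[OF prob_space_stdn] by auto

lemma gtail_cdf: "gtail t = 1 - cdf stdn t"
proof -
  interpret prob_space stdn by (rule prob_space_stdn)
  have "measure stdn (space stdn - {..t}) = 1 - measure stdn {..t}" by (rule prob_compl) auto
  moreover have "space stdn - {..t} = {t<..}" by auto
  ultimately show ?thesis by (simp add: gtail_def cdf_def)
qed

lemma gtail_at_top: "(gtail \<longlongrightarrow> 0) at_top"
proof -
  interpret real_distribution stdn by (rule real_dist_normal_dist)
  have "((\<lambda>t. 1 - cdf stdn t) \<longlongrightarrow> 1 - 1) at_top" by (intro tendsto_intros cdf_lim_at_top_prob)
  then show ?thesis by (simp add: gtail_cdf[abs_def])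
qed

lemma gtail_at_bot: "(gtail \<longlongrightarrow> 1) at_bot"
proof -
  interpret real_distribution stdn by (rule real_dist_normal_dist)
  have "((\<lambda>t. 1 - cdf stdn t) \<longlongrightarrow> 1 - 0) at_bot" by (intro tendsto_intros cdf_lim_at_bot)
  then show ?thesis by (simp add: gtail_cdf[abs_def])
qed

lemma erf_strict_mono: "x < y \<Longrightarrow> erf x < erf y"
  by (rule DERIV_pos_imp_increasing[of x y erf]) (auto intro!: exI DERIV_erf)

lemma erf_surj:
  assumes "\<bar>y\<bar> < 1" shows "\<exists>t. erf t = y"
proof -
  have y: "0 < (1 - y) / 2" "(1 - y) / 2 < 1" using assms by auto
  obtain a where a: "gtail a < (1 - y) / 2"
    using eventually_happens'[OF _ order_tendstoD(2)[OF gtail_at_top y(1)]] by auto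
  obtain b where b: "(1 - y) / 2 < gtail b"
    using eventually_happens'[OF _ order_tendstoD(1)[OF gtail_at_bot y(2)]] by auto
  have ab: "y < erf (a / sqrt 2)" "erf (b / sqrt 2) < y" using a b by (auto simp: gtail_eq_erf)
  have "b / sqrt 2 < a / sqrt 2"
  proof (rule ccontr)
    assume "\<not> b / sqrt 2 < a / sqrt 2"
    then have "erf (a / sqrt 2) \<le> erf (b / sqrt 2)"
      using erf_strict_mono[of "a / sqrt 2" "b / sqrt 2"] by (cases "a / sqrt 2 = b / sqrt 2") auto
    then show False using ab by linarith
  qed
  moreover have "continuous_on {b / sqrt 2..a / sqrt 2} erf"
    by (rule DERIV_continuous_on[OF has_field_derivative_at_within[OF DERIV_erf]])
  ultimately show ?thesis using IVT'[of erf "b / sqrt 2" y "a / sqrt 2"] ab by auto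
qed

text \<open>The description in \<open>erfinv\<close> is determined because \<open>erf\<close> is
  strictly increasing and attains every value in the open interval from \<open>-1\<close> to
  \<open>1\<close>.\<close>

lemma erf_erfinv:
  assumes "\<bar>y\<bar> < 1" shows "erf (erfinv y) = y"
proof -
  obtain t where t: "erf t = y" using erf_surj[OF assms] by auto
  have uniq: "s = t" if "erf s = y" for s
    using that t erf_strict_mono[of s t] erf_strict_mono[of t s] by linarith
  have "erfinv y = t" unfolding erfinv_def by (rule the_equality) (rule t, erule uniq)
  then show ?thesis using t by simp
qed

lemma erfinv_less:
  assumes "\<bar>x\<bar> < 1" "\<bar>y\<bar> < 1" "x < y" shows "erfinv x < erfinv y"
proof (rule ccontr)
  assume "\<not> erfinv x < erfinv y"
  then have "erf (erfinv y) \<le> erf (erfinv x)"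
    using erf_strict_mono[of "erfinv y" "erfinv x"] by (cases "erfinv y = erfinv x") auto
  then show False using assms by (simp add: erf_erfinv)
qed

lemma std_normal_density_at_top: "(std_normal_density \<longlongrightarrow> 0) at_top"
proof (rule tendsto_sandwich)
  show "\<forall>\<^sub>F x in at_top. 0 \<le> std_normal_density x" by simp
  show "\<forall>\<^sub>F x in at_top. std_normal_density x \<le> inverse x"
    using eventually_gt_at_top[of 0]
  proof eventually_elim
    case (elim x)
    have "x \<le> 1 + x\<^sup>2 / 2" using sum_squares_ge_zero[of "x - 1" 0] by (simp add: power2_eq_square algebra_simps)
    also have "\<dots> \<le> exp (x\<^sup>2 / 2)" by (rule exp_ge_add_one_self)
    finally have "exp (- x\<^sup>2 / 2) \<le> inverse x" using elim by (simp add: exp_minus field_simps)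
    moreover have "1 \<le> sqrt (2 * pi)" using pi_gt3 by simp
    ultimately have "1 / sqrt (2 * pi) * exp (- x\<^sup>2 / 2) \<le> 1 * inverse x" by (intro mult_mono) auto
    then show ?case by (simp add: std_normal_density_def)
  qed
  show "((inverse :: real \<Rightarrow> real) \<longlongrightarrow> 0) at_top" by (rule tendsto_inverse_0_at_top) (rule filterlim_ident)
qed simp

text \<open>\<open>\<lambda>x. - std_normal_density x + t * gtail x\<close> is an antiderivative of
  \<open>(x - t) * std_normal_density x\<close> and tends to \<open>0\<close> at infinity. It links
  the probabilistic threshold equation with the closed formulas of the theorem.\<close>

lemma integral_stdn_pos_part: "(\<integral>x. max 0 (x - t) \<partial>stdn) = std_normal_density t - t * gtail t"
proof -
  let ?F = "\<lambda>x. - std_normal_density x + t * gtail x"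
  have "(\<integral>\<^sup>+x. ennreal ((x - t) * std_normal_density x) * indicator {t..} x \<partial>lborel) = ennreal (0 - ?F t)"
  proof (rule nn_integral_FTC_atLeast[where F="?F"])
    show "(?F has_real_derivative (x - t) * std_normal_density x) (at x)" for x
      by (auto intro!: derivative_eq_intros DERIV_std_normal_density DERIV_gtail simp: algebra_simps)
    have "(?F \<longlongrightarrow> - 0 + t * 0) at_top"
      by (intro tendsto_intros std_normal_density_at_top gtail_at_top)
    then show "(?F \<longlongrightarrow> 0) at_top" by simp
  qed auto
  also have "(\<integral>\<^sup>+x. ennreal ((x - t) * std_normal_density x) * indicator {t..} x \<partial>lborel)
      = (\<integral>\<^sup>+x. ennreal (max 0 (x - t)) \<partial>stdn)"
    by (subst nn_integral_density) (auto intro!: nn_integral_cong simp: indicator_def ennreal_mult'[symmetric] max_def mult.commute)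
  finally have e: "(\<integral>\<^sup>+x. ennreal (max 0 (x - t)) \<partial>stdn) = ennreal (std_normal_density t - t * gtail t)" by simp
  have nn: "0 \<le> std_normal_density t - t * gtail t"
  proof (cases "t \<le> 0")
    case True
    then have "t * gtail t \<le> 0" using gtail_bounds[of t] by (simp add: mult_nonpos_nonneg)
    then show ?thesis using normal_density_nonneg[of 0 1 t] by linarith
  next
    case False
    \<comment> \<open>The function \<open>\<lambda>x. std_normal_density x - t * gtail x\<close> decreases to \<open>0\<close> on \<open>{t..}\<close>.\<close>
    have "- 0 + t * 0 \<ge> ?F t"
    proof (rule tendsto_lowerbound)
      show "(?F \<longlongrightarrow> - 0 + t * 0) at_top" by (intro tendsto_intros std_normal_density_at_top gtail_at_top)
      show "\<forall>\<^sub>F x in at_top. ?F t \<le> ?F x"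
        using eventually_ge_at_top[of t]
      proof eventually_elim
        case (elim x)
        show ?case
        proof (rule DERIV_nonneg_imp_nondecreasing[OF elim])
          fix y assume "t \<le> y"
          then have "0 \<le> (y - t) * std_normal_density y" by simp
          moreover have "(?F has_real_derivative (y - t) * std_normal_density y) (at y)"
            by (auto intro!: derivative_eq_intros DERIV_std_normal_density DERIV_gtail simp: algebra_simps)
          ultimately show "\<exists>d. (?F has_real_derivative d) (at y) \<and> 0 \<le> d" by blast
        qed
      qed
    qed simp
    then show ?thesis by simp
  qed
  have "(\<integral>x. max 0 (x - t) \<partial>stdn) = enn2real (\<integral>\<^sup>+x. ennreal (max 0 (x - t)) \<partial>stdn)"
    by (rule integral_eq_nn_integral) auto
  then show ?thesis unfolding e using nn by simp
qed

section \<open>The threshold equation and the bound of the theorem\<close>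

locale threshold =
  fixes \<beta> :: real
  assumes beta: "0 < \<beta>" "\<beta> < 1"
begin

text \<open>\<open>Df\<close> is half the derivative in \<open>t\<close> of the normalised mean squared distance
  \<open>\<beta> * (1 + t\<^sup>2) + (1 - \<beta>) * E (max 0 (g - t))\<^sup>2\<close> of a Gaussian vector from the multiples by \<open>t\<close> in the polar cone.
  At its zero, the bound \<open>Bd\<close> of the theorem coincides with \<open>Th\<close>, the location of the phase transition.\<close>
definition "P t = (1 - \<beta>) * std_normal_density t"
definition "Th t = \<beta> + (1 - \<beta>) * gtail t"
definition "Df t = Th t * t - P t"
definition "Bd t = P t * t + Th t - (P t)\<^sup>2 / Th t"

lemma P_pos: "0 < P t" using beta by (simp add: P_def normal_density_pos)

lemma Th_pos: "0 < Th t" using beta gtail_bounds[of t] by (simp add: Th_def add_pos_nonneg)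

lemma DERIV_P: "(P has_real_derivative - t * P t) (at t)"
  unfolding P_def[abs_def] by (auto intro!: derivative_eq_intros DERIV_std_normal_density)

lemma DERIV_Th: "(Th has_real_derivative - P t) (at t)"
  unfolding Th_def[abs_def] P_def by (auto intro!: derivative_eq_intros DERIV_gtail)

lemma DERIV_Df: "(Df has_real_derivative Th t) (at t)"
  unfolding Df_def[abs_def] by (auto intro!: derivative_eq_intros DERIV_P DERIV_Th)

text \<open>The terms combine into a complete square that vanishes exactly at a zero of
  \<open>Df\<close>. So \<open>Bd\<close> is monotone, and on either side of the root it is an
  estimate of the transition in the right direction.\<close>

lemma DERIV_Bd: "(Bd has_real_derivative - P t * (t - P t / Th t)\<^sup>2) (at t)"
proof -
  have "- t * p * t + 1 * p + - p - ((- t * p * p + - t * p * p) * h - p * p * - p) / (h * h) = - p * (t - p / h)\<^sup>2"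
    if "h \<noteq> 0" for p h :: real
    using that by (simp add: field_simps power2_eq_square)
  note alg = this[of "Th t" "P t"]
  show ?thesis unfolding Bd_def[abs_def] power2_eq_square[of "P _"]
    by (rule DERIV_cong[OF DERIV_diff[OF DERIV_add[OF DERIV_mult[OF DERIV_P DERIV_ident] DERIV_Th]
          DERIV_divide[OF DERIV_mult[OF DERIV_P DERIV_P] DERIV_Th]] alg])
       (use Th_pos[of t] in auto)
qed

lemma Df_strict_mono: "x < y \<Longrightarrow> Df x < Df y"
  by (rule DERIV_pos_imp_increasing[of x y Df]) (auto intro!: exI DERIV_Df Th_pos)

lemma Bd_antimono: "x \<le> y \<Longrightarrow> Bd y \<le> Bd x"
proof (rule DERIV_nonpos_imp_nonincreasing[of x y Bd])
  fix z show "\<exists>d. (Bd has_real_derivative d) (at z) \<and> d \<le> 0"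
    using DERIV_Bd[of z] P_pos[of z] by (intro exI[of _ "- P z * (z - P z / Th z)\<^sup>2"]) (simp add: mult_nonneg_nonneg)
qed

lemma Df_eq: "Df t = \<beta> * t - (1 - \<beta>) * (\<integral>x. max 0 (x - t) \<partial>stdn)"
  by (simp add: integral_stdn_pos_part Df_def Th_def P_def algebra_simps)

lemma ex_root: obtains t where "0 < t" "Df t = 0" "Bd t = Th t"
proof -
  \<comment> \<open>Since \<open>P b \<le> 1\<close> and \<open>\<beta> \<le> Th b\<close>, any
    \<open>b\<close> with \<open>\<beta> * b > 1\<close> makes \<open>Df b\<close> positive.\<close>
  define b where "b = 1 / \<beta> + 1"
  have "Df 0 < 0" using P_pos[of 0] by (simp add: Df_def)
  moreover have "Df b > 0"
  proof -
    have "b > 0" using beta by (simp add: b_def add_pos_pos)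
    have "1 \<le> sqrt (2 * pi)" using pi_gt3 by simp
    then have "std_normal_density b \<le> 1" unfolding std_normal_density_def
      using mult_mono[of "1 / sqrt (2 * pi)" 1 "exp (- b\<^sup>2 / 2)" 1] by simp
    then have "P b \<le> 1 * 1" unfolding P_def using beta by (intro mult_mono) auto
    moreover have "\<beta> * b \<le> Th b * b" using \<open>b > 0\<close> beta gtail_bounds[of b] by (intro mult_right_mono) (auto simp: Th_def)
    moreover have "\<beta> * b > 1" using beta by (simp add: b_def field_simps)
    ultimately show ?thesis by (simp add: Df_def)
  qed
  moreover have "continuous_on {0..b} Df"
    by (rule DERIV_continuous_on[OF has_field_derivative_at_within[OF DERIV_Df]])
  moreover have "0 \<le> b" using beta by (simp add: b_def)
  ultimately obtain t where t: "0 \<le> t" "Df t = 0" using IVT'[of Df 0 0 b] by auto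
  have "t \<noteq> 0" using t \<open>Df 0 < 0\<close> by auto
  moreover have "Bd t = Th t"
  proof -
    have "P t = Th t * t" using t by (simp add: Df_def)
    then show ?thesis using Th_pos[of t] by (simp add: Bd_def power2_eq_square)
  qed
  ultimately show ?thesis using t by (intro that[of t]) auto
qed

lemma Th_isCont: "isCont Th t" using DERIV_Th by (rule DERIV_isCont)

text \<open>\<open>Df s < 0\<close> places \<open>s\<close> to the left of the root
  \<open>t\<close>, so \<open>Th t = Bd t \<le> Bd s < \<alpha>\<close>. Continuity allows a step to
  some \<open>t1\<close> left of the root while \<open>Th t1\<close> stays below \<alpha>;
  \<open>t2\<close> merely has to lie to the right of the root.\<close>

lemma above_threshold:
  assumes "Df s < 0" "Bd s < \<alpha>"
  shows "\<exists>t1 t2 a. 0 < t1 \<and> t1 < t2 \<and> Df t1 < 0 \<and> 0 < Df t2 \<and> Th t1 < a \<and> a < \<alpha>"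
proof -
  obtain t where t: "0 < t" "Df t = 0" "Bd t = Th t" by (rule ex_root)
  have "s < t" using assms(1) t(2) Df_strict_mono[of t s] by (cases "t < s"; cases "s = t") auto
  then have "Th t < \<alpha>" using Bd_antimono[of s t] t(3) assms(2) by simp
  have "eventually (\<lambda>x. Th x < \<alpha>) (at_left t)"
    using Th_isCont[of t] \<open>Th t < \<alpha>\<close> by (intro order_tendstoD(2)[of Th "Th t"]) (auto simp: isCont_def intro: tendsto_mono[OF at_le])
  moreover have "eventually (\<lambda>x. x \<in> {0<..<t}) (at_left t)" using t(1) by (rule eventually_at_left_real)
  ultimately have "eventually (\<lambda>x. Th x < \<alpha> \<and> x \<in> {0<..<t}) (at_left t)" by eventually_elim auto
  then obtain t1 where t1: "Th t1 < \<alpha>" "0 < t1" "t1 < t"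
    using eventually_happens'[of "at_left t"] by force
  obtain a where "Th t1 < a" "a < \<alpha>" using dense[OF t1(1)] by auto
  then show ?thesis using t1 t Df_strict_mono[of t1 t] Df_strict_mono[of t "t + 1"]
    by (intro exI[of _ t1] exI[of _ "t + 1"] exI[of _ a]) auto
qed

text \<open>The mirror image: \<open>s\<close> lies to the right of the root, the step goes to some
  \<open>t2\<close> with \<open>Th t2\<close> above \<alpha>, and \<open>t1\<close> is any positive
  number left of the root.\<close>

lemma below_threshold:
  assumes "0 < Df s" "\<alpha> < Bd s"
  shows "\<exists>t1 t2 a. 0 < t1 \<and> t1 < t2 \<and> Df t1 < 0 \<and> 0 < Df t2 \<and> a < Th t2 \<and> \<alpha> < a"
proof -
  obtain t where t: "0 < t" "Df t = 0" "Bd t = Th t" by (rule ex_root)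
  have "t < s" using assms(1) t(2) Df_strict_mono[of s t] by (cases "s < t"; cases "s = t") auto
  then have "\<alpha> < Th t" using Bd_antimono[of t s] t(3) assms(2) by simp
  have "eventually (\<lambda>x. \<alpha> < Th x) (at_right t)"
    using Th_isCont[of t] \<open>\<alpha> < Th t\<close> by (intro order_tendstoD(1)[of Th "Th t"]) (auto simp: isCont_def intro: tendsto_mono[OF at_le])
  moreover have "eventually (\<lambda>x. x \<in> {t<..<t + 1}) (at_right t)" by (rule eventually_at_right_real) simp
  ultimately have "eventually (\<lambda>x. \<alpha> < Th x \<and> x \<in> {t<..<t + 1}) (at_right t)" by eventually_elim auto
  then obtain t2 where t2: "\<alpha> < Th t2" "t < t2"
    using eventually_happens'[of "at_right t"] by force
  obtain a where "\<alpha> < a" "a < Th t2" using dense[OF t2(1)] by auto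
  then show ?thesis using t2 t Df_strict_mono[of t t2] Df_strict_mono[of "t / 2" t]
    by (intro exI[of _ "t / 2"] exI[of _ t2] exI[of _ a]) auto
qed

text \<open>The substitution \<open>t = sqrt 2 * gw \<beta> \<theta>\<close> is the inverse of
  \<open>Th\<close>, so that \<theta> becomes the limiting fraction of entries in the face. The
  absolute value stems from the square root of a square in the bound.\<close>

lemma gw_facts:
  assumes "\<bar>2 * (1 - \<theta>) / (1 - \<beta>) - 1\<bar> < 1"
  defines "t \<equiv> sqrt 2 * gw \<beta> \<theta>"
  shows "Th t = \<theta>" "P t = (1 - \<beta>) * sqrt (1 / (2 * pi)) * exp (- (gw \<beta> \<theta>)\<^sup>2)"
    and "sqrt (2 * (gw \<beta> \<theta>)\<^sup>2) = \<bar>t\<bar>" "0 < 1 - \<theta>"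
    "(1 - \<beta>) / sqrt (2 * pi) * sqrt (2 * (gw \<beta> \<theta>)\<^sup>2) / exp ((gw \<beta> \<theta>)\<^sup>2) = P t * \<bar>t\<bar>"
proof -
  define x where "x = (1 - \<theta>) / (1 - \<beta>)"
  have x: "2 * (1 - \<theta>) / (1 - \<beta>) - 1 = 2 * x - 1" by (simp add: x_def)
  have "erf (gw \<beta> \<theta>) = 2 * x - 1"
    using erf_erfinv[OF assms(1)] unfolding gw_def x .
  then have "gtail t = (1 - (2 * x - 1)) / 2" by (simp add: gtail_eq_erf t_def)
  then have "gtail t = 1 - x" by simp
  then have "gtail t = 1 - (1 - \<theta>) / (1 - \<beta>)" unfolding x_def .
  then have "Th t = \<beta> + (1 - \<beta>) * (1 - (1 - \<theta>) / (1 - \<beta>))" by (simp add: Th_def)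
  moreover have "(1 - \<beta>) * ((1 - \<theta>) / (1 - \<beta>)) = 1 - \<theta>" using beta by simp
  ultimately show "Th t = \<theta>" by (simp only: right_diff_distrib[of "1 - \<beta>"] mult_1_right)
  show P: "P t = (1 - \<beta>) * sqrt (1 / (2 * pi)) * exp (- (gw \<beta> \<theta>)\<^sup>2)"
    by (simp add: P_def std_normal_density_def t_def power_mult_distrib real_sqrt_divide)
  show tt: "sqrt (2 * (gw \<beta> \<theta>)\<^sup>2) = \<bar>t\<bar>" by (simp add: t_def real_sqrt_mult abs_mult)
  have "0 < 2 * (1 - \<theta>) / (1 - \<beta>)" using assms(1) by auto
  then show "0 < 1 - \<theta>" using beta by (simp add: zero_less_divide_iff)
  show "(1 - \<beta>) / sqrt (2 * pi) * sqrt (2 * (gw \<beta> \<theta>)\<^sup>2) / exp ((gw \<beta> \<theta>)\<^sup>2) = P t * \<bar>t\<bar>"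
    unfolding tt P by (simp add: exp_minus real_sqrt_divide field_simps)
qed

text \<open>Only the direction of the perturbation matters. The larger argument of
  \<open>erfinv\<close> gives \<open>t < (1 - \<epsilon>) * P t / Th t\<close>, which is below
  \<open>P t / Th t\<close>; so \<open>t\<close> lies to the left of the root.\<close>

lemma theta_eq_part1:
  assumes \<epsilon>: "0 < \<epsilon>" "\<epsilon> < 1" and sol: "theta_eq_solution \<epsilon> \<epsilon> \<beta> \<theta>"
    and \<alpha>: "\<alpha> > (1 - \<beta>) / sqrt (2 * pi) * sqrt (2 * (gw \<beta> \<theta>)\<^sup>2) / exp ((gw \<beta> \<theta>)\<^sup>2) + \<theta>
           - ((1 - \<beta>) * sqrt (1 / (2 * pi)) * exp (- (gw \<beta> \<theta>)\<^sup>2))\<^sup>2 / \<theta>"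
  shows "\<exists>s. Df s < 0 \<and> Bd s < \<alpha>"
proof -
  define t where "t = sqrt 2 * gw \<beta> \<theta>"
  define y' where "y' = 2 * ((1 + \<epsilon>) * (1 - \<theta>)) / (1 - \<beta>) - 1"
  have y: "\<bar>2 * (1 - \<theta>) / (1 - \<beta>) - 1\<bar> < 1" "\<bar>y'\<bar> < 1"
    and eq: "(1 - \<epsilon>) * (1 - \<beta>) * (sqrt (1 / (2 * pi)) * exp (- (gw \<beta> \<theta>)\<^sup>2)) / \<theta> = sqrt 2 * erfinv y'"
    using sol by (auto simp: theta_eq_solution_def y'_def)
  note g = gw_facts[OF y(1), folded t_def]
  have "1 * (1 - \<theta>) < (1 + \<epsilon>) * (1 - \<theta>)" using g(4) \<epsilon> by (intro mult_strict_right_mono) auto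
  then have "2 * (1 - \<theta>) / (1 - \<beta>) < 2 * ((1 + \<epsilon>) * (1 - \<theta>)) / (1 - \<beta>)"
    using beta by (intro divide_strict_right_mono) auto
  then have "2 * (1 - \<theta>) / (1 - \<beta>) - 1 < y'" unfolding y'_def by linarith
  then have "t < sqrt 2 * erfinv y'" using erfinv_less[OF y] by (simp add: t_def gw_def)
  also have "\<dots> = (1 - \<epsilon>) * P t / Th t" using eq unfolding g(1,2) by (simp add: mult.assoc)
  also have "\<dots> \<le> P t / Th t" using \<epsilon> P_pos[of t] Th_pos[of t] by (intro divide_right_mono) (auto simp: mult_left_le_one_le)
  finally have "t * Th t < P t" using Th_pos[of t] by (simp add: field_simps)
  then have "Df t < 0" by (simp add: Df_def mult.commute)
  moreover have "Bd t < \<alpha>"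
  proof -
    \<comment> \<open>For negative \<open>t\<close> the absolute value in the hypothesis only
      enlarges the bound that \<alpha> exceeds.\<close>
    have "P t * t \<le> P t * \<bar>t\<bar>" using P_pos[of t] by (intro mult_left_mono) auto
    then show ?thesis using \<alpha> unfolding g(5) g(2)[symmetric] Bd_def g(1) by linarith
  qed
  ultimately show ?thesis by auto
qed

text \<open>Both perturbations now push \<open>t\<close> to the right of the root, since
  \<open>t > (1 + \<epsilon>) * P t / Th t\<close>. In particular \<open>t\<close> is positive and
  the absolute value disappears; the remaining constants only lower the bound.\<close>

lemma theta_eq_part2:
  assumes \<epsilon>: "0 < \<epsilon>" "\<epsilon> < 1" and sol: "theta_eq_solution (- \<epsilon>) (- \<epsilon>) \<beta> \<theta>"
    and e: "0 < \<epsilon>1" "0 < \<epsilon>2" "\<epsilon>2 < 1" "0 < \<epsilon>3" and \<alpha>0: "0 < \<alpha>"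
    and \<alpha>: "\<alpha> < 1 / (1 + \<epsilon>1)\<^sup>2 *
           ((1 - \<epsilon>2) * (\<theta> + (1 - \<beta>) / sqrt (2 * pi) * sqrt (2 * (gw \<beta> \<theta>)\<^sup>2) / exp ((gw \<beta> \<theta>)\<^sup>2))
            - (1 + \<epsilon>3)\<^sup>2 * ((1 - \<beta>) * sqrt (1 / (2 * pi)) * exp (- (gw \<beta> \<theta>)\<^sup>2))\<^sup>2 / \<theta>)"
  shows "\<exists>s. 0 < Df s \<and> \<alpha> < Bd s"
proof -
  define t where "t = sqrt 2 * gw \<beta> \<theta>"
  define y' where "y' = 2 * ((1 - \<epsilon>) * (1 - \<theta>)) / (1 - \<beta>) - 1"
  have y: "\<bar>2 * (1 - \<theta>) / (1 - \<beta>) - 1\<bar> < 1" "\<bar>y'\<bar> < 1"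
    and eq: "(1 + \<epsilon>) * (1 - \<beta>) * (sqrt (1 / (2 * pi)) * exp (- (gw \<beta> \<theta>)\<^sup>2)) / \<theta> = sqrt 2 * erfinv y'"
    using sol by (auto simp: theta_eq_solution_def y'_def)
  note g = gw_facts[OF y(1), folded t_def]
  have "(1 - \<epsilon>) * (1 - \<theta>) < 1 * (1 - \<theta>)" using g(4) \<epsilon> by (intro mult_strict_right_mono) auto
  then have "2 * ((1 - \<epsilon>) * (1 - \<theta>)) / (1 - \<beta>) < 2 * (1 - \<theta>) / (1 - \<beta>)"
    using beta by (intro divide_strict_right_mono) auto
  then have "y' < 2 * (1 - \<theta>) / (1 - \<beta>) - 1" unfolding y'_def by linarith
  then have "sqrt 2 * erfinv y' < t" using erfinv_less[OF y(2,1)] by (simp add: t_def gw_def)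
  moreover have "sqrt 2 * erfinv y' = (1 + \<epsilon>) * P t / Th t" using eq unfolding g(1,2) by (simp add: mult.assoc)
  moreover have "P t / Th t \<le> (1 + \<epsilon>) * P t / Th t" using \<epsilon> P_pos[of t] Th_pos[of t] by (intro divide_right_mono) auto
  ultimately have lt: "P t / Th t < t" by linarith
  then have "P t < t * Th t" using Th_pos[of t] by (simp add: field_simps)
  then have "Df t > 0" by (simp add: Df_def mult.commute)
  have "0 < P t / Th t" using P_pos[of t] Th_pos[of t] by simp
  then have t0: "t > 0" using lt by linarith
  define W where "W = (1 - \<epsilon>2) * (Th t + P t * t) - (1 + \<epsilon>3)\<^sup>2 * (P t)\<^sup>2 / Th t"
  have aW: "\<alpha> < 1 / (1 + \<epsilon>1)\<^sup>2 * W" using \<alpha> t0 unfolding g(5) g(2)[symmetric] W_def g(1) by simp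
  have "(1 + \<epsilon>1)\<^sup>2 \<ge> 1" using e by (simp add: one_le_power)
  then have "0 < (1 + \<epsilon>1)\<^sup>2" by linarith
  \<comment> \<open>Positivity of \<alpha> forces \<open>W\<close> to be positive, and only then
    does division by \<open>(1 + \<epsilon>1)\<^sup>2\<close> make it smaller.\<close>
  have "0 < 1 / (1 + \<epsilon>1)\<^sup>2 * W" using aW \<alpha>0 by linarith
  then have "0 < W" using \<open>0 < (1 + \<epsilon>1)\<^sup>2\<close> by (simp add: zero_less_divide_iff)
  then have "1 / (1 + \<epsilon>1)\<^sup>2 * W \<le> 1 * W" using \<open>(1 + \<epsilon>1)\<^sup>2 \<ge> 1\<close> \<open>0 < (1 + \<epsilon>1)\<^sup>2\<close>
    by (intro mult_right_mono) (auto simp: divide_le_eq_1_pos)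
  moreover have "W \<le> Bd t"
  proof -
    have "(1 - \<epsilon>2) * (Th t + P t * t) \<le> Th t + P t * t"
      using e P_pos[of t] Th_pos[of t] t0 by (intro mult_left_le_one_le) auto
    moreover have "1 * (P t)\<^sup>2 / Th t \<le> (1 + \<epsilon>3)\<^sup>2 * (P t)\<^sup>2 / Th t"
      using e Th_pos[of t] by (intro divide_right_mono mult_right_mono) (auto simp: one_le_power)
    ultimately show ?thesis unfolding W_def Bd_def by simp
  qed
  ultimately have "\<alpha> < Bd t" using aW by linarith
  then show ?thesis using \<open>Df t > 0\<close> by auto
qed

end

section \<open>Recovery and the kernel\<close>

definition cone_kernel :: "'a set \<Rightarrow> 'b set \<Rightarrow> 'b set \<Rightarrow> ('a \<times> 'b \<Rightarrow> real) \<Rightarrow> bool" where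
  "cone_kernel M N S A \<longleftrightarrow> (\<exists>v. cone_vec N S v \<and> (\<exists>i\<in>N. v i \<noteq> 0) \<and> (\<forall>l\<in>M. inner_on N (\<lambda>i. A (l, i)) v = 0))"

text \<open>Representatives of the rays of the cone. Normalisation and the value \<open>0\<close>
  off \<open>N\<close> make the set compact in the product topology on all functions.\<close>

definition cone_base :: "'b set \<Rightarrow> 'b set \<Rightarrow> ('b \<Rightarrow> real) set" where
  "cone_base N S = {v. cone_vec N S v \<and> (\<Sum>i\<in>N. \<bar>v i\<bar>) = 1 \<and> (\<forall>i. i \<notin> N \<longrightarrow> v i = 0)}"

lemma cone_kernel_iff_base:
  assumes N: "finite N"
  shows "cone_kernel M N S A \<longleftrightarrow> (\<exists>v\<in>cone_base N S. \<forall>l\<in>M. inner_on N (\<lambda>i. A (l, i)) v = 0)"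
proof
  assume "cone_kernel M N S A"
  then obtain v i where v: "cone_vec N S v" "i \<in> N" "v i \<noteq> 0" "\<forall>l\<in>M. inner_on N (\<lambda>i. A (l, i)) v = 0"
    unfolding cone_kernel_def by blast
  define c where "c = 1 / (\<Sum>i\<in>N. \<bar>v i\<bar>)"
  have "0 < (\<Sum>i\<in>N. \<bar>v i\<bar>)" using N v(2,3) by (intro sum_pos2[of N i]) auto
  then have c: "c > 0" "c * (\<Sum>i\<in>N. \<bar>v i\<bar>) = 1" by (auto simp: c_def)
  define w where "w = (\<lambda>i. if i \<in> N then c * v i else 0)"
  have "(\<Sum>i\<in>N. w i) = c * (\<Sum>i\<in>N. v i)" by (simp add: w_def sum_distrib_left)
  then have "cone_vec N S w" using v(1) c(1) by (auto simp: cone_vec_def w_def mult_le_0_iff)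
  moreover have "(\<Sum>i\<in>N. \<bar>w i\<bar>) = 1" using c by (simp add: w_def abs_mult sum_distrib_left)
  moreover have "inner_on N (\<lambda>i. A (l, i)) w = c * inner_on N (\<lambda>i. A (l, i)) v" for l
    unfolding inner_on_scale_right[symmetric] by (intro inner_on_cong) (auto simp: w_def)
  ultimately show "\<exists>v\<in>cone_base N S. \<forall>l\<in>M. inner_on N (\<lambda>i. A (l, i)) v = 0"
    using v(4) by (intro bexI[of _ w]) (auto simp: cone_base_def w_def)
next
  assume "\<exists>v\<in>cone_base N S. \<forall>l\<in>M. inner_on N (\<lambda>i. A (l, i)) v = 0"
  then obtain v where v: "v \<in> cone_base N S" "\<forall>l\<in>M. inner_on N (\<lambda>i. A (l, i)) v = 0" by blast
  have "\<exists>i\<in>N. v i \<noteq> 0"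
  proof (rule ccontr)
    assume "\<not> (\<exists>i\<in>N. v i \<noteq> 0)"
    then have "(\<Sum>i\<in>N. \<bar>v i\<bar>) = 0" by simp
    then show False using v(1) by (simp add: cone_base_def)
  qed
  then show "cone_kernel M N S A" using v by (auto simp: cone_kernel_def cone_base_def)
qed

lemma closed_Collect_ball:
  assumes "\<And>x. x \<in> X \<Longrightarrow> closed {y. P x y}"
  shows "closed {y. \<forall>x\<in>X. P x y}"
proof -
  have "{y. \<forall>x\<in>X. P x y} = (\<Inter>x\<in>X. {y. P x y})" by auto
  then show ?thesis using assms by auto
qed

lemma compact_cone_base:
  fixes N S :: "'b set"
  assumes N: "finite N"
  shows "compact (cone_base N S)"
proof -
  define B where "B = (\<Pi>\<^sub>E i\<in>UNIV. if i \<in> N then {- 1..1 :: real} else {0})"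
  have "compactin (product_topology (\<lambda>i. euclidean) UNIV) B"
    unfolding B_def compactin_PiE by (auto simp: compactin_euclidean_iff)
  then have cB: "compact B" by (simp add: euclidean_product_topology compactin_euclidean_iff)
  have "closed {v :: 'b \<Rightarrow> real. (\<forall>i\<in>N - S. 0 \<le> v i) \<and> (\<Sum>i\<in>N. v i) \<le> 0 \<and> (\<Sum>i\<in>N. \<bar>v i\<bar>) = 1}"
    using N by (intro closed_Collect_conj closed_Collect_ball closed_Collect_le closed_Collect_eq
        continuous_intros continuous_on_product_coordinates)
  moreover have "cone_base N S = B \<inter> {v :: 'b \<Rightarrow> real. (\<forall>i\<in>N - S. 0 \<le> v i) \<and> (\<Sum>i\<in>N. v i) \<le> 0 \<and> (\<Sum>i\<in>N. \<bar>v i\<bar>) = 1}"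
  proof (intro equalityI subsetI)
    fix v assume v: "v \<in> cone_base N S"
    have "\<bar>v i\<bar> \<le> 1" if "i \<in> N" for i
      using member_le_sum[of i N "\<lambda>i. \<bar>v i\<bar>"] v N that by (simp add: cone_base_def)
    then have "v \<in> B" using v by (force simp: B_def cone_base_def abs_le_iff)
    then show "v \<in> B \<inter> {v :: 'b \<Rightarrow> real. (\<forall>i\<in>N - S. 0 \<le> v i) \<and> (\<Sum>i\<in>N. v i) \<le> 0 \<and> (\<Sum>i\<in>N. \<bar>v i\<bar>) = 1}"
      using v by (simp add: cone_base_def cone_vec_def)
  next
    fix v assume v: "v \<in> B \<inter> {v :: 'b \<Rightarrow> real. (\<forall>i\<in>N - S. 0 \<le> v i) \<and> (\<Sum>i\<in>N. v i) \<le> 0 \<and> (\<Sum>i\<in>N. \<bar>v i\<bar>) = 1}"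
    then have "v i = 0" if "i \<notin> N" for i using that by (force simp: B_def PiE_iff split: if_splits)
    then show "v \<in> cone_base N S" using v by (simp add: cone_base_def cone_vec_def)
  qed
  ultimately show ?thesis using cB by (simp add: compact_Int_closed)
qed

text \<open>The quantifier over vectors is uncountable, so measurability is not immediate. Over the
  compact base the relation is closed, and projecting away a compact factor preserves
  closedness.\<close>

lemma closed_cone_kernel:
  fixes M :: "'a set" and N S :: "'b set"
  assumes "finite M" "finite N"
  shows "closed {A :: 'a \<times> 'b \<Rightarrow> real. cone_kernel M N S A}"
proof -
  define K where "K = cone_base N S"
  define C where "C = {p :: ('b \<Rightarrow> real) \<times> ('a \<times> 'b \<Rightarrow> real). \<forall>l\<in>M. inner_on N (\<lambda>i. snd p (l, i)) (fst p) = 0}"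
  have "closed C"
    unfolding C_def inner_on_def using assms
    by (intro closed_Collect_ball closed_Collect_eq continuous_intros
        continuous_on_compose2[OF continuous_on_product_coordinates continuous_on_fst[OF continuous_on_id]]
        continuous_on_compose2[OF continuous_on_product_coordinates continuous_on_snd[OF continuous_on_id]]) auto
  then have "closedin (top_of_set (K \<times> UNIV)) ((K \<times> UNIV) \<inter> C)" by (rule closedin_closed_Int)
  then have cl: "closedin (prod_topology (top_of_set K) (euclidean :: ('a \<times> 'b \<Rightarrow> real) topology)) ((K \<times> UNIV) \<inter> C)"
    by (simp add: subtopology_Times[symmetric] prod_topology_subtopology)
  have "compact_space (top_of_set K)"
    using compact_cone_base[OF assms(2)] by (simp add: K_def compact_space_subtopology compactin_euclidean_iff)
  then have "closed_map (prod_topology (top_of_set K) (euclidean :: ('a \<times> 'b \<Rightarrow> real) topology)) euclidean snd"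
    by (rule closed_map_snd)
  with cl have "closedin (euclidean :: ('a \<times> 'b \<Rightarrow> real) topology) (snd ` ((K \<times> UNIV) \<inter> C))"
    unfolding closed_map_def by blast
  moreover have "snd ` ((K \<times> UNIV) \<inter> C) = {A. cone_kernel M N S A}"
    unfolding cone_kernel_iff_base[OF assms(2)] K_def C_def by (force simp: image_iff)
  ultimately show ?thesis by simp
qed

lemma measurable_cone_kernel:
  fixes M N :: "nat set"
  assumes "finite M" "finite N"
  shows "{A \<in> space (gauss (M \<times> N)). cone_kernel M N S A} \<in> sets (gauss (M \<times> N))"
proof -
  let ?G = "gauss (M \<times> N)"
  \<comment> \<open>The Borel sets are those of the full function space, so entries outside
    \<open>M \<times> N\<close> have to be covered too; on \<open>space ?G\<close> they are
    constantly \<open>undefined\<close>.\<close>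
  have "(\<lambda>A. A p) \<in> borel_measurable ?G" for p
  proof (cases "p \<in> M \<times> N")
    case True
    then show ?thesis unfolding measurable_gauss_cong by simp
  next
    case False
    have "(\<lambda>A. undefined :: real) \<in> borel_measurable ?G" by simp
    then show ?thesis
      by (rule measurable_cong[THEN iffD1, rotated]) (metis False extensional_arb space_gauss)
  qed
  then have m: "(\<lambda>A. A) \<in> borel_measurable ?G" by (rule measurable_coordinatewise_then_product)
  have "{A. cone_kernel M N S A} \<in> sets borel" using closed_cone_kernel[OF assms] by (rule borel_closed)
  from measurable_sets[OF m this] have "(\<lambda>A. A) -` {A. cone_kernel M N S A} \<inter> space ?G \<in> sets ?G" .
  moreover have "(\<lambda>A. A) -` {A. cone_kernel M N S A} \<inter> space ?G = {A \<in> space ?G. cone_kernel M N S A}" by auto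
  ultimately show ?thesis by simp
qed

section \<open>From the kernel to the minimisation problem\<close>

lemma matvec_eq_inner_on: "matvec n A u l = inner_on {0..<n} (\<lambda>i. A (l, i)) u"
  by (simp add: matvec_def inner_on_def atLeast0LessThan)

lemma cone_kernel_imp_not_unique:
  assumes S: "S \<subseteq> {0..<n}" and ker: "cone_kernel {0..<m} {0..<n} S A"
  shows "\<exists>x. (\<forall>i<n. i \<notin> S \<longrightarrow> x i = 0) \<and> (\<forall>i\<in>S. 0 < x i) \<and> \<not> unique_pos_l1_solution m n A x"
proof -
  obtain v i0 where ker': "cone_vec {0..<n} S v" "\<forall>l\<in>{0..<m}. inner_on {0..<n} (\<lambda>i. A (l, i)) v = 0"
    and i0: "i0 \<in> {0..<n}" "v i0 \<noteq> 0"
    using ker unfolding cone_kernel_def by blast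
  have v: "\<And>i. i \<in> {0..<n} - S \<Longrightarrow> 0 \<le> v i" "(\<Sum>i\<in>{0..<n}. v i) \<le> 0" "i0 < n" "v i0 \<noteq> 0"
    "\<And>l. l < m \<Longrightarrow> inner_on {0..<n} (\<lambda>i. A (l, i)) v = 0"
    using ker' i0 by (auto simp: cone_vec_def)
  \<comment> \<open>\<open>1 + \<bar>v i\<bar>\<close> is positive and at least
    \<open>- v i\<close>, so the competitor \<open>x + v\<close> is nonnegative on
    \<open>S\<close>.\<close>
  define x where "x = (\<lambda>i. if i \<in> S then 1 + \<bar>v i\<bar> else 0)"
  define u where "u = (\<lambda>i. x i + v i)"
  have x0: "0 \<le> x i" for i by (simp add: x_def)
  have u0: "0 \<le> u i" if "i < n" for i using v(1)[of i] that by (auto simp: u_def x_def)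
  have "matvec n A u l = matvec n A x l" if "l < m" for l
    unfolding matvec_eq_inner_on u_def inner_on_add_right v(5)[OF that] by simp
  moreover have "l1norm n u \<le> l1norm n x"
  proof -
    have "l1norm n u = (\<Sum>i<n. x i + v i)" unfolding l1norm_def using u0 by (intro sum.cong) (auto simp: u_def)
    also have "\<dots> = (\<Sum>i<n. x i) + (\<Sum>i<n. v i)" by (rule sum.distrib)
    also have "\<dots> \<le> (\<Sum>i<n. x i)" using v(2) by (simp add: atLeast0LessThan)
    also have "\<dots> = l1norm n x" by (simp add: l1norm_def x0)
    finally show ?thesis .
  qed
  moreover have "u i0 \<noteq> x i0" using v(4) by (simp add: u_def)
  ultimately have "(\<forall>i<n. 0 \<le> u i) \<and> (\<forall>i<m. matvec n A u i = matvec n A x i) \<and> (\<exists>i<n. u i \<noteq> x i)"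
    and le: "\<not> l1norm n x < l1norm n u"
    using u0 v(3) by auto
  then have "\<not> unique_pos_l1_solution m n A x"
    unfolding unique_pos_l1_solution_def by blast
  then show ?thesis by (intro exI[of _ x]) (auto simp: x_def)
qed

lemma not_unique_imp_cone_kernel:
  assumes S: "S \<subseteq> {0..<n}" and x: "\<And>i. i < n \<Longrightarrow> i \<notin> S \<Longrightarrow> x i = 0" "\<And>i. i \<in> S \<Longrightarrow> 0 \<le> x i"
    and nu: "\<not> unique_pos_l1_solution m n A x"
  shows "cone_kernel {0..<m} {0..<n} S A"
proof -
  have x0: "0 \<le> x i" if "i < n" for i using x[of i] that by (cases "i \<in> S") auto
  then obtain u i0 where u': "\<forall>i<n. 0 \<le> u i" "\<forall>i<m. matvec n A u i = matvec n A x i" "i0 < n" "u i0 \<noteq> x i0"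
      "\<not> l1norm n x < l1norm n u"
    using nu unfolding unique_pos_l1_solution_def by blast
  have u: "\<And>i. i < n \<Longrightarrow> 0 \<le> u i" "\<And>l. l < m \<Longrightarrow> matvec n A u l = matvec n A x l"
    "i0 < n" "u i0 \<noteq> x i0" "l1norm n u \<le> l1norm n x"
    using u' by auto
  define v where "v = (\<lambda>i. u i - x i)"
  have "(\<Sum>i\<in>{0..<n}. v i) \<le> 0"
    using u(5,1) x0 by (simp add: v_def sum_subtractf l1norm_def atLeast0LessThan)
  moreover have "0 \<le> v i" if "i \<in> {0..<n} - S" for i using u(1)[of i] x(1)[of i] that by (auto simp: v_def)
  moreover have "inner_on {0..<n} (\<lambda>i. A (l, i)) v = 0" if "l < m" for l
    using u(2)[OF that] unfolding matvec_eq_inner_on v_def inner_on_diff_right by simp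
  moreover have "v i0 \<noteq> 0" using u(4) by (simp add: v_def)
  ultimately show ?thesis unfolding cone_kernel_def cone_vec_def using u(3) by (intro exI[of _ v]) auto
qed

text \<open>The kernel event governs nonnegative vectors here and strictly positive ones in the
  companion below: a kernel vector always yields a counterexample positive on \<open>S\<close>, and
  conversely nonnegativity on \<open>S\<close> is enough to produce a kernel vector.\<close>

lemma all_unique_iff:
  assumes S: "S \<subseteq> {0..<n}"
  shows "(\<forall>x. (\<forall>i<n. i \<notin> S \<longrightarrow> x i = 0) \<and> (\<forall>i\<in>S. 0 \<le> x i) \<longrightarrow> unique_pos_l1_solution m n A x)
    \<longleftrightarrow> \<not> cone_kernel {0..<m} {0..<n} S A" (is "?L \<longleftrightarrow> _")
proof
  assume L: ?L
  show "\<not> cone_kernel {0..<m} {0..<n} S A"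
  proof
    assume "cone_kernel {0..<m} {0..<n} S A"
    from cone_kernel_imp_not_unique[OF S this] obtain x where
      "\<forall>i<n. i \<notin> S \<longrightarrow> x i = 0" "\<forall>i\<in>S. 0 < x i" "\<not> unique_pos_l1_solution m n A x" by blast
    then show False using L less_imp_le by blast
  qed
next
  assume "\<not> cone_kernel {0..<m} {0..<n} S A"
  then show ?L using not_unique_imp_cone_kernel[OF S] by blast
qed

lemma ex_not_unique_iff:
  assumes S: "S \<subseteq> {0..<n}"
  shows "(\<exists>x. (\<forall>i<n. i \<notin> S \<longrightarrow> x i = 0) \<and> (\<forall>i\<in>S. 0 < x i) \<and> \<not> unique_pos_l1_solution m n A x)
    \<longleftrightarrow> cone_kernel {0..<m} {0..<n} S A" (is "?L \<longleftrightarrow> _")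
proof
  assume ?L
  then obtain x where x: "\<forall>i<n. i \<notin> S \<longrightarrow> x i = 0" "\<forall>i\<in>S. 0 < x i" "\<not> unique_pos_l1_solution m n A x" by blast
  show "cone_kernel {0..<m} {0..<n} S A"
    using x by (intro not_unique_imp_cone_kernel[OF S _ _ x(3)]) (auto intro: less_imp_le)
qed (rule cone_kernel_imp_not_unique[OF S])

section \<open>The two regimes around the transition\<close>

lemma nat_floor_bounds:
  assumes "0 \<le> x"
  shows "x - 1 < real (nat \<lfloor>x\<rfloor>)" "real (nat \<lfloor>x\<rfloor>) \<le> x"
proof -
  have "real (nat \<lfloor>x\<rfloor>) = of_int \<lfloor>x\<rfloor>" using assms by (simp add: of_nat_nat)
  then show "x - 1 < real (nat \<lfloor>x\<rfloor>)" "real (nat \<lfloor>x\<rfloor>) \<le> x" by linarith+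
qed

lemma trivial_kernel_overwhelming:
  fixes \<alpha> \<beta> t1 t2 a :: real
  assumes \<alpha>: "0 < \<alpha>" and \<beta>: "0 < \<beta>" "\<beta> < 1" and t: "0 < t1" "t1 < t2"
    and D: "\<beta> * t1 - (1 - \<beta>) * (\<integral>x. max 0 (x - t1) \<partial>stdn) < 0"
      "0 < \<beta> * t2 - (1 - \<beta>) * (\<integral>x. max 0 (x - t2) \<partial>stdn)"
    and a: "\<beta> + (1 - \<beta>) * measure stdn {t1<..} < a" "a < \<alpha>"
  shows "\<exists>c>0. \<exists>N. \<forall>n\<ge>N. \<forall>S. S \<subseteq> {0..<n} \<and> card S = nat \<lfloor>\<beta> * real n\<rfloor> \<longrightarrow>
     1 - exp (- c * real n) \<le> measure (gauss ({0..<nat \<lfloor>\<alpha> * real n\<rfloor>} \<times> {0..<n}))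
       {A \<in> space (gauss ({0..<nat \<lfloor>\<alpha> * real n\<rfloor>} \<times> {0..<n})). \<not> cone_kernel {0..<nat \<lfloor>\<alpha> * real n\<rfloor>} {0..<n} S A}"
proof -
  \<comment> \<open>Here the face dimension has to be bounded from above; \<open>- 1\<close> is a
    lower bound that every face satisfies.\<close>
  have "(- 1) < \<beta> + (1 - \<beta>) * measure stdn {t2<..}" 
    using \<beta> measure_nonneg[of stdn "{t2<..}"] by (smt (verit) mult_nonneg_nonneg)
  from face_cells_cover[OF \<beta> t D a(1) this, where 'a=nat] obtain c n0 where c: "c > 0"
    and cov: "\<forall>n\<ge>n0. \<forall>T S. finite T \<and> S \<subseteq> T \<and> S \<noteq> {} \<and> \<bar>real (card T) - real n\<bar> \<le> 1 \<and> \<bar>real (card S) - \<beta> * real n\<bar> \<le> 2 \<longrightarrow>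
     1 - exp (- c * real n) \<le> measure (gauss T) {g \<in> space (gauss T).
        \<exists>J\<in>{J :: nat set. J \<subseteq> T - S \<and> (- 1 :: real) * card T < card (S \<union> J) \<and> card (S \<union> J) < a * card T}. face_cell T S J g}"
    by (elim exE conjE) (rule that)
  \<comment> \<open>\<open>n1\<close> makes the gap \<open>(\<alpha> - a) * n\<close> absorb the
    rounding of the number of rows; \<open>n2\<close> and \<open>n3\<close> guarantee two elements
    of \<open>S\<close> and two rows.\<close>
  obtain n1 :: nat where n1: "1 / (\<alpha> - a) \<le> n1" using real_arch_simple by blast
  obtain n2 :: nat where n2: "3 / \<beta> \<le> n2" using real_arch_simple by blast
  obtain n3 :: nat where n3: "2 / \<alpha> \<le> n3" using real_arch_simple by blast
  show ?thesis
  proof (intro exI[of _ c] conjI c exI[of _ "max (max n0 n1) (max n2 n3)"] allI impI)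
    fix n S assume n: "max (max n0 n1) (max n2 n3) \<le> n" and S': "S \<subseteq> {0..<n} \<and> card S = nat \<lfloor>\<beta> * real n\<rfloor>"
    define m where "m = nat \<lfloor>\<alpha> * real n\<rfloor>"
    have S: "S \<subseteq> {0..<n}" and cS: "\<beta> * n - 1 < card S" "card S \<le> \<beta> * n"
      using S' nat_floor_bounds[of "\<beta> * n"] \<beta> by auto
    have mb: "\<alpha> * n - 1 < m" using nat_floor_bounds[of "\<alpha> * n"] \<alpha> by (simp add: m_def)
    have "3 / \<beta> \<le> n" using n2 n by linarith
    then have "3 \<le> \<beta> * n" using \<beta> by (simp add: field_simps)
    then have S2: "2 \<le> card S" using cS by linarith
    have "2 / \<alpha> \<le> n" using n3 n by linarith
    then have "2 \<le> \<alpha> * n" using \<alpha> by (simp add: field_simps)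
    then have "m > 1" using mb by linarith
    \<comment> \<open>The last row becomes the objective and the others form \<open>D\<close>. The
      condition \<open>card (S \<union> J) \<le> Suc (card D)\<close> is thus a comparison with the
      number \<open>m\<close> of all rows.\<close>
    define p where "p = m - 1"
    define D where "D = {0..<p}"
    have Dp: "insert p D = {0..<m}" "p \<notin> D" "finite D" "Suc (card D) = m"
      using \<open>m > 1\<close> by (auto simp: D_def p_def)
    have "1 / (\<alpha> - a) \<le> n" using n1 n by linarith
    then have gap: "1 \<le> (\<alpha> - a) * n" using a(2) by (simp add: field_simps)
    define T where "T = {0..<n}"
    define JJ where "JJ = {J :: nat set. J \<subseteq> T - S \<and> (- 1 :: real) * card T < card (S \<union> J) \<and> card (S \<union> J) < a * card T}"
    have fin: "finite T" "S \<subseteq> T" "S \<noteq> {}" using S S2 by (auto simp: T_def)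
    let ?G = "gauss ({0..<m} \<times> T)"
    interpret G: prob_space ?G by (rule prob_space_gauss)
    interpret GT: prob_space "gauss T" by (rule prob_space_gauss)
    define Ev where "Ev = {A \<in> space ?G. \<not> cone_kernel {0..<m} T S A}"
    have sEv: "Ev \<in> sets ?G"
    proof -
      have "Ev = space ?G - {A \<in> space ?G. cone_kernel {0..<m} T S A}" by (auto simp: Ev_def)
      then show ?thesis using measurable_cone_kernel[of "{0..<m}" T S] fin by (simp add: sets.compl_sets)
    qed
    have "emeasure (gauss T) {g \<in> space (gauss T). \<exists>J\<in>JJ. face_cell T S J g} \<le> emeasure ?G Ev"
    proof (rule emeasure_disjoint_certs_ge[OF fin(1,2), where cert="\<lambda>J A. under_cert D p T S J A"])
      show JT: "J \<subseteq> T - S" if "J \<in> JJ" for J using that by (simp add: JJ_def)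
      show "\<exists>E\<in>sets ?G. (\<forall>A\<in>E. under_cert D p T S J A) \<and>
         emeasure (gauss T) {g \<in> space (gauss T). face_cell T S J g} \<le> emeasure ?G E" if J: "J \<in> JJ" for J
        unfolding Dp(1)[symmetric]
      proof (rule exists_measurable_under_cert[OF fin(1) Dp(3,2) fin(2,3) JT[OF J]])
        have fSJ: "finite (S \<union> J)" using JT[OF J] fin by (auto intro: finite_subset)
        show "2 \<le> card (S \<union> J)" using S2 card_mono[OF fSJ, of S] by simp
        have "card (S \<union> J) < a * n" using J by (simp add: JJ_def T_def)
        also have "\<dots> < m + 0" using gap mb by (simp add: algebra_simps)
        finally show "card (S \<union> J) \<le> Suc (card D)" unfolding Dp(4) by simp
      qed
      show "J = J'" if "J \<in> JJ" "J' \<in> JJ" "under_cert D p T S J A" "under_cert D p T S J' A" for J J' A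
        by (rule under_cert_unique[OF fin(1) JT[OF that(1)] JT[OF that(2)] fin(2) that(3,4)])
      show "Ev \<in> sets ?G" by (rule sEv)
      show "A \<in> Ev" if J: "J \<in> JJ" and A: "A \<in> space ?G" and cert: "under_cert D p T S J A" for J A
      proof -
        have SJ: "S \<union> J \<subseteq> T" using JT[OF J] fin by auto
        have "\<not> cone_kernel {0..<m} T S A"
          unfolding cone_kernel_def Dp(1)[symmetric]
          using under_cert_trivial_kernel[OF fin(1) Dp(3,2) SJ cert] by blast
        then show ?thesis using A by (simp add: Ev_def)
      qed
    qed
    then have "measure (gauss T) {g \<in> space (gauss T). \<exists>J\<in>JJ. face_cell T S J g} \<le> measure ?G Ev"
      by (simp add: GT.emeasure_eq_measure G.emeasure_eq_measure)
    moreover have "1 - exp (- c * real n) \<le> measure (gauss T) {g \<in> space (gauss T). \<exists>J\<in>JJ. face_cell T S J g}"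
      unfolding JJ_def
    proof (rule cov[rule_format])
      show "n0 \<le> n" using n by simp
      show "finite T \<and> S \<subseteq> T \<and> S \<noteq> {} \<and> \<bar>real (card T) - real n\<bar> \<le> 1 \<and> \<bar>real (card S) - \<beta> * real n\<bar> \<le> 2"
        using fin cS by (auto simp: T_def)
    qed
    ultimately show "1 - exp (- c * real n) \<le> measure (gauss ({0..<nat \<lfloor>\<alpha> * real n\<rfloor>} \<times> {0..<n}))
       {A \<in> space (gauss ({0..<nat \<lfloor>\<alpha> * real n\<rfloor>} \<times> {0..<n})). \<not> cone_kernel {0..<nat \<lfloor>\<alpha> * real n\<rfloor>} {0..<n} S A}"
      unfolding Ev_def m_def T_def by linarith
  qed
qed

lemma nontrivial_kernel_overwhelming:
  fixes \<alpha> \<beta> t1 t2 a :: real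
  assumes \<alpha>: "0 < \<alpha>" and \<beta>: "0 < \<beta>" "\<beta> < 1" and t: "0 < t1" "t1 < t2"
    and D: "\<beta> * t1 - (1 - \<beta>) * (\<integral>x. max 0 (x - t1) \<partial>stdn) < 0"
      "0 < \<beta> * t2 - (1 - \<beta>) * (\<integral>x. max 0 (x - t2) \<partial>stdn)"
    and a: "a < \<beta> + (1 - \<beta>) * measure stdn {t2<..}" "\<alpha> < a"
  shows "\<exists>c>0. \<exists>N. \<forall>n\<ge>N. \<forall>S. S \<subseteq> {0..<n} \<and> card S = nat \<lfloor>\<beta> * real n\<rfloor> \<longrightarrow>
     1 - exp (- c * real n) \<le> measure (gauss ({0..<nat \<lfloor>\<alpha> * real n\<rfloor>} \<times> {0..<n}))
       {A \<in> space (gauss ({0..<nat \<lfloor>\<alpha> * real n\<rfloor>} \<times> {0..<n})). cone_kernel {0..<nat \<lfloor>\<alpha> * real n\<rfloor>} {0..<n} S A}"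
proof -
  \<comment> \<open>The dimension now has to be bounded from below; \<open>2\<close> is an upper
    bound beyond every possible fraction.\<close>
  have "\<beta> + (1 - \<beta>) * measure stdn {t1<..} < 2"
  proof -
    have "(1 - \<beta>) * measure stdn {t1<..} \<le> (1 - \<beta>) * 1"
      using \<beta> prob_space.prob_le_1[OF prob_space_stdn] by (intro mult_left_mono) auto
    then show ?thesis by simp
  qed
  from face_cells_cover[OF \<beta> t D this a(1), where 'a=nat] obtain c n0 where c: "c > 0"
    and cov: "\<forall>n\<ge>n0. \<forall>T S. finite T \<and> S \<subseteq> T \<and> S \<noteq> {} \<and> \<bar>real (card T) - real n\<bar> \<le> 1 \<and> \<bar>real (card S) - \<beta> * real n\<bar> \<le> 2 \<longrightarrow>
     1 - exp (- c * real n) \<le> measure (gauss T) {g \<in> space (gauss T).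
        \<exists>J\<in>{J :: nat set. J \<subseteq> T - S \<and> a * card T < card (S \<union> J) \<and> card (S \<union> J) < (2 :: real) * card T}. face_cell T S J g}"
    by (elim exE conjE) (rule that)
  \<comment> \<open>This threshold yields \<open>\<alpha> * n \<le> a * (n - 1)\<close>, as the
    removal of the distinguished column leaves \<open>n - 1\<close> indices in
    \<open>T\<close>.\<close>
  obtain n1 :: nat where n1: "a / (a - \<alpha>) \<le> n1" using real_arch_simple by blast
  obtain n2 :: nat where n2: "3 / \<beta> \<le> n2" using real_arch_simple by blast
  obtain n3 :: nat where n3: "2 / \<alpha> \<le> n3" using real_arch_simple by blast
  show ?thesis
  proof (intro exI[of _ c] conjI c exI[of _ "max (max n0 n1) (max n2 n3)"] allI impI)
    fix n S assume n: "max (max n0 n1) (max n2 n3) \<le> n" and S': "S \<subseteq> {0..<n} \<and> card S = nat \<lfloor>\<beta> * real n\<rfloor>"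
    define m where "m = nat \<lfloor>\<alpha> * real n\<rfloor>"
    have S: "S \<subseteq> {0..<n}" and cS: "\<beta> * n - 1 < card S" "card S \<le> \<beta> * n"
      using S' nat_floor_bounds[of "\<beta> * n"] \<beta> by auto
    have mb: "\<alpha> * n - 1 < m" "m \<le> \<alpha> * n" using nat_floor_bounds[of "\<alpha> * n"] \<alpha> by (auto simp: m_def)
    have fS: "finite S" using S by (auto intro: finite_subset)
    have "3 / \<beta> \<le> n" using n2 n by linarith
    then have "3 \<le> \<beta> * n" using \<beta> by (simp add: field_simps)
    then have S2: "2 \<le> card S" using cS by linarith
    have "2 / \<alpha> \<le> n" using n3 n by linarith
    then have "2 \<le> \<alpha> * n" using \<alpha> by (simp add: field_simps)
    then have "m > 1" using mb by linarith
    have "a / (a - \<alpha>) \<le> n" using n1 n by linarith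
    then have gap: "a \<le> (a - \<alpha>) * n" using a(2) by (simp add: field_simps)
    \<comment> \<open>The distinguished column is taken from \<open>S\<close>, because the kernel
      vector built from it has a negative entry there.\<close>
    obtain s where s: "s \<in> S" using S2 by (cases "S = {}") auto
    define T where "T = {0..<n} - {s}"
    define S0 where "S0 = S - {s}"
    have ins: "insert s T = {0..<n}" "insert s S0 = S" "s \<notin> T" using s S by (auto simp: T_def S0_def)
    have fin: "finite T" "S0 \<subseteq> T" using S by (auto simp: T_def S0_def)
    have cS0: "real (card S0) = real (card S) - 1" using s fS S2 by (simp add: S0_def card_Diff_singleton of_nat_diff)
    have S0ne: "S0 \<noteq> {}" using cS0 S2 by auto
    have "n \<ge> 1" using s S by auto
    have cT: "real (card T) = real n - 1" using s S \<open>n \<ge> 1\<close> by (auto simp: T_def card_Diff_singleton of_nat_diff)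
    define JJ where "JJ = {J :: nat set. J \<subseteq> T - S0 \<and> a * card T < card (S0 \<union> J) \<and> card (S0 \<union> J) < (2 :: real) * card T}"
    let ?G = "gauss ({0..<m} \<times> insert s T)"
    interpret G: prob_space ?G by (rule prob_space_gauss)
    interpret GT: prob_space "gauss T" by (rule prob_space_gauss)
    define Ev where "Ev = {A \<in> space ?G. cone_kernel {0..<m} (insert s T) (insert s S0) A}"
    have sEv: "Ev \<in> sets ?G"
      unfolding Ev_def using fin by (intro measurable_cone_kernel) auto
    have "emeasure (gauss T) {g \<in> space (gauss T). \<exists>J\<in>JJ. face_cell T S0 J g} \<le> emeasure ?G Ev"
    proof (rule emeasure_disjoint_certs_ge[OF fin, where cert="\<lambda>J A. over_cert {0..<m} s T S0 J A"])
      show JT: "J \<subseteq> T - S0" if "J \<in> JJ" for J using that by (simp add: JJ_def)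
      show "\<exists>E\<in>sets ?G. (\<forall>A\<in>E. over_cert {0..<m} s T S0 J A) \<and>
         emeasure (gauss T) {g \<in> space (gauss T). face_cell T S0 J g} \<le> emeasure ?G E" if J: "J \<in> JJ" for J
      proof (rule exists_measurable_over_cert[OF fin(1) _ _ ins(3) fin(2) S0ne JT[OF J]])
        have "m \<le> a * (real n - 1)" using mb gap by (simp add: algebra_simps)
        also have "\<dots> < card (S0 \<union> J)" using J cT by (simp add: JJ_def)
        finally show "card {0..<m} < card (S0 \<union> J)" by simp
      qed (use \<open>m > 1\<close> in auto)
      show "J = J'" if "J \<in> JJ" "J' \<in> JJ" "over_cert {0..<m} s T S0 J A" "over_cert {0..<m} s T S0 J' A" for J J' A
        by (rule over_cert_unique[OF fin(1) JT[OF that(1)] JT[OF that(2)] fin(2) that(3,4)])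
      show "Ev \<in> sets ?G" by (rule sEv)
      show "A \<in> Ev" if J: "J \<in> JJ" and A: "A \<in> space ?G" and cert: "over_cert {0..<m} s T S0 J A" for J A
      proof -
        have SJ: "S0 \<union> J \<subseteq> T" using JT[OF J] fin by auto
        have "cone_kernel {0..<m} (insert s T) (insert s S0) A"
          unfolding cone_kernel_def using over_cert_nontrivial_kernel[OF fin(1) ins(3) SJ cert] by blast
        then show ?thesis using A by (simp add: Ev_def)
      qed
    qed
    then have "measure (gauss T) {g \<in> space (gauss T). \<exists>J\<in>JJ. face_cell T S0 J g} \<le> measure ?G Ev"
      by (simp add: GT.emeasure_eq_measure G.emeasure_eq_measure)
    moreover have "1 - exp (- c * real n) \<le> measure (gauss T) {g \<in> space (gauss T). \<exists>J\<in>JJ. face_cell T S0 J g}"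
      unfolding JJ_def
    proof (rule cov[rule_format])
      show "n0 \<le> n" using n by simp
      show "finite T \<and> S0 \<subseteq> T \<and> S0 \<noteq> {} \<and> \<bar>real (card T) - real n\<bar> \<le> 1 \<and> \<bar>real (card S0) - \<beta> * real n\<bar> \<le> 2"
        using fin S0ne cT cS0 cS by auto
    qed
    ultimately show "1 - exp (- c * real n) \<le> measure (gauss ({0..<nat \<lfloor>\<alpha> * real n\<rfloor>} \<times> {0..<n}))
       {A \<in> space (gauss ({0..<nat \<lfloor>\<alpha> * real n\<rfloor>} \<times> {0..<n})). cone_kernel {0..<nat \<lfloor>\<alpha> * real n\<rfloor>} {0..<n} S A}"
      unfolding Ev_def ins m_def by linarith
  qed
qed

theorem theorem5:
  fixes \<alpha> \<beta> :: real
    and \<epsilon>1c \<epsilon>2c \<epsilon>1m \<epsilon>1g \<epsilon>3g :: real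
    and \<theta>1 \<theta>2 :: real
  assumes "0 < \<alpha>" "\<alpha> < 1" "0 < \<beta>" "\<beta> < 1"
    and "0 < \<epsilon>1c" "\<epsilon>1c < 1" "0 < \<epsilon>2c" "\<epsilon>2c < 1" "0 < \<epsilon>1m" "\<epsilon>1m < 1"
    and "0 < \<epsilon>1g" "\<epsilon>1g < 1" "0 < \<epsilon>3g" "\<epsilon>3g < 1"
  shows
   "(theta_eq_solution \<epsilon>1c \<epsilon>1c \<beta> \<theta>1 \<and>
     \<alpha> > (1 - \<beta>) / sqrt (2 * pi) * sqrt (2 * (gw \<beta> \<theta>1)\<^sup>2) / exp ((gw \<beta> \<theta>1)\<^sup>2) + \<theta>1
           - ((1 - \<beta>) * sqrt (1 / (2 * pi)) * exp (- (gw \<beta> \<theta>1)\<^sup>2))\<^sup>2 / \<theta>1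
     \<longrightarrow>
     (\<exists>c>0. \<exists>N. \<forall>n\<ge>N. \<forall>S. S \<subseteq> {0..<n} \<and> card S = nat \<lfloor>\<beta> * real n\<rfloor> \<longrightarrow>
        measure (gaussian_matrix (nat \<lfloor>\<alpha> * real n\<rfloor>) n)
          {A \<in> space (gaussian_matrix (nat \<lfloor>\<alpha> * real n\<rfloor>) n).
             \<forall>x. (\<forall>i<n. i \<notin> S \<longrightarrow> x i = 0) \<and> (\<forall>i\<in>S. 0 \<le> x i) \<longrightarrow>
                 unique_pos_l1_solution (nat \<lfloor>\<alpha> * real n\<rfloor>) n A x}
        \<ge> 1 - exp (- c * real n)))
  \<and>
   (theta_eq_solution (- \<epsilon>2c) (- \<epsilon>2c) \<beta> \<theta>2 \<and>
     \<alpha> < 1 / (1 + \<epsilon>1m)\<^sup>2 *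
           ((1 - \<epsilon>1g) * (\<theta>2 + (1 - \<beta>) / sqrt (2 * pi) * sqrt (2 * (gw \<beta> \<theta>2)\<^sup>2)
                                     / exp ((gw \<beta> \<theta>2)\<^sup>2))
            - (1 + \<epsilon>3g)\<^sup>2 * ((1 - \<beta>) * sqrt (1 / (2 * pi)) * exp (- (gw \<beta> \<theta>2)\<^sup>2))\<^sup>2 / \<theta>2)
     \<longrightarrow>
     (\<exists>c>0. \<exists>N. \<forall>n\<ge>N. \<forall>S. S \<subseteq> {0..<n} \<and> card S = nat \<lfloor>\<beta> * real n\<rfloor> \<longrightarrow>
        measure (gaussian_matrix (nat \<lfloor>\<alpha> * real n\<rfloor>) n)
          {A \<in> space (gaussian_matrix (nat \<lfloor>\<alpha> * real n\<rfloor>) n).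
             \<exists>x. (\<forall>i<n. i \<notin> S \<longrightarrow> x i = 0) \<and> (\<forall>i\<in>S. 0 < x i) \<and>
                 \<not> unique_pos_l1_solution (nat \<lfloor>\<alpha> * real n\<rfloor>) n A x}
        \<ge> 1 - exp (- c * real n)))"
proof -
  interpret threshold \<beta> using assms by unfold_locales
  show ?thesis
  proof (intro conjI impI)
    assume h: "theta_eq_solution \<epsilon>1c \<epsilon>1c \<beta> \<theta>1 \<and>
     \<alpha> > (1 - \<beta>) / sqrt (2 * pi) * sqrt (2 * (gw \<beta> \<theta>1)\<^sup>2) / exp ((gw \<beta> \<theta>1)\<^sup>2) + \<theta>1
           - ((1 - \<beta>) * sqrt (1 / (2 * pi)) * exp (- (gw \<beta> \<theta>1)\<^sup>2))\<^sup>2 / \<theta>1"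
    obtain s where "Df s < 0" "Bd s < \<alpha>"
      using theta_eq_part1[OF assms(5,6) conjunct1[OF h] conjunct2[OF h]] by blast
    then obtain t1 t2 a where t: "0 < t1" "t1 < t2" "Df t1 < 0" "0 < Df t2" "Th t1 < a" "a < \<alpha>"
      using above_threshold by blast
    from trivial_kernel_overwhelming[OF assms(1,3,4) t(1,2) t(3,4)[unfolded Df_eq] t(5)[unfolded Th_def gtail_def] t(6)]
    show "\<exists>c>0. \<exists>N. \<forall>n\<ge>N. \<forall>S. S \<subseteq> {0..<n} \<and> card S = nat \<lfloor>\<beta> * real n\<rfloor> \<longrightarrow>
        measure (gaussian_matrix (nat \<lfloor>\<alpha> * real n\<rfloor>) n)
          {A \<in> space (gaussian_matrix (nat \<lfloor>\<alpha> * real n\<rfloor>) n).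
             \<forall>x. (\<forall>i<n. i \<notin> S \<longrightarrow> x i = 0) \<and> (\<forall>i\<in>S. 0 \<le> x i) \<longrightarrow>
                 unique_pos_l1_solution (nat \<lfloor>\<alpha> * real n\<rfloor>) n A x}
        \<ge> 1 - exp (- c * real n)"
      unfolding gaussian_matrix_eq_gauss by (simp add: all_unique_iff cong: conj_cong imp_cong)
  next
    assume h: "theta_eq_solution (- \<epsilon>2c) (- \<epsilon>2c) \<beta> \<theta>2 \<and>
     \<alpha> < 1 / (1 + \<epsilon>1m)\<^sup>2 *
           ((1 - \<epsilon>1g) * (\<theta>2 + (1 - \<beta>) / sqrt (2 * pi) * sqrt (2 * (gw \<beta> \<theta>2)\<^sup>2)
                                     / exp ((gw \<beta> \<theta>2)\<^sup>2))
            - (1 + \<epsilon>3g)\<^sup>2 * ((1 - \<beta>) * sqrt (1 / (2 * pi)) * exp (- (gw \<beta> \<theta>2)\<^sup>2))\<^sup>2 / \<theta>2)"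
    obtain s where "0 < Df s" "\<alpha> < Bd s"
      using theta_eq_part2[OF assms(7,8) conjunct1[OF h] assms(9,11,12,13,1) conjunct2[OF h]] by blast
    then obtain t1 t2 a where t: "0 < t1" "t1 < t2" "Df t1 < 0" "0 < Df t2" "a < Th t2" "\<alpha> < a"
      using below_threshold by blast
    from nontrivial_kernel_overwhelming[OF assms(1,3,4) t(1,2) t(3,4)[unfolded Df_eq] t(5)[unfolded Th_def gtail_def] t(6)]
    show "\<exists>c>0. \<exists>N. \<forall>n\<ge>N. \<forall>S. S \<subseteq> {0..<n} \<and> card S = nat \<lfloor>\<beta> * real n\<rfloor> \<longrightarrow>
        measure (gaussian_matrix (nat \<lfloor>\<alpha> * real n\<rfloor>) n)
          {A \<in> space (gaussian_matrix (nat \<lfloor>\<alpha> * real n\<rfloor>) n).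
             \<exists>x. (\<forall>i<n. i \<notin> S \<longrightarrow> x i = 0) \<and> (\<forall>i\<in>S. 0 < x i) \<and>
                 \<not> unique_pos_l1_solution (nat \<lfloor>\<alpha> * real n\<rfloor>) n A x}
        \<ge> 1 - exp (- c * real n)"
      unfolding gaussian_matrix_eq_gauss by (simp add: ex_not_unique_iff cong: conj_cong imp_cong)
  qed
qed

end
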